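(* Let $A$ be a commutative ring in which $2$ is invertible. If $\mathrm{Rq}(A)=A$, then for every analytic functor $F:\mathbf{P}(A)\to\mathbf{Ab}$ the canonical morphism $$\operatorname{colim}_{n\in\mathbb{N}}F(A^n)_{O_n(A)}\simeq H_0(\mathbf{H}^T(\mathcal{A});i^*\pi^*F)\to H_0(\mathcal{A}^T;\pi^*F)\simeq\mathbb{Z}[S^2_A]^\vee\underset{\mathbf{P}(A)}{\otimes}F$$ induced by the inclusion $i:\mathbf{H}^T(\mathcal{A})\to\mathcal{A}^T$ is an isomorphism.
   Context: $\mathcal{A}=\mathbf{P}(A)$ is (a skeleton of) the category of finitely generated projective $A$-modules. $rq(A)$ is the set of $x\in A$ such that $1-x^2$ is a sum of squares in $A$, and $\mathrm{Rq}(A)$ is the set of (finite) sums of elements of $rq(A)$ (a subring of $A$). $O_n(A)$ is the orthogonal group of the form $\varepsilon_n=\sum_{i=1}^nX_i^2$ on $A^n$; it acts on $F(A^n)$ by functoriality, the subscript $O_n(A)$ denotes coinvariants, and the transition maps are given by $A^n\to A^{n+1}$, $g\mapsto g\oplus1$. For $V\in\mathbf{P}(A)$, $T(V)$ is the additive monoid of quadratic forms on $V$ which are sums of squares of linear forms on $V$ (equivalently, forms $q$ such that $(V,q)$ admits a form-preserving linear map to some $(A^n,\varepsilon_n)$). $\mathcal{A}^T$ is the category of pairs $(V,q)$ with $V\in\mathbf{P}(A)$, $q\in T(V)$, with morphisms the $A$-linear maps preserving the forms; $\pi:\mathcal{A}^T\to\mathcal{A}$ is the forgetful functor; $\mathbf{H}^T(\mathcal{A})$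 is the full subcategory of pairs with $q$ non-degenerate (i.e. the associated map $V\to V^*$ is an isomorphism). $\mathbb{Z}[S^2_A]^\vee$ is the functor $V\mapsto\mathbb{Z}[S^2_A(V^* )]$ with $V^*=\mathrm{Hom}_A(V,A)$, i.e. the free abelian group on the set of all quadratic forms on $V$. For a functor $\varphi$, $\varphi^*$ is precomposition by $\varphi$. For a small category $\mathcal{C}$, $G:\mathcal{C}^{op}\to\mathbf{Ab}$ and $F:\mathcal{C}\to\mathbf{Ab}$, $G\otimes_{\mathcal{C}}F$ is the coend of $(a,b)\mapsto G(a)\otimes F(b)$, and $H_0(\mathcal{C};F)=\mathbb{Z}\otimes_{\mathcal{C}}F$ (the colimit of $F$). The map $H_0(\mathcal{A}^T;\pi^*F)\simeq\mathbb{Z}[T]\otimes_{\mathcal{A}}F\to\mathbb{Z}[S^2_A]^\vee\otimes_{\mathcal{A}}F$ induced by the inclusion of $T$ in the functor of all quadratic forms is an isomorphism, and is the last identification in the statement. For a finite set $E$ and $I\subset E$, let $u_I:V\to V^{\oplus E}$ be the morphism whose component of index $e$ is the identity if $e\in I$ and $0$ otherwise. $F$ is polynomial of degree at most $d$ if $\sum_{I\subset E}(-1)^{\#I}F(u_I)=0$ for $E$ with $d+1$ elements; it is polynomial if this holds for some $d$; it is analytic if it is a colimit of polynomial functors. *)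

theory Defs
  imports "HOL-Algebra.Module" "HOL-Algebra.Coset" "HOL-Algebra.Free_Abelian_Groups"
begin

section \<open>Small categories and functors to abelian groups\<close>

text \<open>Arrow sets for different pairs of objects need not be disjoint, so every operation on
  arrows takes the objects as arguments: \<open>Cmp C X Y Z g f\<close> is the composite of \<open>f : X \<rightarrow> Y\<close>
  and \<open>g : Y \<rightarrow> Z\<close>.\<close>

record ('o, 'm) small_cat =
  Ob :: "'o set"
  Arr :: "'o \<Rightarrow> 'o \<Rightarrow> 'm set"
  Idn :: "'o \<Rightarrow> 'm"
  Cmp :: "'o \<Rightarrow> 'o \<Rightarrow> 'o \<Rightarrow> 'm \<Rightarrow> 'm \<Rightarrow> 'm"

definition small_category :: "('o, 'm) small_cat \<Rightarrow> bool" where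
  "small_category C \<longleftrightarrow>
     (\<forall>X\<in>Ob C. Idn C X \<in> Arr C X X) \<and>
     (\<forall>X\<in>Ob C. \<forall>Y\<in>Ob C. \<forall>Z\<in>Ob C. \<forall>f\<in>Arr C X Y. \<forall>g\<in>Arr C Y Z.
        Cmp C X Y Z g f \<in> Arr C X Z) \<and>
     (\<forall>X\<in>Ob C. \<forall>Y\<in>Ob C. \<forall>f\<in>Arr C X Y.
        Cmp C X X Y f (Idn C X) = f \<and> Cmp C X Y Y (Idn C Y) f = f) \<and>
     (\<forall>X\<in>Ob C. \<forall>Y\<in>Ob C. \<forall>Z\<in>Ob C. \<forall>W\<in>Ob C.
        \<forall>f\<in>Arr C X Y. \<forall>g\<in>Arr C Y Z. \<forall>h\<in>Arr C Z W.
        Cmp C X Z W h (Cmp C X Y Z g f) = Cmp C X Y W (Cmp C Y Z W h g) f)"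

definition full_subcategory :: "('o, 'm) small_cat \<Rightarrow> ('o \<Rightarrow> bool) \<Rightarrow> ('o, 'm) small_cat" where
  "full_subcategory C Q = C\<lparr>Ob := {X \<in> Ob C. Q X}\<rparr>"

text \<open>Abelian groups are the multiplicatively written \<open>comm_group\<close>s of the library.
  For a contravariant functor \<open>G\<close> and \<open>f : X \<rightarrow> Y\<close>, the map \<open>far G X Y f\<close> goes from
  \<open>fob G Y\<close> to \<open>fob G X\<close>.\<close>

record ('o, 'm, 'g) ab_functor =
  fob :: "'o \<Rightarrow> 'g monoid"
  far :: "'o \<Rightarrow> 'o \<Rightarrow> 'm \<Rightarrow> 'g \<Rightarrow> 'g"

definition is_functor :: "('o, 'm) small_cat \<Rightarrow> ('o, 'm, 'g) ab_functor \<Rightarrow> bool" where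
  "is_functor C F \<longleftrightarrow>
     (\<forall>X\<in>Ob C. comm_group (fob F X)) \<and>
     (\<forall>X\<in>Ob C. \<forall>Y\<in>Ob C. \<forall>f\<in>Arr C X Y. far F X Y f \<in> hom (fob F X) (fob F Y)) \<and>
     (\<forall>X\<in>Ob C. \<forall>x\<in>carrier (fob F X). far F X X (Idn C X) x = x) \<and>
     (\<forall>X\<in>Ob C. \<forall>Y\<in>Ob C. \<forall>Z\<in>Ob C. \<forall>f\<in>Arr C X Y. \<forall>g\<in>Arr C Y Z. \<forall>x\<in>carrier (fob F X).
        far F X Z (Cmp C X Y Z g f) x = far F Y Z g (far F X Y f x))"

definition nat_trans ::
  "('o, 'm) small_cat \<Rightarrow> ('o, 'm, 'g) ab_functor \<Rightarrow> ('o, 'm, 'h) ab_functor \<Rightarrow> ('o \<Rightarrow> 'g \<Rightarrow> 'h) \<Rightarrow> bool"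
where
  "nat_trans C F G \<tau> \<longleftrightarrow>
     (\<forall>X\<in>Ob C. \<tau> X \<in> hom (fob F X) (fob G X)) \<and>
     (\<forall>X\<in>Ob C. \<forall>Y\<in>Ob C. \<forall>f\<in>Arr C X Y. \<forall>x\<in>carrier (fob F X).
        \<tau> Y (far F X Y f x) = far G X Y f (\<tau> X x))"

text \<open>Precomposition with a functor given by its effect on objects and on arrows.\<close>

definition precomp ::
  "('p \<Rightarrow> 'o) \<Rightarrow> ('n \<Rightarrow> 'm) \<Rightarrow> ('o, 'm, 'g) ab_functor \<Rightarrow> ('p, 'n, 'g) ab_functor" where
  "precomp \<phi> \<phi>' F =
     \<lparr>fob = (\<lambda>X. fob F (\<phi> X)), far = (\<lambda>X Y f. far F (\<phi> X) (\<phi> Y) (\<phi>' f))\<rparr>"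


section \<open>Colimits and tensor products over a category\<close>

definition presented :: "'s set \<Rightarrow> ('s \<Rightarrow>\<^sub>0 int) set \<Rightarrow> ('s \<Rightarrow>\<^sub>0 int) set monoid" where
  "presented S Rel = free_Abelian_group S Mod generate (free_Abelian_group S) Rel"

definition gen_class :: "'s set \<Rightarrow> ('s \<Rightarrow>\<^sub>0 int) set \<Rightarrow> 's \<Rightarrow> ('s \<Rightarrow>\<^sub>0 int) set" where
  "gen_class S Rel s =
     generate (free_Abelian_group S) Rel #>\<^bsub>free_Abelian_group S\<^esub> frag_of s"

definition colim_gens :: "('o, 'm) small_cat \<Rightarrow> ('o, 'm, 'g) ab_functor \<Rightarrow> ('o \<times> 'g) set" where
  "colim_gens C F = {(X, x). X \<in> Ob C \<and> x \<in> carrier (fob F X)}"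

definition colim_rels ::
  "('o, 'm) small_cat \<Rightarrow> ('o, 'm, 'g) ab_functor \<Rightarrow> (('o \<times> 'g) \<Rightarrow>\<^sub>0 int) set" where
  "colim_rels C F =
     {frag_of (X, x \<otimes>\<^bsub>fob F X\<^esub> y) - frag_of (X, x) - frag_of (X, y) | X x y.
        X \<in> Ob C \<and> x \<in> carrier (fob F X) \<and> y \<in> carrier (fob F X)} \<union>
     {frag_of (Y, far F X Y f x) - frag_of (X, x) | X Y f x.
        X \<in> Ob C \<and> Y \<in> Ob C \<and> f \<in> Arr C X Y \<and> x \<in> carrier (fob F X)}"

definition colim ::
  "('o, 'm) small_cat \<Rightarrow> ('o, 'm, 'g) ab_functor \<Rightarrow> (('o \<times> 'g) \<Rightarrow>\<^sub>0 int) set monoid" where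
  "colim C F = presented (colim_gens C F) (colim_rels C F)"

definition colim_class ::
  "('o, 'm) small_cat \<Rightarrow> ('o, 'm, 'g) ab_functor \<Rightarrow> 'o \<Rightarrow> 'g \<Rightarrow> (('o \<times> 'g) \<Rightarrow>\<^sub>0 int) set" where
  "colim_class C F X x = gen_class (colim_gens C F) (colim_rels C F) (X, x)"

abbreviation (input) H0 ::
  "('o, 'm) small_cat \<Rightarrow> ('o, 'm, 'g) ab_functor \<Rightarrow> (('o \<times> 'g) \<Rightarrow>\<^sub>0 int) set monoid" where
  "H0 \<equiv> colim"

text \<open>\<open>G \<otimes>\<^sub>C F\<close>, the coend of \<open>G(a) \<otimes> F(b)\<close>: a generator \<open>(X, g, x)\<close> stands for
  \<open>g \<otimes> x\<close> in the summand \<open>G(X) \<otimes> F(X)\<close>; the first two families of relations are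
  biadditivity, the third one is the coend relation.\<close>

definition tensor_gens ::
  "('o, 'm) small_cat \<Rightarrow> ('o, 'm, 'h) ab_functor \<Rightarrow> ('o, 'm, 'g) ab_functor \<Rightarrow> ('o \<times> 'h \<times> 'g) set"
where
  "tensor_gens C G F =
     {(X, g, x). X \<in> Ob C \<and> g \<in> carrier (fob G X) \<and> x \<in> carrier (fob F X)}"

definition tensor_rels ::
  "('o, 'm) small_cat \<Rightarrow> ('o, 'm, 'h) ab_functor \<Rightarrow> ('o, 'm, 'g) ab_functor
     \<Rightarrow> (('o \<times> 'h \<times> 'g) \<Rightarrow>\<^sub>0 int) set" where
  "tensor_rels C G F =
     {frag_of (X, g \<otimes>\<^bsub>fob G X\<^esub> h, x) - frag_of (X, g, x) - frag_of (X, h, x) | X g h x.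
        X \<in> Ob C \<and> g \<in> carrier (fob G X) \<and> h \<in> carrier (fob G X) \<and> x \<in> carrier (fob F X)} \<union>
     {frag_of (X, g, x \<otimes>\<^bsub>fob F X\<^esub> y) - frag_of (X, g, x) - frag_of (X, g, y) | X g x y.
        X \<in> Ob C \<and> g \<in> carrier (fob G X) \<and> x \<in> carrier (fob F X) \<and> y \<in> carrier (fob F X)} \<union>
     {frag_of (X, far G X Y f g, x) - frag_of (Y, g, far F X Y f x) | X Y f g x.
        X \<in> Ob C \<and> Y \<in> Ob C \<and> f \<in> Arr C X Y \<and> g \<in> carrier (fob G Y) \<and> x \<in> carrier (fob F X)}"

definition tensor ::
  "('o, 'm) small_cat \<Rightarrow> ('o, 'm, 'h) ab_functor \<Rightarrow> ('o, 'm, 'g) ab_functor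
     \<Rightarrow> (('o \<times> 'h \<times> 'g) \<Rightarrow>\<^sub>0 int) set monoid" where
  "tensor C G F = presented (tensor_gens C G F) (tensor_rels C G F)"

definition tensor_class ::
  "('o, 'm) small_cat \<Rightarrow> ('o, 'm, 'h) ab_functor \<Rightarrow> ('o, 'm, 'g) ab_functor
     \<Rightarrow> 'o \<Rightarrow> 'h \<Rightarrow> 'g \<Rightarrow> (('o \<times> 'h \<times> 'g) \<Rightarrow>\<^sub>0 int) set" where
  "tensor_class C G F X g x = gen_class (tensor_gens C G F) (tensor_rels C G F) (X, g, x)"


section \<open>Finitely generated projective modules\<close>

definition lin_maps ::
  "('a, 'r) ring_scheme \<Rightarrow> ('a, 'v, 's) module_scheme \<Rightarrow> ('a, 'w, 't) module_scheme \<Rightarrow> ('v \<Rightarrow> 'w) set"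
where
  "lin_maps R V W =
     {f \<in> carrier V \<rightarrow>\<^sub>E carrier W.
        (\<forall>v\<in>carrier V. \<forall>w\<in>carrier V. f (v \<oplus>\<^bsub>V\<^esub> w) = f v \<oplus>\<^bsub>W\<^esub> f w) \<and>
        (\<forall>a\<in>carrier R. \<forall>v\<in>carrier V. f (a \<odot>\<^bsub>V\<^esub> v) = a \<odot>\<^bsub>W\<^esub> f v)}"

text \<open>\<open>A\<^sup>n\<close> consists of sequences vanishing from index \<open>n\<close> on, so that the standard inclusion
  of \<open>A\<^sup>m\<close> into \<open>A\<^sup>n\<close> is the identity on elements. The multiplicative fields of a module
  record carry no meaning.\<close>

definition free_mod :: "('a, 'r) ring_scheme \<Rightarrow> nat \<Rightarrow> ('a, nat \<Rightarrow> 'a) module" where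
  "free_mod R n =
     \<lparr>carrier = {v. (\<forall>i<n. v i \<in> carrier R) \<and> (\<forall>i\<ge>n. v i = \<zero>\<^bsub>R\<^esub>)},
      monoid.mult = undefined, one = undefined,
      ring.zero = (\<lambda>i. \<zero>\<^bsub>R\<^esub>), add = (\<lambda>v w i. v i \<oplus>\<^bsub>R\<^esub> w i),
      smult = (\<lambda>a v i. a \<otimes>\<^bsub>R\<^esub> v i)\<rparr>"

text \<open>Finitely generated projective means: direct factor of some \<open>A\<^sup>n\<close>. Every such module
  embeds in a set of sequences, so that the modules whose elements are of type
  \<^typ>\<open>nat \<Rightarrow> 'a\<close> form a small category equivalent to the category of all finitely generated
  projective modules.\<close>

definition fg_projective :: "('a, 'r) ring_scheme \<Rightarrow> ('a, 'v, 's) module_scheme \<Rightarrow> bool" where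
  "fg_projective R V \<longleftrightarrow> module R V \<and>
     (\<exists>n. \<exists>s\<in>lin_maps R V (free_mod R n). \<exists>r\<in>lin_maps R (free_mod R n) V.
        \<forall>v\<in>carrier V. r (s v) = v)"

type_synonym 'a pobj = "('a, nat \<Rightarrow> 'a) module"
type_synonym 'a parr = "(nat \<Rightarrow> 'a) \<Rightarrow> (nat \<Rightarrow> 'a)"
type_synonym 'a qform = "(nat \<Rightarrow> 'a) \<Rightarrow> 'a"

definition proj_cat :: "('a, 'r) ring_scheme \<Rightarrow> ('a pobj, 'a parr) small_cat" where
  "proj_cat R =
     \<lparr>Ob = {V. fg_projective R V}, Arr = lin_maps R,
      Idn = (\<lambda>V. \<lambda>v\<in>carrier V. v), Cmp = (\<lambda>U V W g f. compose (carrier U) g f)\<rparr>"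


section \<open>Polynomial and analytic functors\<close>

text \<open>\<open>W\<close> with projections \<open>p e\<close> is the module \<open>V\<^bsup>\<oplus>E\<^esup>\<close>, which is only determined up to
  isomorphism.\<close>

definition is_power ::
  "('a, 'r) ring_scheme \<Rightarrow> 'a pobj \<Rightarrow> nat set \<Rightarrow> 'a pobj \<Rightarrow> (nat \<Rightarrow> 'a parr) \<Rightarrow> bool" where
  "is_power R V E W p \<longleftrightarrow>
     (\<forall>e\<in>E. p e \<in> lin_maps R W V) \<and>
     bij_betw (\<lambda>w. \<lambda>e\<in>E. p e w) (carrier W) (E \<rightarrow>\<^sub>E carrier V)"

definition polynomial_of_degree_le ::
  "('a, 'r) ring_scheme \<Rightarrow> ('a pobj, 'a parr, 'g) ab_functor \<Rightarrow> nat \<Rightarrow> bool" where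
  "polynomial_of_degree_le R F d \<longleftrightarrow>
     (\<forall>E V W p u.
        finite E \<and> card E = d + 1 \<and> V \<in> Ob (proj_cat R) \<and> W \<in> Ob (proj_cat R) \<and>
        is_power R V E W p \<and>
        (\<forall>I\<subseteq>E. u I \<in> lin_maps R V W \<and>
           (\<forall>e\<in>E. \<forall>v\<in>carrier V. p e (u I v) = (if e \<in> I then v else \<zero>\<^bsub>V\<^esub>)))
        \<longrightarrow> (\<forall>x\<in>carrier (fob F V).
              finprod (fob F W)
                (\<lambda>I. far F V W (u I) x [^]\<^bsub>fob F W\<^esub> ((-1) ^ card I :: int)) (Pow E)
              = \<one>\<^bsub>fob F W\<^esub>))"

definition polynomial_functor ::
  "('a, 'r) ring_scheme \<Rightarrow> ('a pobj, 'a parr, 'g) ab_functor \<Rightarrow> bool" where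
  "polynomial_functor R F \<longleftrightarrow> (\<exists>d. polynomial_of_degree_le R F d)"

text \<open>\<open>F\<close> is the colimit, with coprojections \<open>\<iota> j\<close>, of the diagram of functors \<open>D j\<close> indexed
  by the small category \<open>J\<close>, with transition maps \<open>t j k a\<close>. Colimits in the functor
  category are pointwise.\<close>

definition is_functor_colimit ::
  "('o, 'm) small_cat \<Rightarrow> ('j, 'k) small_cat \<Rightarrow> ('j \<Rightarrow> ('o, 'm, 'h) ab_functor)
     \<Rightarrow> ('j \<Rightarrow> 'j \<Rightarrow> 'k \<Rightarrow> 'o \<Rightarrow> 'h \<Rightarrow> 'h) \<Rightarrow> ('o, 'm, 'g) ab_functor \<Rightarrow> ('j \<Rightarrow> 'o \<Rightarrow> 'h \<Rightarrow> 'g) \<Rightarrow> bool"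
where
  "is_functor_colimit C J D t F \<iota> \<longleftrightarrow>
     small_category J \<and>
     (\<forall>j\<in>Ob J. is_functor C (D j)) \<and>
     (\<forall>j\<in>Ob J. \<forall>k\<in>Ob J. \<forall>a\<in>Arr J j k. nat_trans C (D j) (D k) (t j k a)) \<and>
     (\<forall>j\<in>Ob J. nat_trans C (D j) F (\<iota> j)) \<and>
     (\<forall>V\<in>Ob C.
        let DV = \<lparr>fob = (\<lambda>j. fob (D j) V), far = (\<lambda>j k a. t j k a V)\<rparr> in
        is_functor J DV \<and>
        (\<exists>\<phi>\<in>iso (colim J DV) (fob F V).
           \<forall>j\<in>Ob J. \<forall>x\<in>carrier (fob (D j) V). \<phi> (colim_class J DV j x) = \<iota> j V x))"

text \<open>The type argument bounds the size of the indexing category and of the groups in the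
  diagram. In a theorem assuming analyticity at free type variables, these are arbitrary.\<close>

definition analytic ::
  "('j \<times> 'k \<times> 'h) itself \<Rightarrow> ('a, 'r) ring_scheme \<Rightarrow> ('a pobj, 'a parr, 'g) ab_functor \<Rightarrow> bool"
where
  "analytic _ R F \<longleftrightarrow>
     (\<exists>(J :: ('j, 'k) small_cat) (D :: 'j \<Rightarrow> ('a pobj, 'a parr, 'h) ab_functor) t \<iota>.
        is_functor_colimit (proj_cat R) J D t F \<iota> \<and> (\<forall>j\<in>Ob J. polynomial_functor R (D j)))"


section \<open>Sums of squares and the subring Rq\<close>

definition fin_sums :: "('a, 'r) ring_scheme \<Rightarrow> 'a set \<Rightarrow> 'a set" where
  "fin_sums R S = {finsum R f {..<n} | f n. f \<in> {..<n :: nat} \<rightarrow> S}"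

definition sums_of_squares :: "('a, 'r) ring_scheme \<Rightarrow> 'a set" where
  "sums_of_squares R = fin_sums R {x \<otimes>\<^bsub>R\<^esub> x | x. x \<in> carrier R}"

definition rq :: "('a, 'r) ring_scheme \<Rightarrow> 'a set" where
  "rq R = {x \<in> carrier R. \<one>\<^bsub>R\<^esub> \<ominus>\<^bsub>R\<^esub> x \<otimes>\<^bsub>R\<^esub> x \<in> sums_of_squares R}"

definition Rq :: "('a, 'r) ring_scheme \<Rightarrow> 'a set" where
  "Rq R = fin_sums R (rq R)"


section \<open>Quadratic forms\<close>

definition ring_as_module :: "('a, 'r) ring_scheme \<Rightarrow> ('a, 'a) module" where
  "ring_as_module R =
     \<lparr>carrier = carrier R, monoid.mult = monoid.mult R, one = one R, ring.zero = ring.zero R, add = add R,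
      smult = monoid.mult R\<rparr>"

definition dual :: "('a, 'r) ring_scheme \<Rightarrow> 'a pobj \<Rightarrow> 'a qform set" where
  "dual R V = lin_maps R V (ring_as_module R)"

definition polar ::
  "('a, 'r) ring_scheme \<Rightarrow> 'a pobj \<Rightarrow> 'a qform \<Rightarrow> (nat \<Rightarrow> 'a) \<Rightarrow> 'a qform" where
  "polar R V q v = (\<lambda>w\<in>carrier V. q (v \<oplus>\<^bsub>V\<^esub> w) \<ominus>\<^bsub>R\<^esub> q v \<ominus>\<^bsub>R\<^esub> q w)"

text \<open>The polar form is symmetric, so linearity in the second argument is bilinearity.\<close>

definition quad_forms :: "('a, 'r) ring_scheme \<Rightarrow> 'a pobj \<Rightarrow> 'a qform set" where
  "quad_forms R V =
     {q \<in> carrier V \<rightarrow>\<^sub>E carrier R.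
        (\<forall>a\<in>carrier R. \<forall>v\<in>carrier V. q (a \<odot>\<^bsub>V\<^esub> v) = (a \<otimes>\<^bsub>R\<^esub> a) \<otimes>\<^bsub>R\<^esub> q v) \<and>
        (\<forall>v\<in>carrier V. polar R V q v \<in> dual R V)}"

text \<open>The polar form is twice the symmetric bilinear form attached to \<open>q\<close>; as 2 is invertible,
  the two have the same non-degenerate forms.\<close>

definition nondegenerate :: "('a, 'r) ring_scheme \<Rightarrow> 'a pobj \<Rightarrow> 'a qform \<Rightarrow> bool" where
  "nondegenerate R V q \<longleftrightarrow> bij_betw (polar R V q) (carrier V) (dual R V)"

definition T_forms :: "('a, 'r) ring_scheme \<Rightarrow> 'a pobj \<Rightarrow> 'a qform set" where
  "T_forms R V =
     {(\<lambda>v\<in>carrier V. finsum R (\<lambda>i. l i v \<otimes>\<^bsub>R\<^esub> l i v) {..<n}) | l n.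
        l \<in> {..<n :: nat} \<rightarrow> dual R V}"

definition eps :: "('a, 'r) ring_scheme \<Rightarrow> nat \<Rightarrow> 'a qform" where
  "eps R n =
     (\<lambda>v\<in>carrier (free_mod R n). finsum R (\<lambda>i. v i \<otimes>\<^bsub>R\<^esub> v i) {..<n})"

definition pullback_form :: "'a pobj \<Rightarrow> 'a parr \<Rightarrow> 'a qform \<Rightarrow> 'a qform" where
  "pullback_form V f q = (\<lambda>v\<in>carrier V. q (f v))"

text \<open>The contravariant functor sending \<open>V\<close> to the free abelian group on \<open>X V\<close>, for a
  functor \<open>X\<close> of quadratic forms.\<close>

definition Z_forms ::
  "('a pobj \<Rightarrow> 'a qform set) \<Rightarrow> ('a pobj, 'a parr, 'a qform \<Rightarrow>\<^sub>0 int) ab_functor" where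
  "Z_forms X =
     \<lparr>fob = (\<lambda>V. free_Abelian_group (X V)),
      far = (\<lambda>V W f. frag_extend (\<lambda>q. frag_of (pullback_form V f q)))\<rparr>"

definition AT :: "('a, 'r) ring_scheme \<Rightarrow> ('a pobj \<times> 'a qform, 'a parr) small_cat" where
  "AT R =
     \<lparr>Ob = {(V, q). V \<in> Ob (proj_cat R) \<and> q \<in> T_forms R V},
      Arr = (\<lambda>(V, q) (W, q'). {f \<in> lin_maps R V W. pullback_form V f q' = q}),
      Idn = (\<lambda>(V, q). Idn (proj_cat R) V),
      Cmp = (\<lambda>(U, q) (V, q') (W, q''). Cmp (proj_cat R) U V W)\<rparr>"

definition HT :: "('a, 'r) ring_scheme \<Rightarrow> ('a pobj \<times> 'a qform, 'a parr) small_cat" where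
  "HT R = full_subcategory (AT R) (\<lambda>(V, q). nondegenerate R V q)"

text \<open>\<open>pi_star F\<close> and \<open>i_star F\<close> are the precompositions with the forgetful functor from
  \<open>AT R\<close> to \<open>proj_cat R\<close> and with the inclusion of \<open>HT R\<close> in \<open>AT R\<close>.\<close>

abbreviation pi_star ::
  "('a pobj, 'a parr, 'g) ab_functor \<Rightarrow> ('a pobj \<times> 'a qform, 'a parr, 'g) ab_functor" where
  "pi_star F \<equiv> precomp fst id F"

abbreviation i_star ::
  "('a pobj \<times> 'a qform, 'a parr, 'g) ab_functor \<Rightarrow> ('a pobj \<times> 'a qform, 'a parr, 'g) ab_functor"
where
  "i_star F \<equiv> precomp id id F"


section \<open>Coinvariants of the orthogonal groups\<close>

definition orth :: "('a, 'r) ring_scheme \<Rightarrow> nat \<Rightarrow> 'a parr set" where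
  "orth R n =
     {g \<in> lin_maps R (free_mod R n) (free_mod R n).
        bij_betw g (carrier (free_mod R n)) (carrier (free_mod R n)) \<and>
        pullback_form (free_mod R n) g (eps R n) = eps R n}"

definition std_incl :: "('a, 'r) ring_scheme \<Rightarrow> nat \<Rightarrow> 'a parr" where
  "std_incl R m = (\<lambda>v\<in>carrier (free_mod R m). v)"

definition coinv_sub ::
  "('a, 'r) ring_scheme \<Rightarrow> ('a pobj, 'a parr, 'g) ab_functor \<Rightarrow> nat \<Rightarrow> 'g set" where
  "coinv_sub R F n =
     (let V = free_mod R n in
      generate (fob F V)
        {far F V V g x \<otimes>\<^bsub>fob F V\<^esub> inv\<^bsub>fob F V\<^esub> x | g x. g \<in> orth R n \<and> x \<in> carrier (fob F V)})"

definition coinv_class ::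
  "('a, 'r) ring_scheme \<Rightarrow> ('a pobj, 'a parr, 'g) ab_functor \<Rightarrow> nat \<Rightarrow> 'g \<Rightarrow> 'g set" where
  "coinv_class R F n x = coinv_sub R F n #>\<^bsub>fob F (free_mod R n)\<^esub> x"

definition nat_cat :: "(nat, unit) small_cat" where
  "nat_cat =
     \<lparr>Ob = UNIV, Arr = (\<lambda>m n. if m \<le> n then {()} else {}), Idn = (\<lambda>_. ()),
      Cmp = (\<lambda>_ _ _ _ _. ())\<rparr>"

text \<open>The value of a transition map on a coset is given as the union of the classes of the
  images of the elements of the coset; all these classes coincide.\<close>

definition coinv_system ::
  "('a, 'r) ring_scheme \<Rightarrow> ('a pobj, 'a parr, 'g) ab_functor \<Rightarrow> (nat, unit, 'g set) ab_functor" where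
  "coinv_system R F =
     \<lparr>fob = (\<lambda>n. fob F (free_mod R n) Mod coinv_sub R F n),
      far = (\<lambda>m n _ X.
        \<Union>x\<in>X. coinv_class R F n (far F (free_mod R m) (free_mod R n) (std_incl R m) x))\<rparr>"


section \<open>The canonical morphisms\<close>

text \<open>Each of the following conditions determines the morphism on the source group, since the
  classes on which it is prescribed generate that group.\<close>

definition is_stabilisation_map where
  "is_stabilisation_map R F \<alpha> \<longleftrightarrow>
     \<alpha> \<in> hom (colim nat_cat (coinv_system R F)) (H0 (HT R) (i_star (pi_star F))) \<and>
     (\<forall>n. \<forall>x\<in>carrier (fob F (free_mod R n)).
        \<alpha> (colim_class nat_cat (coinv_system R F) n (coinv_class R F n x))
        = colim_class (HT R) (i_star (pi_star F)) (free_mod R n, eps R n) x)"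

definition is_inclusion_map where
  "is_inclusion_map R F \<beta> \<longleftrightarrow>
     \<beta> \<in> hom (H0 (HT R) (i_star (pi_star F))) (H0 (AT R) (pi_star F)) \<and>
     (\<forall>(V, q)\<in>Ob (HT R). \<forall>x\<in>carrier (fob F V).
        \<beta> (colim_class (HT R) (i_star (pi_star F)) (V, q) x)
        = colim_class (AT R) (pi_star F) (V, q) x)"

definition is_fibration_map where
  "is_fibration_map R F \<gamma> \<longleftrightarrow>
     \<gamma> \<in> hom (H0 (AT R) (pi_star F)) (tensor (proj_cat R) (Z_forms (T_forms R)) F) \<and>
     (\<forall>(V, q)\<in>Ob (AT R). \<forall>x\<in>carrier (fob F V).
        \<gamma> (colim_class (AT R) (pi_star F) (V, q) x)
        = tensor_class (proj_cat R) (Z_forms (T_forms R)) F V (frag_of q) x)"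

definition is_forms_map where
  "is_forms_map R F \<delta> \<longleftrightarrow>
     \<delta> \<in> hom (tensor (proj_cat R) (Z_forms (T_forms R)) F)
             (tensor (proj_cat R) (Z_forms (quad_forms R)) F) \<and>
     (\<forall>V\<in>Ob (proj_cat R). \<forall>c\<in>carrier (free_Abelian_group (T_forms R V)). \<forall>x\<in>carrier (fob F V).
        \<delta> (tensor_class (proj_cat R) (Z_forms (T_forms R)) F V c x)
        = tensor_class (proj_cat R) (Z_forms (quad_forms R)) F V c x)"

end

(*
  Every object of the category of T-forms maps to some (A^n, eps_n), so all four maps are
  surjective, and it suffices to construct a left inverse of their composite, that is, to recover
  the stable coinvariant class of x in F(A^n) from [eps_n] tensor x.

  For M : V -> A^n the class c(M_* x) depends only on the form |M|^2. Indeed, if Rq(A) = A, each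
  form in T(A^m) is bounded: |M|^2 + |P|^2 = u^2 eps_m for some P and some power u of 2. Given N
  with |N|^2 = |M|^2, the maps (M; P) / u and (N; P) / u are isometries, and isometries become
  conjugate under the orthogonal group after stabilisation, even in presence of further rows P.
  As x has finite degree, an alternating product over the subsets I of a finite set, applied to M
  with the copies of P indexed by I below it, is trivial, and likewise for N; the terms with I
  nonempty agree, hence so do those with I empty.

  The resulting function of t in T(V) is polynomial, and every quadratic form is a difference of
  elements of T(V) as 2 is invertible; hence it extends to all quadratic forms. The same
  polynomiality in the form shows that the last map is surjective.
*)

theory Submission
  imports Defs
begin

section \<open>Quotients and presented groups\<close>

text \<open>The obstacle is that \<open>M\<close> is seldom an isometry, and that adding the rows
  \<open>P\<close> which make it a multiple of one changes the class; finite degree is what allows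
  \<open>P\<close> to be removed again. Rq(A) = A yields \<open>P\<close>: every scalar is a sum of
  elements a for which 1 - a^2 is a sum of squares, and the parallelogram law bounds the square of a
  sum by twice the sum of the squares, so that every form in T has an integer bound C. Enlarging C
  to 4^C = (2^C)^2 makes it the square of a unit. The image of an isometry X splits off
  orthogonally, and an orthogonal involution moves it onto m additional coordinates; what results no
  longer mentions X. As \<open>M\<close> has to occur in every term while copies of \<open>P\<close>
  come and go, degree is measured on cubes whose base block is always filled. It is attached to
  elements rather than to functors: an analytic functor need not have bounded degree, but each of
  its elements is a combination of images of elements of polynomial functors. Projective modules are
  reached as retracts of free ones, so degrees are considered at A^m only.\<close>

lemma comm_group_hom_group_hom:
  assumes "comm_group G" "comm_group H" "h \<in> hom G H"
  shows "group_hom G H h"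
  using assms by (simp add: comm_group_def group_hom_axioms.intro group_hom_def)

lemma quotient_comm_group:
  assumes "comm_group G" "K \<subseteq> carrier G"
  shows "comm_group (G Mod generate G K)"
proof -
  interpret comm_group G by fact
  show ?thesis
    using abelian_FactGroup generate_is_subgroup assms by blast
qed

lemma quotient_hom:
  assumes "comm_group G" "K \<subseteq> carrier G"
  shows "(\<lambda>x. generate G K #>\<^bsub>G\<^esub> x) \<in> hom G (G Mod generate G K)"
proof -
  interpret comm_group G by fact
  have "generate G K \<lhd> G"
    using generate_is_subgroup assms subgroup_imp_normal by blast
  then show ?thesis
    by (rule normal.r_coset_hom_Mod)
qed

lemma quotient_relation:
  assumes "comm_group G" "K \<subseteq> carrier G" "x \<in> K"
  shows "generate G K #>\<^bsub>G\<^esub> x = \<one>\<^bsub>G Mod generate G K\<^esub>"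
proof -
  interpret comm_group G by fact
  have "subgroup (generate G K) G"
    using generate_is_subgroup assms by blast
  moreover have "x \<in> generate G K"
    using assms(3) by (rule generate.incl)
  ultimately have "generate G K #>\<^bsub>G\<^esub> x = generate G K"
    by (simp add: coset_join2 subgroup.mem_carrier)
  then show ?thesis
    by (simp add: FactGroup_def)
qed

text \<open>The kernel of \<open>h\<close> is a subgroup, so it contains the whole subgroup
  generated by \<open>K\<close>, and \<open>h\<close> is constant on cosets.\<close>

lemma quotient_universal:
  assumes G: "comm_group G" and K: "K \<subseteq> carrier G" and H: "comm_group H"
    and h: "h \<in> hom G H" and hK: "\<And>x. x \<in> K \<Longrightarrow> h x = \<one>\<^bsub>H\<^esub>"
  shows "\<exists>g\<in>hom (G Mod generate G K) H. \<forall>x\<in>carrier G. g (generate G K #>\<^bsub>G\<^esub> x) = h x"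
proof -
  interpret comm_group G by fact
  interpret H: comm_group H by fact
  interpret h: group_hom G H h
    using comm_group_hom_group_hom G H h by blast
  have sub: "subgroup (generate G K) G"
    using generate_is_subgroup K by blast
  then have norm: "generate G K \<lhd> G"
    by (rule subgroup_imp_normal)
  have "generate G K \<subseteq> kernel G H h"
    by (rule generate_subgroup_incl) (use K hK in \<open>auto simp: kernel_def h.subgroup_kernel[unfolded kernel_def]\<close>)
  then have ker: "h x = \<one>\<^bsub>H\<^esub>" if "x \<in> generate G K" for x
    using that by (auto simp: kernel_def)
  have eq: "h x = h y"
    if "x \<in> carrier G" "y \<in> carrier G" "generate G K #>\<^bsub>G\<^esub> x = generate G K #>\<^bsub>G\<^esub> y" for x y
  proof -
    have "x \<in> generate G K #>\<^bsub>G\<^esub> y"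
      using that sub by (metis rcos_self)
    then obtain n where n: "n \<in> generate G K" "x = n \<otimes>\<^bsub>G\<^esub> y"
      by (auto simp: r_coset_def)
    then have "h x = h n \<otimes>\<^bsub>H\<^esub> h y"
      using that sub by (simp add: subgroup.mem_carrier)
    then show ?thesis
      using ker n that by simp
  qed
  obtain g where "g \<in> hom (G Mod generate G K) H"
    "\<And>x. x \<in> carrier G \<Longrightarrow> g (generate G K #>\<^bsub>G\<^esub> x) = h x"
    using FactGroup_universal[OF h norm eq] by metis
  then show ?thesis by blast
qed

context
  fixes S :: "'s set" and Rel :: "('s \<Rightarrow>\<^sub>0 int) set"
  assumes Rel: "Rel \<subseteq> carrier (free_Abelian_group S)"
begin

lemma presented_comm_group: "comm_group (presented S Rel)"
  unfolding presented_def
  by (rule quotient_comm_group[OF abelian_free_Abelian_group Rel])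

lemma presented_hom:
  "(\<lambda>c. generate (free_Abelian_group S) Rel #>\<^bsub>free_Abelian_group S\<^esub> c)
     \<in> hom (free_Abelian_group S) (presented S Rel)"
  unfolding presented_def
  by (rule quotient_hom[OF abelian_free_Abelian_group Rel])

lemma gen_class_closed: "s \<in> S \<Longrightarrow> gen_class S Rel s \<in> carrier (presented S Rel)"
  unfolding gen_class_def by (rule hom_in_carrier[OF presented_hom]) simp

lemma gen_class_relation_add:
  assumes r: "frag_of a - frag_of b - frag_of c \<in> Rel" and S: "a \<in> S" "b \<in> S" "c \<in> S"
  shows "gen_class S Rel a = gen_class S Rel b \<otimes>\<^bsub>presented S Rel\<^esub> gen_class S Rel c"
proof -
  let ?G = "free_Abelian_group S" and ?Q = "presented S Rel"
  let ?k = "\<lambda>c. generate ?G Rel #>\<^bsub>?G\<^esub> c"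
  interpret k: group_hom ?G ?Q ?k
    by (rule comm_group_hom_group_hom[OF abelian_free_Abelian_group presented_comm_group presented_hom])
  have "Poly_Mapping.keys (frag_of a - frag_of b - frag_of c) \<subseteq> S"
    using subsetD[OF Rel r] by (simp only: carrier_free_Abelian_group_iff)
  then have "?k ((frag_of a - frag_of b - frag_of c) \<otimes>\<^bsub>?G\<^esub> (frag_of b \<otimes>\<^bsub>?G\<^esub> frag_of c))
     = ?k (frag_of a - frag_of b - frag_of c) \<otimes>\<^bsub>?Q\<^esub> (?k (frag_of b) \<otimes>\<^bsub>?Q\<^esub> ?k (frag_of c))"
    using S comm_groupE(1)[OF abelian_free_Abelian_group[of S], of "frag_of b" "frag_of c"]
    by (simp del: mult_free_Abelian_group)
  moreover have "?k (frag_of a - frag_of b - frag_of c) = \<one>\<^bsub>?Q\<^esub>"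
    using quotient_relation[OF abelian_free_Abelian_group Rel r] by (simp add: presented_def)
  moreover have "?k (frag_of b) \<in> carrier ?Q" "?k (frag_of c) \<in> carrier ?Q"
    using S by auto
  ultimately show ?thesis
    by (simp add: gen_class_def)
qed

lemma gen_class_relation_eq:
  assumes r: "frag_of a - frag_of b \<in> Rel" and S: "a \<in> S" "b \<in> S"
  shows "gen_class S Rel a = gen_class S Rel b"
proof -
  let ?G = "free_Abelian_group S" and ?Q = "presented S Rel"
  let ?k = "\<lambda>c. generate ?G Rel #>\<^bsub>?G\<^esub> c"
  interpret k: group_hom ?G ?Q ?k
    by (rule comm_group_hom_group_hom[OF abelian_free_Abelian_group presented_comm_group presented_hom])
  have "Poly_Mapping.keys (frag_of a - frag_of b) \<subseteq> S"
    using subsetD[OF Rel r] by (simp only: carrier_free_Abelian_group_iff)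
  then have "?k ((frag_of a - frag_of b) \<otimes>\<^bsub>?G\<^esub> frag_of b)
     = ?k (frag_of a - frag_of b) \<otimes>\<^bsub>?Q\<^esub> ?k (frag_of b)"
    using S by (subst k.hom_mult; simp del: mult_free_Abelian_group)
  moreover have "?k (frag_of a - frag_of b) = \<one>\<^bsub>?Q\<^esub>"
    using quotient_relation[OF abelian_free_Abelian_group Rel r] by (simp add: presented_def)
  moreover have "?k (frag_of b) \<in> carrier ?Q"
    using S by auto
  ultimately show ?thesis
    by (simp add: gen_class_def)
qed

text \<open>The step is on quotients because \<open>free_Abelian_group_induct\<close> steps on
  differences; with the unit this covers inverses and products.\<close>

lemma presented_induct:
  assumes z: "z \<in> carrier (presented S Rel)"
    and one: "P \<one>\<^bsub>presented S Rel\<^esub>"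
    and quot: "\<And>x y. x \<in> carrier (presented S Rel) \<Longrightarrow> y \<in> carrier (presented S Rel) \<Longrightarrow>
      P x \<Longrightarrow> P y \<Longrightarrow> P (x \<otimes>\<^bsub>presented S Rel\<^esub> inv\<^bsub>presented S Rel\<^esub> y)"
    and gen: "\<And>s. s \<in> S \<Longrightarrow> P (gen_class S Rel s)"
  shows "P z"
proof -
  let ?G = "free_Abelian_group S" and ?Q = "presented S Rel"
  let ?k = "\<lambda>c. generate ?G Rel #>\<^bsub>?G\<^esub> c"
  interpret k: group_hom ?G ?Q ?k
    by (rule comm_group_hom_group_hom[OF abelian_free_Abelian_group presented_comm_group presented_hom])
  obtain c where c: "c \<in> carrier ?G" "z = ?k c"
    using z by (auto simp: presented_def carrier_FactGroup)
  have "P (?k c)"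
  proof (rule free_Abelian_group_induct[where P = "\<lambda>c. P (?k c)"])
    show "Poly_Mapping.keys c \<subseteq> S"
      using c by simp
    show "P (?k 0)"
      using one k.hom_one by simp
    show "P (?k (frag_of a))" if "a \<in> S" for a
      using gen that by (simp add: gen_class_def)
    fix x y
    assume x: "Poly_Mapping.keys x \<subseteq> S" "P (?k x)" and y: "Poly_Mapping.keys y \<subseteq> S" "P (?k y)"
    have xy: "x \<in> carrier ?G" "y \<in> carrier ?G"
      using x y by simp_all
    then have "?k (x \<otimes>\<^bsub>?G\<^esub> inv\<^bsub>?G\<^esub> y) = ?k x \<otimes>\<^bsub>?Q\<^esub> inv\<^bsub>?Q\<^esub> ?k y"
      by (simp del: mult_free_Abelian_group inv_free_Abelian_group carrier_free_Abelian_group_iff)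
    then show "P (?k (x - y))"
      using quot[OF k.hom_closed[OF xy(1)] k.hom_closed[OF xy(2)]] x y by simp
  qed
  then show ?thesis using c by simp
qed

text \<open>Relators are tested on an arbitrary extension \<open>h\<close> of \<open>f\<close> to
  the free group. A caller thus evaluates \<open>h\<close> on a relator from the values on
  generators, by \<open>hom_frag_relation_add\<close> or
  \<open>hom_frag_relation_eq\<close>.\<close>

lemma presented_universal:
  assumes H: "comm_group H" and f: "\<And>s. s \<in> S \<Longrightarrow> f s \<in> carrier H"
    and rel: "\<And>h r. h \<in> hom (free_Abelian_group S) H \<Longrightarrow> (\<And>s. s \<in> S \<Longrightarrow> h (frag_of s) = f s) \<Longrightarrow>
      r \<in> Rel \<Longrightarrow> h r = \<one>\<^bsub>H\<^esub>"
  shows "\<exists>g\<in>hom (presented S Rel) H. \<forall>s\<in>S. g (gen_class S Rel s) = f s"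
proof -
  interpret H: comm_group H by fact
  obtain h where h: "h \<in> hom (free_Abelian_group S) H" "\<And>s. s \<in> S \<Longrightarrow> h (frag_of s) = f s"
    by (rule H.free_Abelian_group_universal[of f S]) (use f in auto)
  have "\<exists>g\<in>hom (presented S Rel) H. \<forall>x\<in>carrier (free_Abelian_group S).
      g (generate (free_Abelian_group S) Rel #>\<^bsub>free_Abelian_group S\<^esub> x) = h x"
    unfolding presented_def
    by (rule quotient_universal[OF abelian_free_Abelian_group Rel H h(1)]) (use rel h in blast)
  then obtain g where g: "g \<in> hom (presented S Rel) H"
    "\<And>x. x \<in> carrier (free_Abelian_group S) \<Longrightarrow>
      g (generate (free_Abelian_group S) Rel #>\<^bsub>free_Abelian_group S\<^esub> x) = h x"
    by blast
  have "g (gen_class S Rel s) = f s" if "s \<in> S" for s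
    unfolding gen_class_def using that g(2)[of "frag_of s"] h(2) by simp
  then show ?thesis using g(1) by blast
qed

end

lemma hom_frag_relation_add:
  assumes H: "comm_group H" and h: "h \<in> hom (free_Abelian_group S) H"
    and S: "a \<in> S" "b \<in> S" "c \<in> S"
    and eq: "h (frag_of a) = h (frag_of b) \<otimes>\<^bsub>H\<^esub> h (frag_of c)"
  shows "h (frag_of a - frag_of b - frag_of c) = \<one>\<^bsub>H\<^esub>"
proof -
  let ?G = "free_Abelian_group S"
  interpret H: comm_group H by fact
  interpret h: group_hom ?G H h
    by (rule comm_group_hom_group_hom[OF abelian_free_Abelian_group H h])
  have "h (frag_of a \<otimes>\<^bsub>?G\<^esub> inv\<^bsub>?G\<^esub> frag_of b \<otimes>\<^bsub>?G\<^esub> inv\<^bsub>?G\<^esub> frag_of c)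
    = h (frag_of a) \<otimes>\<^bsub>H\<^esub> inv\<^bsub>H\<^esub> h (frag_of b) \<otimes>\<^bsub>H\<^esub> inv\<^bsub>H\<^esub> h (frag_of c)"
    using S by (simp del: mult_free_Abelian_group inv_free_Abelian_group carrier_free_Abelian_group_iff)
  also have "\<dots> = \<one>\<^bsub>H\<^esub>"
  proof -
    have "h (frag_of b) \<in> carrier H" "h (frag_of c) \<in> carrier H"
      using S by simp_all
    then show ?thesis
      unfolding eq by (metis H.inv_mult H.m_assoc H.m_closed H.inv_closed H.r_inv)
  qed
  finally show ?thesis using S by simp
qed

lemma hom_frag_relation_eq:
  assumes H: "comm_group H" and h: "h \<in> hom (free_Abelian_group S) H"
    and S: "a \<in> S" "b \<in> S" and eq: "h (frag_of a) = h (frag_of b)"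
  shows "h (frag_of a - frag_of b) = \<one>\<^bsub>H\<^esub>"
proof -
  let ?G = "free_Abelian_group S"
  interpret h: group_hom ?G H h
    by (rule comm_group_hom_group_hom[OF abelian_free_Abelian_group H h])
  have "h (frag_of a \<otimes>\<^bsub>?G\<^esub> inv\<^bsub>?G\<^esub> frag_of b) = h (frag_of a) \<otimes>\<^bsub>H\<^esub> inv\<^bsub>H\<^esub> h (frag_of b)"
    using S by (simp del: mult_free_Abelian_group inv_free_Abelian_group carrier_free_Abelian_group_iff)
  also have "\<dots> = \<one>\<^bsub>H\<^esub>"
    using eq S h.hom_closed by simp
  finally show ?thesis using S by simp
qed

lemma keys_frag_of_diff: "a \<in> S \<Longrightarrow> b \<in> S \<Longrightarrow> Poly_Mapping.keys (frag_of a - frag_of b) \<subseteq> S"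
  by (rule order.trans[OF keys_diff]) auto

lemma keys_frag_of_diff2:
  "a \<in> S \<Longrightarrow> b \<in> S \<Longrightarrow> c \<in> S \<Longrightarrow> Poly_Mapping.keys (frag_of a - frag_of b - frag_of c) \<subseteq> S"
  by (rule order.trans[OF keys_diff]) (use keys_frag_of_diff[of a S b] in auto)


lemma hom_free_diff:
  assumes H: "comm_group H" and h: "h \<in> hom (free_Abelian_group S) H"
    and ab: "Poly_Mapping.keys a \<subseteq> S" "Poly_Mapping.keys b \<subseteq> S"
  shows "h (a - b) = h a \<otimes>\<^bsub>H\<^esub> inv\<^bsub>H\<^esub> h b"
proof -
  interpret h: group_hom "free_Abelian_group S" H h
    by (rule comm_group_hom_group_hom[OF abelian_free_Abelian_group H h])
  have "a \<in> carrier (free_Abelian_group S)" "b \<in> carrier (free_Abelian_group S)"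
    using ab by simp_all
  then have "h (a \<otimes>\<^bsub>free_Abelian_group S\<^esub> inv\<^bsub>free_Abelian_group S\<^esub> b) = h a \<otimes>\<^bsub>H\<^esub> inv\<^bsub>H\<^esub> h b"
    by (simp del: mult_free_Abelian_group inv_free_Abelian_group carrier_free_Abelian_group_iff)
  then show ?thesis using ab by simp
qed

lemma hom_free_zero:
  assumes "comm_group H" "h \<in> hom (free_Abelian_group S) H"
  shows "h 0 = \<one>\<^bsub>H\<^esub>"
  using hom_one[OF assms(2) group_free_Abelian_group] assms(1) by (simp add: comm_group_def)

lemma hom_free_eqI:
  assumes H: "comm_group H" and h: "h \<in> hom (free_Abelian_group S) H" and k: "k \<in> hom (free_Abelian_group S) H"
    and eq: "\<And>s. s \<in> S \<Longrightarrow> h (frag_of s) = k (frag_of s)" and c: "Poly_Mapping.keys c \<subseteq> S"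
  shows "h c = k c"
  by (rule free_Abelian_group_induct[OF c, where P = "\<lambda>c. h c = k c"])
    (simp_all add: hom_free_zero[OF H h] hom_free_zero[OF H k] hom_free_diff[OF H h] hom_free_diff[OF H k] eq)

lemma image_one:
  assumes "comm_group A" "comm_group B" "h \<in> hom A B"
  shows "\<one>\<^bsub>B\<^esub> \<in> h ` carrier A"
proof -
  interpret group_hom A B h by (rule comm_group_hom_group_hom[OF assms])
  show ?thesis
    by (rule image_eqI[of _ _ "\<one>\<^bsub>A\<^esub>"]) simp_all
qed

lemma image_quot:
  assumes "comm_group A" "comm_group B" "h \<in> hom A B" and xy: "x \<in> h ` carrier A" "y \<in> h ` carrier A"
  shows "x \<otimes>\<^bsub>B\<^esub> inv\<^bsub>B\<^esub> y \<in> h ` carrier A"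
proof -
  interpret group_hom A B h by (rule comm_group_hom_group_hom[OF assms(1-3)])
  obtain a b where "a \<in> carrier A" "b \<in> carrier A" "x = h a" "y = h b"
    using xy by blast
  then show ?thesis
    by (intro image_eqI[of _ _ "a \<otimes>\<^bsub>A\<^esub> inv\<^bsub>A\<^esub> b"]) simp_all
qed

text \<open>The image of a homomorphism is closed under quotients, so it suffices to hit the
  generating classes. Surjectivity of all four canonical maps goes through this lemma.\<close>

lemma presented_surj:
  assumes Rel: "Rel \<subseteq> carrier (free_Abelian_group S)" and A: "comm_group A"
    and h: "h \<in> hom A (presented S Rel)"
    and gen: "\<And>s. s \<in> S \<Longrightarrow> gen_class S Rel s \<in> h ` carrier A"
  shows "h ` carrier A = carrier (presented S Rel)"
proof
  note B = presented_comm_group[OF Rel]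
  show "h ` carrier A \<subseteq> carrier (presented S Rel)"
    using hom_in_carrier[OF h] by blast
  show "carrier (presented S Rel) \<subseteq> h ` carrier A"
  proof
    fix z assume "z \<in> carrier (presented S Rel)"
    then show "z \<in> h ` carrier A"
      by (rule presented_induct[OF Rel]) (rule image_one[OF A B h], rule image_quot[OF A B h], assumption+, rule gen, assumption)
  qed
qed


section \<open>Colimits and tensor products\<close>

text \<open>The closure under \<open>far\<close> places the coend relators in the free group on
  \<open>tensor_gens\<close>.\<close>

definition group_presheaf :: "('o, 'm) small_cat \<Rightarrow> ('o, 'm, 'h) ab_functor \<Rightarrow> bool" where
  "group_presheaf C G \<longleftrightarrow>
     (\<forall>X\<in>Ob C. comm_group (fob G X)) \<and>
     (\<forall>X\<in>Ob C. \<forall>Y\<in>Ob C. \<forall>f\<in>Arr C X Y. \<forall>g\<in>carrier (fob G Y). far G X Y f g \<in> carrier (fob G X))"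

context
  fixes C :: "('o, 'm) small_cat" and F :: "('o, 'm, 'g) ab_functor"
  assumes F: "is_functor C F"
begin

lemma functor_group: "X \<in> Ob C \<Longrightarrow> comm_group (fob F X)"
  using F by (simp add: is_functor_def)

lemma functor_hom:
  "X \<in> Ob C \<Longrightarrow> Y \<in> Ob C \<Longrightarrow> f \<in> Arr C X Y \<Longrightarrow> far F X Y f \<in> hom (fob F X) (fob F Y)"
  using F by (simp add: is_functor_def)

lemma functor_closed:
  "X \<in> Ob C \<Longrightarrow> Y \<in> Ob C \<Longrightarrow> f \<in> Arr C X Y \<Longrightarrow> x \<in> carrier (fob F X) \<Longrightarrow>
     far F X Y f x \<in> carrier (fob F Y)"
  using functor_hom by (meson hom_in_carrier)

lemma functor_mult_closed:
  "X \<in> Ob C \<Longrightarrow> x \<in> carrier (fob F X) \<Longrightarrow> y \<in> carrier (fob F X) \<Longrightarrow>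
     x \<otimes>\<^bsub>fob F X\<^esub> y \<in> carrier (fob F X)"
  using functor_group by (meson comm_group_def comm_monoid_def monoid.m_closed)

lemma colim_rels_closed: "colim_rels C F \<subseteq> carrier (free_Abelian_group (colim_gens C F))"
proof
  fix r assume "r \<in> colim_rels C F"
  then consider
      (add) X x y where "r = frag_of (X, x \<otimes>\<^bsub>fob F X\<^esub> y) - frag_of (X, x) - frag_of (X, y)"
        "X \<in> Ob C" "x \<in> carrier (fob F X)" "y \<in> carrier (fob F X)"
    | (arr) X Y f x where "r = frag_of (Y, far F X Y f x) - frag_of (X, x)"
        "X \<in> Ob C" "Y \<in> Ob C" "f \<in> Arr C X Y" "x \<in> carrier (fob F X)"
    unfolding colim_rels_def by blast
  then show "r \<in> carrier (free_Abelian_group (colim_gens C F))"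
  proof cases
    case add
    then show ?thesis
      unfolding add(1) carrier_free_Abelian_group_iff
      by (intro keys_frag_of_diff2) (simp_all add: colim_gens_def functor_mult_closed)
  next
    case arr
    then show ?thesis
      unfolding arr(1) carrier_free_Abelian_group_iff
      by (intro keys_frag_of_diff) (simp_all add: colim_gens_def functor_closed)
  qed
qed

lemma colim_comm_group: "comm_group (colim C F)"
  unfolding colim_def by (rule presented_comm_group[OF colim_rels_closed])

lemma colim_class_closed:
  "X \<in> Ob C \<Longrightarrow> x \<in> carrier (fob F X) \<Longrightarrow> colim_class C F X x \<in> carrier (colim C F)"
  unfolding colim_def colim_class_def
  by (rule gen_class_closed[OF colim_rels_closed]) (simp add: colim_gens_def)

lemma colim_class_hom:
  assumes "X \<in> Ob C"
  shows "colim_class C F X \<in> hom (fob F X) (colim C F)"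
proof (rule homI)
  fix x y assume xy: "x \<in> carrier (fob F X)" "y \<in> carrier (fob F X)"
  show "colim_class C F X (x \<otimes>\<^bsub>fob F X\<^esub> y)
    = colim_class C F X x \<otimes>\<^bsub>colim C F\<^esub> colim_class C F X y"
    unfolding colim_def colim_class_def
    by (rule gen_class_relation_add[OF colim_rels_closed])
      (use assms xy in \<open>auto simp: colim_gens_def colim_rels_def functor_mult_closed\<close>)
qed (simp add: assms colim_class_closed)

lemma colim_class_far:
  assumes "X \<in> Ob C" "Y \<in> Ob C" "f \<in> Arr C X Y" "x \<in> carrier (fob F X)"
  shows "colim_class C F Y (far F X Y f x) = colim_class C F X x"
  unfolding colim_class_def
  by (rule gen_class_relation_eq[OF colim_rels_closed])
    (use assms in \<open>auto simp: colim_gens_def colim_rels_def functor_closed\<close>)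

lemma colim_induct:
  assumes "z \<in> carrier (colim C F)" "P \<one>\<^bsub>colim C F\<^esub>"
    and "\<And>x y. x \<in> carrier (colim C F) \<Longrightarrow> y \<in> carrier (colim C F) \<Longrightarrow>
      P x \<Longrightarrow> P y \<Longrightarrow> P (x \<otimes>\<^bsub>colim C F\<^esub> inv\<^bsub>colim C F\<^esub> y)"
    and "\<And>X x. X \<in> Ob C \<Longrightarrow> x \<in> carrier (fob F X) \<Longrightarrow> P (colim_class C F X x)"
  shows "P z"
  by (rule presented_induct[OF colim_rels_closed assms(1)[unfolded colim_def]])
    (use assms(2-) in \<open>auto simp: colim_def colim_gens_def colim_class_def\<close>)

lemma colim_surj:
  assumes A: "comm_group A" and h: "h \<in> hom A (colim C F)"
    and gen: "\<And>X x. X \<in> Ob C \<Longrightarrow> x \<in> carrier (fob F X) \<Longrightarrow> colim_class C F X x \<in> h ` carrier A"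
  shows "h ` carrier A = carrier (colim C F)"
  using h unfolding colim_def
  by (rule presented_surj[OF colim_rels_closed A]) (use gen in \<open>auto simp: colim_gens_def colim_class_def\<close>)

lemma colim_universal:
  assumes H: "comm_group H" and k: "\<And>X. X \<in> Ob C \<Longrightarrow> k X \<in> hom (fob F X) H"
    and compat: "\<And>X Y f x. X \<in> Ob C \<Longrightarrow> Y \<in> Ob C \<Longrightarrow> f \<in> Arr C X Y \<Longrightarrow> x \<in> carrier (fob F X) \<Longrightarrow>
      k Y (far F X Y f x) = k X x"
  shows "\<exists>g\<in>hom (colim C F) H. \<forall>X\<in>Ob C. \<forall>x\<in>carrier (fob F X). g (colim_class C F X x) = k X x"
proof -
  let ?S = "colim_gens C F"
  have "\<exists>g\<in>hom (presented ?S (colim_rels C F)) H.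
      \<forall>s\<in>?S. g (gen_class ?S (colim_rels C F) s) = (case s of (X, x) \<Rightarrow> k X x)"
  proof (rule presented_universal[OF colim_rels_closed H])
    show "(case s of (X, x) \<Rightarrow> k X x) \<in> carrier H" if "s \<in> ?S" for s
      using that k by (auto simp: colim_gens_def intro: hom_in_carrier)
  next
    fix h r assume h: "h \<in> hom (free_Abelian_group ?S) H"
      and hf: "\<And>s. s \<in> ?S \<Longrightarrow> h (frag_of s) = (case s of (X, x) \<Rightarrow> k X x)"
      and r: "r \<in> colim_rels C F"
    from r consider
      (add) X x y where "r = frag_of (X, x \<otimes>\<^bsub>fob F X\<^esub> y) - frag_of (X, x) - frag_of (X, y)"
        "X \<in> Ob C" "x \<in> carrier (fob F X)" "y \<in> carrier (fob F X)"
    | (arr) X Y f x where "r = frag_of (Y, far F X Y f x) - frag_of (X, x)"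
        "X \<in> Ob C" "Y \<in> Ob C" "f \<in> Arr C X Y" "x \<in> carrier (fob F X)"
      unfolding colim_rels_def by blast
    then show "h r = \<one>\<^bsub>H\<^esub>"
    proof cases
      case add
      then have "(X, x \<otimes>\<^bsub>fob F X\<^esub> y) \<in> ?S" "(X, x) \<in> ?S" "(X, y) \<in> ?S"
        by (auto simp: colim_gens_def functor_mult_closed)
      moreover have "k X (x \<otimes>\<^bsub>fob F X\<^esub> y) = k X x \<otimes>\<^bsub>H\<^esub> k X y"
        using add k[of X] by (simp add: hom_mult)
      ultimately show ?thesis
        unfolding add(1) by (intro hom_frag_relation_add[OF H h]) (simp_all add: hf)
    next
      case arr
      then have "(Y, far F X Y f x) \<in> ?S" "(X, x) \<in> ?S"
        by (auto simp: colim_gens_def functor_closed)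
      then show ?thesis
        unfolding arr(1) using arr compat
        by (intro hom_frag_relation_eq[OF H h]) (simp_all add: hf)
    qed
  qed
  then obtain g where g: "g \<in> hom (colim C F) H"
    and gs: "\<forall>s\<in>?S. g (gen_class ?S (colim_rels C F) s) = (case s of (X, x) \<Rightarrow> k X x)"
    unfolding colim_def by blast
  have "g (colim_class C F X x) = k X x" if "X \<in> Ob C" "x \<in> carrier (fob F X)" for X x
    using bspec[OF gs, of "(X, x)"] that by (simp add: colim_gens_def colim_class_def)
  then show ?thesis using g by blast

qed

context
  fixes G :: "('o, 'm, 'h) ab_functor"
  assumes presheaf: "group_presheaf C G"
begin

lemma presheaf_group: "X \<in> Ob C \<Longrightarrow> comm_group (fob G X)"
  using presheaf by (simp add: group_presheaf_def)

lemma presheaf_far_closed: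
  "X \<in> Ob C \<Longrightarrow> Y \<in> Ob C \<Longrightarrow> f \<in> Arr C X Y \<Longrightarrow> g \<in> carrier (fob G Y) \<Longrightarrow>
     far G X Y f g \<in> carrier (fob G X)"
  using presheaf by (simp add: group_presheaf_def)

lemma presheaf_mult_closed:
  "X \<in> Ob C \<Longrightarrow> x \<in> carrier (fob G X) \<Longrightarrow> y \<in> carrier (fob G X) \<Longrightarrow>
     x \<otimes>\<^bsub>fob G X\<^esub> y \<in> carrier (fob G X)"
  using presheaf_group by (meson comm_group_def comm_monoid_def monoid.m_closed)

lemma tensor_rels_closed: "tensor_rels C G F \<subseteq> carrier (free_Abelian_group (tensor_gens C G F))"
proof
  fix r assume "r \<in> tensor_rels C G F"
  then consider
      (left) X g g' x where
        "r = frag_of (X, g \<otimes>\<^bsub>fob G X\<^esub> g', x) - frag_of (X, g, x) - frag_of (X, g', x)"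
        "X \<in> Ob C" "g \<in> carrier (fob G X)" "g' \<in> carrier (fob G X)" "x \<in> carrier (fob F X)"
    | (right) X g x y where
        "r = frag_of (X, g, x \<otimes>\<^bsub>fob F X\<^esub> y) - frag_of (X, g, x) - frag_of (X, g, y)"
        "X \<in> Ob C" "g \<in> carrier (fob G X)" "x \<in> carrier (fob F X)" "y \<in> carrier (fob F X)"
    | (arr) X Y f g x where "r = frag_of (X, far G X Y f g, x) - frag_of (Y, g, far F X Y f x)"
        "X \<in> Ob C" "Y \<in> Ob C" "f \<in> Arr C X Y" "g \<in> carrier (fob G Y)" "x \<in> carrier (fob F X)"
    unfolding tensor_rels_def by blast
  then show "r \<in> carrier (free_Abelian_group (tensor_gens C G F))"
  proof cases
    case left
    then show ?thesis
      unfolding left(1) carrier_free_Abelian_group_iff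
      by (intro keys_frag_of_diff2) (simp_all add: tensor_gens_def presheaf_mult_closed)
  next
    case right
    then show ?thesis
      unfolding right(1) carrier_free_Abelian_group_iff
      by (intro keys_frag_of_diff2) (simp_all add: tensor_gens_def functor_mult_closed)
  next
    case arr
    then show ?thesis
      unfolding arr(1) carrier_free_Abelian_group_iff
      by (intro keys_frag_of_diff) (simp_all add: tensor_gens_def functor_closed presheaf_far_closed)
  qed
qed

lemma tensor_comm_group: "comm_group (tensor C G F)"
  unfolding tensor_def by (rule presented_comm_group[OF tensor_rels_closed])

lemma tensor_class_closed:
  "X \<in> Ob C \<Longrightarrow> g \<in> carrier (fob G X) \<Longrightarrow> x \<in> carrier (fob F X) \<Longrightarrow>
     tensor_class C G F X g x \<in> carrier (tensor C G F)"
  unfolding tensor_def tensor_class_def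
  by (rule gen_class_closed[OF tensor_rels_closed]) (simp add: tensor_gens_def)

lemma tensor_class_hom_left:
  assumes "X \<in> Ob C" "x \<in> carrier (fob F X)"
  shows "(\<lambda>g. tensor_class C G F X g x) \<in> hom (fob G X) (tensor C G F)"
proof (rule homI)
  fix g h assume gh: "g \<in> carrier (fob G X)" "h \<in> carrier (fob G X)"
  show "tensor_class C G F X (g \<otimes>\<^bsub>fob G X\<^esub> h) x
    = tensor_class C G F X g x \<otimes>\<^bsub>tensor C G F\<^esub> tensor_class C G F X h x"
    unfolding tensor_def tensor_class_def
    by (rule gen_class_relation_add[OF tensor_rels_closed])
      (use assms gh in \<open>auto simp: tensor_gens_def tensor_rels_def presheaf_mult_closed\<close>)
qed (simp add: assms tensor_class_closed)

lemma tensor_class_hom_right: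
  assumes "X \<in> Ob C" "g \<in> carrier (fob G X)"
  shows "tensor_class C G F X g \<in> hom (fob F X) (tensor C G F)"
proof (rule homI)
  fix x y assume xy: "x \<in> carrier (fob F X)" "y \<in> carrier (fob F X)"
  show "tensor_class C G F X g (x \<otimes>\<^bsub>fob F X\<^esub> y)
    = tensor_class C G F X g x \<otimes>\<^bsub>tensor C G F\<^esub> tensor_class C G F X g y"
    unfolding tensor_def tensor_class_def
    by (rule gen_class_relation_add[OF tensor_rels_closed])
      (use assms xy in \<open>auto simp: tensor_gens_def tensor_rels_def functor_mult_closed\<close>)
qed (simp add: assms tensor_class_closed)

lemma tensor_class_coend:
  assumes "X \<in> Ob C" "Y \<in> Ob C" "f \<in> Arr C X Y" "g \<in> carrier (fob G Y)" "x \<in> carrier (fob F X)"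
  shows "tensor_class C G F X (far G X Y f g) x = tensor_class C G F Y g (far F X Y f x)"
  unfolding tensor_class_def
  by (rule gen_class_relation_eq[OF tensor_rels_closed])
    (use assms in \<open>auto simp: tensor_gens_def tensor_rels_def functor_closed presheaf_far_closed\<close>)

lemma tensor_surj:
  assumes A: "comm_group A" and h: "h \<in> hom A (tensor C G F)"
    and gen: "\<And>X g x. X \<in> Ob C \<Longrightarrow> g \<in> carrier (fob G X) \<Longrightarrow> x \<in> carrier (fob F X) \<Longrightarrow>
      tensor_class C G F X g x \<in> h ` carrier A"
  shows "h ` carrier A = carrier (tensor C G F)"
  using h unfolding tensor_def
  by (rule presented_surj[OF tensor_rels_closed A]) (use gen in \<open>auto simp: tensor_gens_def tensor_class_def\<close>)

lemma tensor_universal: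
  assumes H: "comm_group H"
    and kl: "\<And>X x. X \<in> Ob C \<Longrightarrow> x \<in> carrier (fob F X) \<Longrightarrow> (\<lambda>g. k X g x) \<in> hom (fob G X) H"
    and kr: "\<And>X g. X \<in> Ob C \<Longrightarrow> g \<in> carrier (fob G X) \<Longrightarrow> k X g \<in> hom (fob F X) H"
    and coend: "\<And>X Y f g x. X \<in> Ob C \<Longrightarrow> Y \<in> Ob C \<Longrightarrow> f \<in> Arr C X Y \<Longrightarrow> g \<in> carrier (fob G Y) \<Longrightarrow>
      x \<in> carrier (fob F X) \<Longrightarrow> k X (far G X Y f g) x = k Y g (far F X Y f x)"
  shows "\<exists>h\<in>hom (tensor C G F) H. \<forall>X\<in>Ob C. \<forall>g\<in>carrier (fob G X). \<forall>x\<in>carrier (fob F X).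
    h (tensor_class C G F X g x) = k X g x"
proof -
  let ?S = "tensor_gens C G F"
  have "\<exists>h\<in>hom (presented ?S (tensor_rels C G F)) H.
      \<forall>s\<in>?S. h (gen_class ?S (tensor_rels C G F) s) = (case s of (X, g, x) \<Rightarrow> k X g x)"
  proof (rule presented_universal[OF tensor_rels_closed H])
    show "(case s of (X, g, x) \<Rightarrow> k X g x) \<in> carrier H" if "s \<in> ?S" for s
      using that kr by (auto simp: tensor_gens_def intro: hom_in_carrier)
  next
    fix h r assume h: "h \<in> hom (free_Abelian_group ?S) H"
      and hf: "\<And>s. s \<in> ?S \<Longrightarrow> h (frag_of s) = (case s of (X, g, x) \<Rightarrow> k X g x)"
      and r: "r \<in> tensor_rels C G F"
    from r consider
      (left) X g g' x where
        "r = frag_of (X, g \<otimes>\<^bsub>fob G X\<^esub> g', x) - frag_of (X, g, x) - frag_of (X, g', x)"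
        "X \<in> Ob C" "g \<in> carrier (fob G X)" "g' \<in> carrier (fob G X)" "x \<in> carrier (fob F X)"
    | (right) X g x y where
        "r = frag_of (X, g, x \<otimes>\<^bsub>fob F X\<^esub> y) - frag_of (X, g, x) - frag_of (X, g, y)"
        "X \<in> Ob C" "g \<in> carrier (fob G X)" "x \<in> carrier (fob F X)" "y \<in> carrier (fob F X)"
    | (arr) X Y f g x where "r = frag_of (X, far G X Y f g, x) - frag_of (Y, g, far F X Y f x)"
        "X \<in> Ob C" "Y \<in> Ob C" "f \<in> Arr C X Y" "g \<in> carrier (fob G Y)" "x \<in> carrier (fob F X)"
      unfolding tensor_rels_def by blast
    then show "h r = \<one>\<^bsub>H\<^esub>"
    proof cases
      case left
      then have "(X, g \<otimes>\<^bsub>fob G X\<^esub> g', x) \<in> ?S" "(X, g, x) \<in> ?S" "(X, g', x) \<in> ?S"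
        by (auto simp: tensor_gens_def presheaf_mult_closed)
      moreover have "k X (g \<otimes>\<^bsub>fob G X\<^esub> g') x = k X g x \<otimes>\<^bsub>H\<^esub> k X g' x"
        using left kl[of X x] by (simp add: hom_def)
      ultimately show ?thesis
        unfolding left(1) by (intro hom_frag_relation_add[OF H h]) (simp_all add: hf)
    next
      case right
      then have "(X, g, x \<otimes>\<^bsub>fob F X\<^esub> y) \<in> ?S" "(X, g, x) \<in> ?S" "(X, g, y) \<in> ?S"
        by (auto simp: tensor_gens_def functor_mult_closed)
      moreover have "k X g (x \<otimes>\<^bsub>fob F X\<^esub> y) = k X g x \<otimes>\<^bsub>H\<^esub> k X g y"
        using right kr[of X g] by (simp add: hom_mult)
      ultimately show ?thesis
        unfolding right(1) by (intro hom_frag_relation_add[OF H h]) (simp_all add: hf)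
    next
      case arr
      then have "(X, far G X Y f g, x) \<in> ?S" "(Y, g, far F X Y f x) \<in> ?S"
        by (auto simp: tensor_gens_def functor_closed presheaf_far_closed)
      then show ?thesis
        unfolding arr(1) using arr coend
        by (intro hom_frag_relation_eq[OF H h]) (simp_all add: hf)
    qed
  qed
  then obtain h where h: "h \<in> hom (tensor C G F) H"
    and hs: "\<forall>s\<in>?S. h (gen_class ?S (tensor_rels C G F) s) = (case s of (X, g, x) \<Rightarrow> k X g x)"
    unfolding tensor_def by blast
  have "h (tensor_class C G F X g x) = k X g x"
    if "X \<in> Ob C" "g \<in> carrier (fob G X)" "x \<in> carrier (fob F X)" for X g x
    using bspec[OF hs, of "(X, g, x)"] that by (simp add: tensor_gens_def tensor_class_def)
  then show ?thesis using h by blast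

qed

end

end


section \<open>Linear maps and the standard bilinear form\<close>

definition uvec :: "('a, 'r) ring_scheme \<Rightarrow> nat \<Rightarrow> nat \<Rightarrow> 'a" where
  "uvec R j = (\<lambda>i. if i = j then \<one>\<^bsub>R\<^esub> else \<zero>\<^bsub>R\<^esub>)"

text \<open>The index \<open>n\<close> bounds the summation only. The arguments may come from
  smaller or larger free modules, which keeps dimensions flexible (see
  \<open>ip_extend\<close>).\<close>

definition ip :: "('a, 'r) ring_scheme \<Rightarrow> nat \<Rightarrow> (nat \<Rightarrow> 'a) \<Rightarrow> (nat \<Rightarrow> 'a) \<Rightarrow> 'a" where
  "ip R n v w = finsum R (\<lambda>i. v i \<otimes>\<^bsub>R\<^esub> w i) {..<n}"

text \<open>The identification of the direct sum of A^n and A^p with A^(n+p). The length of the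
  first part is an argument because a sequence that vanishes from index n on does not record
  n.\<close>

definition vcat :: "nat \<Rightarrow> (nat \<Rightarrow> 'a) \<Rightarrow> (nat \<Rightarrow> 'a) \<Rightarrow> nat \<Rightarrow> 'a" where
  "vcat n a b = (\<lambda>i. if i < n then a i else b (i - n))"

lemma free_mod_simps [simp]:
  "\<zero>\<^bsub>free_mod R n\<^esub> = (\<lambda>i. \<zero>\<^bsub>R\<^esub>)"
  "v \<oplus>\<^bsub>free_mod R n\<^esub> w = (\<lambda>i. v i \<oplus>\<^bsub>R\<^esub> w i)"
  "a \<odot>\<^bsub>free_mod R n\<^esub> v = (\<lambda>i. a \<otimes>\<^bsub>R\<^esub> v i)"
  by (simp_all add: free_mod_def)

lemma ring_as_module_simps [simp]:
  "carrier (ring_as_module R) = carrier R"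
  "v \<oplus>\<^bsub>ring_as_module R\<^esub> w = v \<oplus>\<^bsub>R\<^esub> w"
  "a \<odot>\<^bsub>ring_as_module R\<^esub> v = a \<otimes>\<^bsub>R\<^esub> v"
  by (simp_all add: ring_as_module_def)

lemma free_mod_iff:
  "v \<in> carrier (free_mod R n) \<longleftrightarrow> (\<forall>i<n. v i \<in> carrier R) \<and> (\<forall>i\<ge>n. v i = \<zero>\<^bsub>R\<^esub>)"
  by (simp add: free_mod_def)

lemma lin_mapsD:
  assumes "f \<in> lin_maps R V W"
  shows "v \<in> carrier V \<Longrightarrow> f v \<in> carrier W"
    and "v \<in> carrier V \<Longrightarrow> w \<in> carrier V \<Longrightarrow> f (v \<oplus>\<^bsub>V\<^esub> w) = f v \<oplus>\<^bsub>W\<^esub> f w"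
    and "a \<in> carrier R \<Longrightarrow> v \<in> carrier V \<Longrightarrow> f (a \<odot>\<^bsub>V\<^esub> v) = a \<odot>\<^bsub>W\<^esub> f v"
    and "v \<notin> carrier V \<Longrightarrow> f v = undefined"
  using assms by (auto simp: lin_maps_def)

lemma lin_maps_ext:
  assumes "f \<in> lin_maps R V W" "g \<in> lin_maps R V W'" "\<And>v. v \<in> carrier V \<Longrightarrow> f v = g v"
  shows "f = g"
proof
  fix v show "f v = g v"
    using assms(3) lin_mapsD(4)[OF assms(1)] lin_mapsD(4)[OF assms(2)] by (cases "v \<in> carrier V") simp_all
qed

lemma lin_mapsI:
  assumes "module R V"
    and "\<And>v. v \<in> carrier V \<Longrightarrow> f v \<in> carrier W"
    and "\<And>v w. v \<in> carrier V \<Longrightarrow> w \<in> carrier V \<Longrightarrow> f (v \<oplus>\<^bsub>V\<^esub> w) = f v \<oplus>\<^bsub>W\<^esub> f w"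
    and "\<And>a v. a \<in> carrier R \<Longrightarrow> v \<in> carrier V \<Longrightarrow> f (a \<odot>\<^bsub>V\<^esub> v) = a \<odot>\<^bsub>W\<^esub> f v"
  shows "(\<lambda>v\<in>carrier V. f v) \<in> lin_maps R V W"
proof -
  interpret module R V by fact
  show ?thesis
    using assms(2-) by (auto simp: lin_maps_def)
qed

lemma lin_maps_compose:
  assumes f: "f \<in> lin_maps R U V" and g: "g \<in> lin_maps R V W" and U: "module R U"
  shows "compose (carrier U) g f \<in> lin_maps R U W"
  unfolding compose_def
  by (rule lin_mapsI[OF U]) (simp_all add: lin_mapsD[OF f] lin_mapsD[OF g])

lemma lin_maps_restrict_comp:
  assumes f: "f \<in> lin_maps R U V" and g: "g \<in> lin_maps R V W" and U: "module R U"
  shows "(\<lambda>v\<in>carrier U. g (f v)) \<in> lin_maps R U W"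
  using lin_maps_compose[OF assms] by (simp add: compose_def)

lemma Ob_proj_cat: "V \<in> Ob (proj_cat R) \<longleftrightarrow> fg_projective R V"
  by (simp add: proj_cat_def)

lemma Arr_proj_cat [simp]: "Arr (proj_cat R) = lin_maps R"
  by (simp add: proj_cat_def)

lemma Ob_proj_cat_module: "V \<in> Ob (proj_cat R) \<Longrightarrow> module R V"
  by (simp add: Ob_proj_cat fg_projective_def)

lemma fg_projective_retract:
  assumes "V \<in> Ob (proj_cat R)"
  shows "\<exists>m. \<exists>s\<in>lin_maps R V (free_mod R m). \<exists>r\<in>lin_maps R (free_mod R m) V.
    \<forall>v\<in>carrier V. r (s v) = v"
  using assms unfolding Ob_proj_cat fg_projective_def by blast

context cring
begin

lemma free_mod_closed: "v \<in> carrier (free_mod R n) \<Longrightarrow> v i \<in> carrier R"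
  by (cases "i < n") (simp_all add: free_mod_iff)

lemma free_mod_tail: "v \<in> carrier (free_mod R n) \<Longrightarrow> n \<le> i \<Longrightarrow> v i = \<zero>"
  by (simp add: free_mod_iff)

lemma free_mod_mono: "m \<le> n \<Longrightarrow> v \<in> carrier (free_mod R m) \<Longrightarrow> v \<in> carrier (free_mod R n)"
  by (metis free_mod_closed free_mod_iff order.trans)

lemma free_mod_add_closed:
  "v \<in> carrier (free_mod R n) \<Longrightarrow> w \<in> carrier (free_mod R n) \<Longrightarrow>
     (\<lambda>i. v i \<oplus> w i) \<in> carrier (free_mod R n)"
  by (simp add: free_mod_iff)

lemma free_mod_minus_closed:
  "v \<in> carrier (free_mod R n) \<Longrightarrow> w \<in> carrier (free_mod R n) \<Longrightarrow>
     (\<lambda>i. v i \<ominus> w i) \<in> carrier (free_mod R n)"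
  by (simp add: free_mod_iff minus_eq)

lemma free_mod_smult_closed:
  "a \<in> carrier R \<Longrightarrow> w \<in> carrier (free_mod R n) \<Longrightarrow> (\<lambda>i. a \<otimes> w i) \<in> carrier (free_mod R n)"
  by (simp add: free_mod_iff)

lemma free_mod_zero_closed: "(\<lambda>i. \<zero>) \<in> carrier (free_mod R n)"
  by (simp add: free_mod_iff)

lemma free_mod_module: "module R (free_mod R n)"
proof (rule moduleI)
  show "cring R" ..
  show "abelian_group (free_mod R n)"
  proof (rule abelian_groupI)
    fix x assume x: "x \<in> carrier (free_mod R n)"
    then show "\<exists>y\<in>carrier (free_mod R n). y \<oplus>\<^bsub>free_mod R n\<^esub> x = \<zero>\<^bsub>free_mod R n\<^esub>"
      by (intro bexI[of _ "\<lambda>i. \<ominus> x i"]) (use free_mod_closed[OF x] x in \<open>auto simp: l_neg free_mod_iff\<close>)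
  qed (simp_all add: free_mod_add_closed free_mod_zero_closed a_ac free_mod_closed)
qed (simp_all add: free_mod_smult_closed l_distr r_distr m_assoc free_mod_closed)

lemma free_mod_Ob: "free_mod R n \<in> Ob (proj_cat R)"
proof -
  have "(\<lambda>v\<in>carrier (free_mod R n). v) \<in> lin_maps R (free_mod R n) (free_mod R n)"
    by (rule lin_mapsI[OF free_mod_module]) auto
  then show ?thesis
    unfolding Ob_proj_cat fg_projective_def
    by (intro conjI free_mod_module exI[of _ n] bexI) simp_all
qed

lemma uvec_closed [simp]: "j < n \<Longrightarrow> uvec R j \<in> carrier (free_mod R n)"
  by (auto simp: free_mod_iff uvec_def)

lemma uvec_carrier [simp]: "uvec R j i \<in> carrier R"
  by (simp add: uvec_def)

lemma dual_expansion:
  assumes l: "l \<in> dual R (free_mod R n)" and v: "v \<in> carrier (free_mod R n)"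
  shows "l v = (\<Oplus>j\<in>{..<n}. v j \<otimes> l (uvec R j))"
proof -
  note lD = lin_mapsD[OF l[unfolded dual_def]]
  \<comment> \<open>Truncation to the first \<open>k\<close> coordinates: \<open>t 0\<close> is
    zero, \<open>t n\<close> is \<open>v\<close>, and each step adds one multiple of a unit
    vector.\<close>
  define t where "t k = (\<lambda>i. if i < k then v i else \<zero>)" for k
  have t: "t k \<in> carrier (free_mod R n)" if "k \<le> n" for k
    using v that by (auto simp: t_def free_mod_iff)
  have lv: "l u \<in> carrier R" if "u \<in> carrier (free_mod R n)" for u
    using lD(1)[OF that] by simp
  have "l (t k) = (\<Oplus>j\<in>{..<k}. v j \<otimes> l (uvec R j))" if "k \<le> n" for k
    using that
  proof (induction k)
    case 0
    have "t 0 = \<zero> \<odot>\<^bsub>free_mod R n\<^esub> t 0"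
      by (simp add: t_def fun_eq_iff)
    then have "l (t 0) = \<zero> \<otimes> l (t 0)"
      using lD(3)[of \<zero> "t 0"] t[of 0] by simp
    then show ?case using lv[OF t[of 0]] by simp
  next
    case (Suc k)
    have "t (Suc k) = t k \<oplus>\<^bsub>free_mod R n\<^esub> (v k \<odot>\<^bsub>free_mod R n\<^esub> uvec R k)"
      using v free_mod_closed[OF v] by (auto simp: t_def fun_eq_iff uvec_def less_Suc_eq)
    moreover have "l (t k \<oplus>\<^bsub>free_mod R n\<^esub> (v k \<odot>\<^bsub>free_mod R n\<^esub> uvec R k))
      = l (t k) \<oplus> v k \<otimes> l (uvec R k)"
      using Suc.prems v t[of k]
      by (subst lD(2)) (simp_all add: free_mod_smult_closed lD(3)[of "v k" "uvec R k", simplified] free_mod_closed)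
    ultimately have "l (t (Suc k)) = v k \<otimes> l (uvec R k) \<oplus> l (t k)"
      using Suc.prems v t[of k] lv by (simp add: a_comm free_mod_closed[OF v])
    moreover have "(\<Oplus>j\<in>{..<Suc k}. v j \<otimes> l (uvec R j))
      = v k \<otimes> l (uvec R k) \<oplus> (\<Oplus>j\<in>{..<k}. v j \<otimes> l (uvec R j))"
      unfolding lessThan_Suc using Suc.prems v lv
      by (subst finsum_insert) (auto simp: free_mod_closed)
    ultimately show ?case using Suc by simp
  qed
  moreover have "t n = v"
    using v by (auto simp: t_def fun_eq_iff free_mod_iff)
  ultimately show ?thesis by auto
qed

lemma coord_dual:
  assumes V: "module R V" and f: "f \<in> lin_maps R V (free_mod R n)"
  shows "(\<lambda>v\<in>carrier V. f v i) \<in> dual R V"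
  unfolding dual_def
  by (rule lin_mapsI[OF V]) (use lin_mapsD[OF f] lin_mapsD(1)[OF f, THEN free_mod_closed] in simp_all)

lemma lin_map_of_dual:
  assumes V: "module R V" and l: "\<And>i. i < n \<Longrightarrow> l i \<in> dual R V"
  shows "(\<lambda>v\<in>carrier V. \<lambda>i. if i < n then l i v else \<zero>) \<in> lin_maps R V (free_mod R n)"
  using l[unfolded dual_def, THEN lin_mapsD(1)] l[unfolded dual_def, THEN lin_mapsD(2)]
    l[unfolded dual_def, THEN lin_mapsD(3)]
  by (intro lin_mapsI[OF V]) (auto simp: free_mod_iff fun_eq_iff)

text \<open>The free modules are nested sets of sequences with the same operations, so a map into a
  smaller one is literally a map into a larger one, without composing with an inclusion.\<close>

lemma lin_map_std: "f \<in> lin_maps R V (free_mod R m) \<Longrightarrow> m \<le> n \<Longrightarrow> f \<in> lin_maps R V (free_mod R n)"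
  by (auto simp: lin_maps_def PiE_iff free_mod_mono)

lemma std_incl_lin: "m \<le> n \<Longrightarrow> std_incl R m \<in> lin_maps R (free_mod R m) (free_mod R n)"
  unfolding std_incl_def by (rule lin_mapsI[OF free_mod_module]) (auto simp: free_mod_mono)


subsection \<open>The bilinear form\<close>

lemma ip_closed [simp, intro]:
  "v \<in> carrier (free_mod R m) \<Longrightarrow> w \<in> carrier (free_mod R k) \<Longrightarrow> ip R n v w \<in> carrier R"
  unfolding ip_def by (auto intro!: finsum_closed simp: free_mod_closed)

lemma ip_comm:
  "v \<in> carrier (free_mod R m) \<Longrightarrow> w \<in> carrier (free_mod R k) \<Longrightarrow> ip R n v w = ip R n w v"
  unfolding ip_def by (rule finsum_cong') (auto intro: m_comm simp: free_mod_closed)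

lemma ip_add_left:
  assumes "u \<in> carrier (free_mod R m)" "v \<in> carrier (free_mod R m)" "w \<in> carrier (free_mod R k)"
  shows "ip R n (\<lambda>i. u i \<oplus> v i) w = ip R n u w \<oplus> ip R n v w"
proof -
  have "ip R n (\<lambda>i. u i \<oplus> v i) w = (\<Oplus>i\<in>{..<n}. u i \<otimes> w i \<oplus> v i \<otimes> w i)"
    unfolding ip_def by (rule finsum_cong') (use assms in \<open>auto simp: l_distr free_mod_closed\<close>)
  also have "\<dots> = ip R n u w \<oplus> ip R n v w"
    unfolding ip_def by (rule finsum_addf) (use assms in \<open>auto simp: free_mod_closed\<close>)
  finally show ?thesis .
qed

lemma ip_smult_left:
  assumes "a \<in> carrier R" "v \<in> carrier (free_mod R m)" "w \<in> carrier (free_mod R k)"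
  shows "ip R n (\<lambda>i. a \<otimes> v i) w = a \<otimes> ip R n v w"
proof -
  have "ip R n (\<lambda>i. a \<otimes> v i) w = (\<Oplus>i\<in>{..<n}. a \<otimes> (v i \<otimes> w i))"
    unfolding ip_def by (rule finsum_cong') (use assms in \<open>auto simp: m_assoc free_mod_closed\<close>)
  also have "\<dots> = a \<otimes> ip R n v w"
    unfolding ip_def by (rule finsum_rdistr[symmetric]) (use assms in \<open>auto simp: free_mod_closed\<close>)
  finally show ?thesis .
qed

lemma ip_add_right:
  assumes "u \<in> carrier (free_mod R m)" "v \<in> carrier (free_mod R m)" "w \<in> carrier (free_mod R k)"
  shows "ip R n w (\<lambda>i. u i \<oplus> v i) = ip R n w u \<oplus> ip R n w v"
  using ip_add_left[OF assms] assms
  by (simp add: ip_comm[OF assms(3)] free_mod_add_closed ip_comm[OF assms(3) free_mod_add_closed])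

lemma ip_smult_right:
  assumes "a \<in> carrier R" "v \<in> carrier (free_mod R m)" "w \<in> carrier (free_mod R k)"
  shows "ip R n w (\<lambda>i. a \<otimes> v i) = a \<otimes> ip R n w v"
  using ip_smult_left[OF assms] assms
  by (simp add: ip_comm[OF assms(3)] ip_comm[OF assms(3) free_mod_smult_closed])

lemma ip_minus_left:
  assumes "u \<in> carrier (free_mod R m)" "v \<in> carrier (free_mod R m)" "w \<in> carrier (free_mod R k)"
  shows "ip R n (\<lambda>i. u i \<ominus> v i) w = ip R n u w \<ominus> ip R n v w"
proof -
  have "(\<lambda>i. u i \<ominus> v i) = (\<lambda>i. u i \<oplus> (\<ominus> \<one>) \<otimes> v i)"
    using assms by (simp add: fun_eq_iff minus_eq l_minus free_mod_closed)
  then have "ip R n (\<lambda>i. u i \<ominus> v i) w = ip R n u w \<oplus> (\<ominus> \<one>) \<otimes> ip R n v w"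
    using assms by (simp add: ip_add_left[OF _ free_mod_smult_closed] ip_smult_left)
  then show ?thesis
    using assms ip_closed[OF assms(2,3)] by (simp add: minus_eq l_minus)
qed

lemma ip_minus_right:
  assumes "u \<in> carrier (free_mod R m)" "v \<in> carrier (free_mod R m)" "w \<in> carrier (free_mod R k)"
  shows "ip R n w (\<lambda>i. u i \<ominus> v i) = ip R n w u \<ominus> ip R n w v"
  using ip_minus_left[OF assms] assms
  by (simp add: ip_comm[OF assms(3)] ip_comm[OF assms(3) free_mod_minus_closed])

lemma ip_zero:
  assumes "\<And>i. i < n \<Longrightarrow> v i \<otimes> w i = \<zero>"
  shows "ip R n v w = \<zero>"
  unfolding ip_def using assms by (intro add.finprod_one_eqI) auto

lemma ip_extend:
  assumes "m \<le> n" "v \<in> carrier (free_mod R m)" "w \<in> carrier (free_mod R k)"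
  shows "ip R n v w = ip R m v w"
  unfolding ip_def
  by (rule add.finprod_mono_neutral_cong_right)
    (use assms in \<open>auto simp: free_mod_tail[OF assms(2)] free_mod_closed\<close>)

lemma vcat_closed:
  "a \<in> carrier (free_mod R n) \<Longrightarrow> b \<in> carrier (free_mod R p) \<Longrightarrow>
     vcat n a b \<in> carrier (free_mod R (n + p))"
  by (auto simp: free_mod_iff vcat_def)

lemma vcat_zero: "a \<in> carrier (free_mod R n) \<Longrightarrow> vcat n a (\<lambda>i. \<zero>) = a"
  by (auto simp: fun_eq_iff vcat_def free_mod_tail)

lemma ip_vcat:
  assumes "a \<in> carrier (free_mod R n)" "b \<in> carrier (free_mod R p)"
    "a' \<in> carrier (free_mod R n)" "b' \<in> carrier (free_mod R p)"
  shows "ip R (n + p) (vcat n a b) (vcat n a' b') = ip R n a a' \<oplus> ip R p b b'"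
proof -
  let ?f = "\<lambda>i. vcat n a b i \<otimes> vcat n a' b' i"
  have c: "vcat n a b i \<in> carrier R" "vcat n a' b' i \<in> carrier R" for i
    using assms by (simp_all add: vcat_def free_mod_closed)
  have img: "(\<lambda>i. n + i) ` {..<p} = {n..<n + p}"
    by (simp add: lessThan_atLeast0 add.commute)
  have "{..<n + p} = {..<n} \<union> {n..<n + p}"
    by auto
  then have "ip R (n + p) (vcat n a b) (vcat n a' b') = finsum R ?f {..<n} \<oplus> finsum R ?f {n..<n + p}"
    unfolding ip_def by simp (rule finsum_Un_disjoint, use c in auto)
  moreover have "finsum R ?f {..<n} = ip R n a a'"
    unfolding ip_def by (rule finsum_cong') (use assms in \<open>auto simp: vcat_def free_mod_closed\<close>)
  moreover have "finsum R ?f {n..<n + p} = ip R p b b'"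
    unfolding ip_def img[symmetric]
    by (subst finsum_reindex) (use assms c in \<open>auto simp: vcat_def free_mod_closed intro!: finsum_cong'\<close>)
  ultimately show ?thesis by simp
qed

lemma eps_ip: "v \<in> carrier (free_mod R n) \<Longrightarrow> eps R n v = ip R n v v"
  by (simp add: eps_def ip_def)

lemma lin_vcat:
  assumes V: "module R V" and f: "f \<in> lin_maps R V (free_mod R n)" and g: "g \<in> lin_maps R V (free_mod R p)"
  shows "(\<lambda>v\<in>carrier V. vcat n (f v) (g v)) \<in> lin_maps R V (free_mod R (n + p))"
  by (rule lin_mapsI[OF V])
    (simp_all add: vcat_closed lin_mapsD[OF f] lin_mapsD[OF g], simp_all add: fun_eq_iff vcat_def)

lemma lin_add:
  assumes V: "module R V" and f: "f \<in> lin_maps R V (free_mod R n)" and g: "g \<in> lin_maps R V (free_mod R n)"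
  shows "(\<lambda>v\<in>carrier V. \<lambda>i. f v i \<oplus> g v i) \<in> lin_maps R V (free_mod R n)"
proof (rule lin_mapsI[OF V])
  note fD = lin_mapsD[OF f] and gD = lin_mapsD[OF g]
  show "(\<lambda>i. f v i \<oplus> g v i) \<in> carrier (free_mod R n)" if "v \<in> carrier V" for v
    using that fD(1) gD(1) by (simp add: free_mod_add_closed)
  show "(\<lambda>i. f (v \<oplus>\<^bsub>V\<^esub> w) i \<oplus> g (v \<oplus>\<^bsub>V\<^esub> w) i)
    = (\<lambda>i. f v i \<oplus> g v i) \<oplus>\<^bsub>free_mod R n\<^esub> (\<lambda>i. f w i \<oplus> g w i)"
    if "v \<in> carrier V" "w \<in> carrier V" for v w
    using that fD(1)[THEN free_mod_closed] gD(1)[THEN free_mod_closed]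
    by (simp add: fD(2) gD(2) fun_eq_iff a_ac)
  show "(\<lambda>i. f (a \<odot>\<^bsub>V\<^esub> v) i \<oplus> g (a \<odot>\<^bsub>V\<^esub> v) i) = a \<odot>\<^bsub>free_mod R n\<^esub> (\<lambda>i. f v i \<oplus> g v i)"
    if "a \<in> carrier R" "v \<in> carrier V" for a v
    using that fD(1)[THEN free_mod_closed] gD(1)[THEN free_mod_closed]
    by (simp add: fD(3) gD(3) fun_eq_iff r_distr)
qed

lemma lin_smult:
  assumes V: "module R V" and f: "f \<in> lin_maps R V (free_mod R n)" and b: "b \<in> carrier R"
  shows "(\<lambda>v\<in>carrier V. \<lambda>i. b \<otimes> f v i) \<in> lin_maps R V (free_mod R n)"
proof (rule lin_mapsI[OF V])
  note fD = lin_mapsD[OF f]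
  show "(\<lambda>i. b \<otimes> f v i) \<in> carrier (free_mod R n)" if "v \<in> carrier V" for v
    using that fD(1) b by (simp add: free_mod_smult_closed)
  show "(\<lambda>i. b \<otimes> f (v \<oplus>\<^bsub>V\<^esub> w) i)
    = (\<lambda>i. b \<otimes> f v i) \<oplus>\<^bsub>free_mod R n\<^esub> (\<lambda>i. b \<otimes> f w i)"
    if "v \<in> carrier V" "w \<in> carrier V" for v w
    using that fD(1)[THEN free_mod_closed] b by (simp add: fD(2) fun_eq_iff r_distr)
  show "(\<lambda>i. b \<otimes> f (a \<odot>\<^bsub>V\<^esub> v) i) = a \<odot>\<^bsub>free_mod R n\<^esub> (\<lambda>i. b \<otimes> f v i)"
    if "a \<in> carrier R" "v \<in> carrier V" for a v
    using that fD(1)[THEN free_mod_closed] b by (simp add: fD(3) fun_eq_iff m_lcomm)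
qed

end


section \<open>Quadratic forms\<close>

definition form_add :: "('a, 'r) ring_scheme \<Rightarrow> 'a pobj \<Rightarrow> 'a qform \<Rightarrow> 'a qform \<Rightarrow> 'a qform" where
  "form_add R V q p = (\<lambda>v\<in>carrier V. q v \<oplus>\<^bsub>R\<^esub> p v)"

definition form_mult :: "('a, 'r) ring_scheme \<Rightarrow> 'a pobj \<Rightarrow> nat \<Rightarrow> 'a qform \<Rightarrow> 'a qform" where
  "form_mult R V k p = (\<lambda>v\<in>carrier V. [k] \<cdot>\<^bsub>R\<^esub> p v)"

locale half_cring = cring R for R :: "'a ring" (structure) +
  assumes two_unit: "\<one> \<oplus> \<one> \<in> Units R"
begin

definition half :: 'a where "half = inv (\<one> \<oplus> \<one>)"

lemma half_closed [simp]: "half \<in> carrier R"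
  using two_unit by (simp add: half_def)

lemma half_add: "half \<oplus> half = \<one>"
  using two_unit Units_l_inv[OF two_unit] by (simp add: half_def r_distr)

lemma half_double: "x \<in> carrier R \<Longrightarrow> half \<otimes> (x \<oplus> x) = x"
  by (metis half_add half_closed l_distr l_one r_distr)

lemma double_cancel: "x \<in> carrier R \<Longrightarrow> y \<in> carrier R \<Longrightarrow> x \<oplus> x = y \<oplus> y \<Longrightarrow> x = y"
  using half_double by metis

text \<open>The linear forms of a sum of squares are the coordinates of one linear map to A^n, and
  the form is the square length of this map. Later arguments handle T-forms through such
  maps.\<close>

lemma T_forms_iff:
  assumes V: "module R V"
  shows "q \<in> T_forms R V \<longleftrightarrow>
    (\<exists>n. \<exists>M\<in>lin_maps R V (free_mod R n). q = (\<lambda>v\<in>carrier V. ip R n (M v) (M v)))"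
proof
  assume "q \<in> T_forms R V"
  then obtain n and l :: "nat \<Rightarrow> (nat \<Rightarrow> 'a) \<Rightarrow> 'a" where l: "l \<in> {..<n} \<rightarrow> dual R V"
    and q: "q = (\<lambda>v\<in>carrier V. finsum R (\<lambda>i. l i v \<otimes> l i v) {..<n})"
    by (auto simp: T_forms_def)
  let ?M = "\<lambda>v\<in>carrier V. \<lambda>i. if i < n then l i v else \<zero>"
  have "?M \<in> lin_maps R V (free_mod R n)"
    by (rule lin_map_of_dual[OF V]) (use l in auto)
  moreover have "q = (\<lambda>v\<in>carrier V. ip R n (?M v) (?M v))"
    unfolding q ip_def
  proof (rule restrict_ext)
    fix v assume v: "v \<in> carrier V"
    have "l i v \<in> carrier R" if "i < n" for i
      using lin_mapsD(1)[of "l i" R V "ring_as_module R"] l that v by (auto simp: dual_def)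
    then show "(\<Oplus>i\<in>{..<n}. l i v \<otimes> l i v) = (\<Oplus>i\<in>{..<n}. ?M v i \<otimes> ?M v i)"
      using v by (intro finsum_cong') auto
  qed
  ultimately show "\<exists>n. \<exists>M\<in>lin_maps R V (free_mod R n). q = (\<lambda>v\<in>carrier V. ip R n (M v) (M v))"
    by blast
next
  assume "\<exists>n. \<exists>M\<in>lin_maps R V (free_mod R n). q = (\<lambda>v\<in>carrier V. ip R n (M v) (M v))"
  then obtain n M where M: "M \<in> lin_maps R V (free_mod R n)"
    and q: "q = (\<lambda>v\<in>carrier V. ip R n (M v) (M v))" by blast
  let ?l = "\<lambda>i. \<lambda>v\<in>carrier V. M v i"
  have l: "?l \<in> {..<n} \<rightarrow> dual R V"
    using coord_dual[OF V M] by auto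
  have q': "q = (\<lambda>v\<in>carrier V. finsum R (\<lambda>i. ?l i v \<otimes> ?l i v) {..<n})"
    unfolding q ip_def using lin_mapsD(1)[OF M, THEN free_mod_closed]
    by (intro restrict_ext finsum_cong') auto
  show "q \<in> T_forms R V"
    unfolding T_forms_def by (intro CollectI exI[of _ ?l] exI[of _ n] conjI l q')
qed

lemma T_formsE:
  assumes "module R V" "q \<in> T_forms R V"
  obtains n M where "M \<in> lin_maps R V (free_mod R n)" "q = pullback_form V M (eps R n)"
    "\<And>v. v \<in> carrier V \<Longrightarrow> q v = ip R n (M v) (M v)"
proof -
  obtain n M where M: "M \<in> lin_maps R V (free_mod R n)"
    and q: "q = (\<lambda>v\<in>carrier V. ip R n (M v) (M v))"
    using assms T_forms_iff by blast
  have "q = pullback_form V M (eps R n)"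
    unfolding q pullback_form_def by (rule restrict_ext) (simp add: eps_ip lin_mapsD(1)[OF M])
  with M q that show thesis by simp
qed

lemma T_forms_lin:
  assumes "module R V" "M \<in> lin_maps R V (free_mod R n)"
  shows "(\<lambda>v\<in>carrier V. ip R n (M v) (M v)) \<in> T_forms R V"
  using assms T_forms_iff by blast

lemma T_forms_add:
  assumes V: "module R V" and q: "q \<in> T_forms R V" "p \<in> T_forms R V"
  shows "form_add R V q p \<in> T_forms R V"
proof -
  obtain n M where M: "M \<in> lin_maps R V (free_mod R n)"
    "\<And>v. v \<in> carrier V \<Longrightarrow> q v = ip R n (M v) (M v)"
    using T_formsE[OF V q(1)] by metis
  obtain k P where P: "P \<in> lin_maps R V (free_mod R k)"
    "\<And>v. v \<in> carrier V \<Longrightarrow> p v = ip R k (P v) (P v)"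
    using T_formsE[OF V q(2)] by metis
  let ?N = "\<lambda>v\<in>carrier V. vcat n (M v) (P v)"
  have "form_add R V q p = (\<lambda>v\<in>carrier V. ip R (n + k) (?N v) (?N v))"
    unfolding form_add_def
    by (rule restrict_ext) (simp add: M(2) P(2) ip_vcat lin_mapsD(1)[OF M(1)] lin_mapsD(1)[OF P(1)])
  then show ?thesis
    using T_forms_lin[OF V lin_vcat[OF V M(1) P(1)]] by simp
qed

lemma T_forms_zero: "module R V \<Longrightarrow> (\<lambda>v\<in>carrier V. \<zero>) \<in> T_forms R V"
  unfolding T_forms_def by (auto intro!: exI[of _ 0] exI[of _ "\<lambda>_. undefined"])

lemma T_forms_pullback:
  assumes V: "module R V" and W: "module R W" and f: "f \<in> lin_maps R V W" and q: "q \<in> T_forms R W"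
  shows "pullback_form V f q \<in> T_forms R V"
proof -
  obtain n M where M: "M \<in> lin_maps R W (free_mod R n)"
    "\<And>v. v \<in> carrier W \<Longrightarrow> q v = ip R n (M v) (M v)"
    using T_formsE[OF W q] by metis
  let ?N = "\<lambda>v\<in>carrier V. M (f v)"
  have "pullback_form V f q = (\<lambda>v\<in>carrier V. ip R n (?N v) (?N v))"
    unfolding pullback_form_def by (rule restrict_ext) (simp add: M(2) lin_mapsD(1)[OF f])
  then show ?thesis
    using T_forms_lin[OF V lin_maps_restrict_comp[OF f M(1) V]] by simp
qed

lemma eps_T: "eps R n \<in> T_forms R (free_mod R n)"
proof -
  let ?I = "\<lambda>v\<in>carrier (free_mod R n). v"
  have "?I \<in> lin_maps R (free_mod R n) (free_mod R n)"
    by (rule lin_mapsI[OF free_mod_module]) auto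
  moreover have "eps R n = (\<lambda>v\<in>carrier (free_mod R n). ip R n (?I v) (?I v))"
    unfolding eps_def ip_def by (rule restrict_ext) simp
  ultimately show ?thesis
    using T_forms_lin[OF free_mod_module, of ?I n n] by simp
qed

lemma T_forms_closed:
  assumes "module R V" "q \<in> T_forms R V" "v \<in> carrier V"
  shows "q v \<in> carrier R"
proof -
  obtain n M where "M \<in> lin_maps R V (free_mod R n)" "q v = ip R n (M v) (M v)"
    using T_formsE[OF assms(1,2)] assms(3) by metis
  then show ?thesis
    using ip_closed[OF lin_mapsD(1) lin_mapsD(1)] assms(3) by metis
qed

lemma T_forms_square:
  assumes "l \<in> dual R V"
  shows "(\<lambda>v\<in>carrier V. l v \<otimes> l v) \<in> T_forms R V"
proof -
  have "finsum R (\<lambda>i. l v \<otimes> l v) {..<1::nat} = l v \<otimes> l v" if "v \<in> carrier V" for v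
    using lin_mapsD(1)[OF assms[unfolded dual_def] that] by (simp add: lessThan_Suc)
  then have "(\<lambda>v\<in>carrier V. l v \<otimes> l v) = (\<lambda>v\<in>carrier V. finsum R (\<lambda>i. l v \<otimes> l v) {..<1::nat})"
    by (intro restrict_ext) simp
  then show ?thesis
    unfolding T_forms_def using assms by (intro CollectI exI[of _ "\<lambda>_. l"] exI[of _ 1]) auto
qed

text \<open>Index sets other than initial segments occur in \<open>bounded_square_rq\<close>, where
  one coordinate is left out.\<close>

lemma T_forms_finsum:
  assumes V: "module R V" and "finite I" "\<And>i. i \<in> I \<Longrightarrow> l i \<in> dual R V"
  shows "(\<lambda>v\<in>carrier V. finsum R (\<lambda>i. l i v \<otimes> l i v) I) \<in> T_forms R V"
  using assms(2,3)
proof (induction I rule: finite_induct)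
  case empty
  then show ?case using T_forms_zero[OF V] by (simp only: finsum_empty)
next
  case (insert i I)
  have c: "l j v \<in> carrier R" if "j \<in> insert i I" "v \<in> carrier V" for j v
    using lin_mapsD(1)[OF insert.prems[unfolded dual_def, OF that(1)] that(2)] by simp
  have "(\<lambda>v\<in>carrier V. finsum R (\<lambda>i. l i v \<otimes> l i v) (insert i I))
    = form_add R V (\<lambda>v\<in>carrier V. l i v \<otimes> l i v) (\<lambda>v\<in>carrier V. finsum R (\<lambda>i. l i v \<otimes> l i v) I)"
    unfolding form_add_def using insert.hyps c by (intro restrict_ext) (simp add: finsum_insert)
  moreover have "l i \<in> dual R V" "(\<lambda>v\<in>carrier V. finsum R (\<lambda>i. l i v \<otimes> l i v) I) \<in> T_forms R V"
    using insert.prems insert.IH by blast+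
  ultimately show ?case
    by (simp only: T_forms_add[OF V T_forms_square])
qed

lemma T_forms_mult: "module R V \<Longrightarrow> p \<in> T_forms R V \<Longrightarrow> form_mult R V k p \<in> T_forms R V"
proof (induction k)
  case 0
  have "form_mult R V 0 p = (\<lambda>v\<in>carrier V. \<zero>)"
    unfolding form_mult_def by (rule restrict_ext) simp
  then show ?case using T_forms_zero 0 by (simp only:)
next
  case (Suc k)
  have "form_mult R V (Suc k) p = form_add R V (form_mult R V k p) p"
    unfolding form_mult_def form_add_def by (rule restrict_ext) simp
  then show ?case using Suc T_forms_add by simp
qed


subsection \<open>Closure properties of quadratic forms\<close>

lemma dual_add:
  assumes V: "module R V" and l: "l \<in> dual R V" "l' \<in> dual R V"
  shows "(\<lambda>v\<in>carrier V. l v \<oplus> l' v) \<in> dual R V"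
  unfolding dual_def
  by (rule lin_mapsI[OF V])
    (use lin_mapsD(1-3)[OF l(1)[unfolded dual_def]] lin_mapsD(1-3)[OF l(2)[unfolded dual_def]]
      in \<open>simp_all add: r_distr a_ac\<close>)

lemma dual_smult:
  assumes V: "module R V" and a: "a \<in> carrier R" and l: "l \<in> dual R V"
  shows "(\<lambda>v\<in>carrier V. a \<otimes> l v) \<in> dual R V"
  unfolding dual_def
  by (rule lin_mapsI[OF V])
    (use a lin_mapsD(1-3)[OF l(1)[unfolded dual_def]] in \<open>simp_all add: r_distr m_lcomm\<close>)

lemma dual_minus:
  assumes V: "module R V" and l: "l \<in> dual R V" "l' \<in> dual R V"
  shows "(\<lambda>v\<in>carrier V. l v \<ominus> l' v) \<in> dual R V"
  unfolding dual_def
  by (rule lin_mapsI[OF V])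
    (use lin_mapsD(1-3)[OF l(1)[unfolded dual_def]] lin_mapsD(1-3)[OF l(2)[unfolded dual_def]]
      in \<open>simp_all add: minus_eq r_distr r_minus minus_add a_ac\<close>)

lemma dual_compose:
  assumes "module R V" "f \<in> lin_maps R V W" "l \<in> dual R W"
  shows "(\<lambda>v\<in>carrier V. l (f v)) \<in> dual R V"
  unfolding dual_def by (rule lin_maps_restrict_comp[OF assms(2) assms(3)[unfolded dual_def] assms(1)])

lemma quad_forms_closed: "q \<in> quad_forms R V \<Longrightarrow> v \<in> carrier V \<Longrightarrow> q v \<in> carrier R"
  by (auto simp: quad_forms_def)

lemma quad_forms_pullback:
  assumes V: "module R V" and W: "module R W" and f: "f \<in> lin_maps R V W" and q: "q \<in> quad_forms R W"
  shows "pullback_form V f q \<in> quad_forms R V"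
proof -
  interpret V: module R V by fact
  note fD = lin_mapsD[OF f]
  have "polar R V (pullback_form V f q) v = (\<lambda>w\<in>carrier V. polar R W q (f v) (f w))"
    if "v \<in> carrier V" for v
    unfolding polar_def pullback_form_def
    by (rule restrict_ext) (use that in \<open>simp add: fD(1,2)\<close>)
  moreover have "(\<lambda>w\<in>carrier V. polar R W q (f v) (f w)) \<in> dual R V" if "v \<in> carrier V" for v
    by (rule dual_compose[OF V f]) (use q fD(1) that in \<open>auto simp: quad_forms_def\<close>)
  moreover have "pullback_form V f q (a \<odot>\<^bsub>V\<^esub> v) = (a \<otimes> a) \<otimes> pullback_form V f q v"
    if "a \<in> carrier R" "v \<in> carrier V" for a v
    using q that fD(1)[OF that(2)] by (auto simp: pullback_form_def fD(3) quad_forms_def)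
  moreover have "pullback_form V f q \<in> carrier V \<rightarrow>\<^sub>E carrier R"
    using q fD(1) by (auto simp: pullback_form_def quad_forms_def)
  ultimately show ?thesis
    by (simp add: quad_forms_def)
qed

lemma quad_forms_add:
  assumes V: "module R V" and q: "q \<in> quad_forms R V" "p \<in> quad_forms R V"
  shows "form_add R V q p \<in> quad_forms R V"
proof -
  interpret V: module R V by fact
  note c = quad_forms_closed[OF q(1)] quad_forms_closed[OF q(2)]
  have "polar R V (form_add R V q p) v = (\<lambda>w\<in>carrier V. polar R V q v w \<oplus> polar R V p v w)"
    if "v \<in> carrier V" for v
    unfolding polar_def form_add_def
    by (rule restrict_ext) (use that c in \<open>simp add: minus_eq minus_add a_ac\<close>)
  moreover have "(\<lambda>w\<in>carrier V. polar R V q v w \<oplus> polar R V p v w) \<in> dual R V" if "v \<in> carrier V" for v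
    by (rule dual_add[OF V]) (use q that in \<open>auto simp: quad_forms_def\<close>)
  moreover have "form_add R V q p (a \<odot>\<^bsub>V\<^esub> v) = (a \<otimes> a) \<otimes> form_add R V q p v"
    if "a \<in> carrier R" "v \<in> carrier V" for a v
    using q that c by (auto simp: form_add_def quad_forms_def r_distr)
  moreover have "form_add R V q p \<in> carrier V \<rightarrow>\<^sub>E carrier R"
    using c by (auto simp: form_add_def)
  ultimately show ?thesis
    by (simp add: quad_forms_def)
qed

lemma polar_eps:
  assumes "v \<in> carrier (free_mod R n)" "w \<in> carrier (free_mod R n)"
  shows "polar R (free_mod R n) (eps R n) v w = ip R n v w \<oplus> ip R n v w"
proof -
  have c: "ip R n v v \<in> carrier R" "ip R n v w \<in> carrier R" "ip R n w w \<in> carrier R"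
    using assms by auto
  have "polar R (free_mod R n) (eps R n) v w
     = (ip R n v v \<oplus> ip R n v w \<oplus> (ip R n w v \<oplus> ip R n w w)) \<ominus> ip R n v v \<ominus> ip R n w w"
    using assms by (simp add: polar_def eps_ip free_mod_add_closed ip_add_left[OF assms free_mod_add_closed]
        ip_add_right[OF assms])
  also have "ip R n w v = ip R n v w"
    using ip_comm assms by blast
  also have "(ip R n v v \<oplus> ip R n v w \<oplus> (ip R n v w \<oplus> ip R n w w)) \<ominus> ip R n v v \<ominus> ip R n w w
     = (ip R n v w \<oplus> ip R n v w) \<oplus> (ip R n v v \<ominus> ip R n v v) \<oplus> (ip R n w w \<ominus> ip R n w w)"
    using c by (simp add: minus_eq a_ac)
  also have "\<dots> = ip R n v w \<oplus> ip R n v w"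
    using c by (simp add: minus_eq r_neg)
  finally show ?thesis .
qed

lemma ip_dual:
  assumes "v \<in> carrier (free_mod R n)"
  shows "(\<lambda>w\<in>carrier (free_mod R n). ip R n v w) \<in> dual R (free_mod R n)"
  unfolding dual_def
  by (rule lin_mapsI[OF free_mod_module])
    (use assms in \<open>simp_all add: ip_closed ip_add_right[OF _ _ assms] ip_smult_right[OF _ _ assms]\<close>)

lemma eps_quad: "eps R n \<in> quad_forms R (free_mod R n)"
proof -
  let ?V = "free_mod R n"
  have "polar R ?V (eps R n) v
     = (\<lambda>w\<in>carrier ?V. (\<lambda>w\<in>carrier ?V. ip R n v w) w \<oplus> (\<lambda>w\<in>carrier ?V. ip R n v w) w)"
    if "v \<in> carrier ?V" for v
  proof (rule ext)
    fix w show "polar R ?V (eps R n) v w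
      = (\<lambda>w\<in>carrier ?V. (\<lambda>w\<in>carrier ?V. ip R n v w) w \<oplus> (\<lambda>w\<in>carrier ?V. ip R n v w) w) w"
      by (cases "w \<in> carrier ?V") (simp add: polar_eps[OF that], simp add: polar_def)
  qed
  then have "polar R ?V (eps R n) v \<in> dual R ?V" if "v \<in> carrier ?V" for v
    using dual_add[OF free_mod_module ip_dual[OF that] ip_dual[OF that]] that by simp
  moreover have "eps R n (a \<odot>\<^bsub>?V\<^esub> v) = (a \<otimes> a) \<otimes> eps R n v"
    if "a \<in> carrier R" "v \<in> carrier ?V" for a v
    using that by (simp add: eps_ip free_mod_smult_closed ip_smult_left[OF _ _ free_mod_smult_closed]
        ip_smult_right m_assoc ip_closed)
  moreover have "eps R n \<in> carrier ?V \<rightarrow>\<^sub>E carrier R"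
    using eps_ip ip_closed by (auto simp: PiE_iff eps_def extensional_def)
  ultimately show ?thesis
    by (simp add: quad_forms_def)
qed

lemma T_subset_quad:
  assumes "module R V"
  shows "T_forms R V \<subseteq> quad_forms R V"
proof
  fix q assume "q \<in> T_forms R V"
  then obtain n M where "M \<in> lin_maps R V (free_mod R n)" "q = pullback_form V M (eps R n)"
    using T_formsE[OF assms] by metis
  then show "q \<in> quad_forms R V"
    using quad_forms_pullback[OF assms free_mod_module _ eps_quad] by simp
qed

lemma eps_nondegenerate: "nondegenerate R (free_mod R n) (eps R n)"
  unfolding nondegenerate_def
proof (rule bij_betw_imageI)
  let ?V = "free_mod R n"
  have at_uvec: "ip R n v (uvec R j) = v j" if "v \<in> carrier ?V" "j < n" for v j
  proof -
    have "ip R n v (uvec R j) = (\<Oplus>i\<in>{..<n}. if j = i then v i else \<zero>)"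
      unfolding ip_def by (rule finsum_cong') (use free_mod_closed[OF that(1)] in \<open>auto simp: uvec_def\<close>)
    also have "\<dots> = v j"
      by (rule finsum_singleton) (use free_mod_closed[OF that(1)] that in auto)
    finally show ?thesis .
  qed
  show "inj_on (polar R ?V (eps R n)) (carrier ?V)"
  proof (rule inj_onI)
    fix v w assume vw: "v \<in> carrier ?V" "w \<in> carrier ?V"
      and eq: "polar R ?V (eps R n) v = polar R ?V (eps R n) w"
    show "v = w"
    proof
      fix i show "v i = w i"
      proof (cases "i < n")
        case True
        then have "v i \<oplus> v i = w i \<oplus> w i"
          using fun_cong[OF eq, of "uvec R i"] vw by (simp add: polar_eps at_uvec)
        then show ?thesis
          using double_cancel vw free_mod_closed by blast
      qed (use vw in \<open>simp add: free_mod_tail\<close>)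
    qed
  qed
  show "polar R ?V (eps R n) ` carrier ?V = dual R ?V"
  proof
    show "polar R ?V (eps R n) ` carrier ?V \<subseteq> dual R ?V"
      using eps_quad by (auto simp: quad_forms_def)
    show "dual R ?V \<subseteq> polar R ?V (eps R n) ` carrier ?V"
    proof
      fix l assume l: "l \<in> dual R ?V"
      note lD = lin_mapsD[OF l[unfolded dual_def]]
      \<comment> \<open>The coefficient vector of \<open>l\<close>, halved because the polar form of
        \<open>eps\<close> is twice \<open>ip\<close> by \<open>polar_eps\<close>.\<close>
      define v where "v = (\<lambda>i. if i < n then half \<otimes> l (uvec R i) else \<zero>)"
      have lu: "l (uvec R i) \<in> carrier R" if "i < n" for i
        using lD(1)[of "uvec R i"] that by simp
      have v: "v \<in> carrier ?V"
        using lu by (auto simp: v_def free_mod_iff)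
      have "l w = polar R ?V (eps R n) v w" for w
      proof (cases "w \<in> carrier ?V")
        case True
        have "ip R n v w \<oplus> ip R n v w = ip R n (\<lambda>i. v i \<oplus> v i) w"
          using ip_add_left[OF v v True] by simp
        also have "\<dots> = l w"
          unfolding dual_expansion[OF l True] ip_def
        proof (rule finsum_cong')
          fix i assume "i \<in> {..<n}"
          then show "(v i \<oplus> v i) \<otimes> w i = w i \<otimes> l (uvec R i)"
            using lu[of i] free_mod_closed[OF True, of i]
            by (simp add: v_def m_comm l_distr[symmetric] half_add)
        qed (use lu free_mod_closed[OF True] in auto)
        finally show ?thesis using polar_eps[OF v True] by simp
      qed (use lD(4) in \<open>simp add: polar_def\<close>)
      then have "l = polar R ?V (eps R n) v"
        by (rule ext)
      then show "l \<in> polar R ?V (eps R n) ` carrier ?V"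
        using v by blast
    qed
  qed
qed

text \<open>Up to the unit 1/2, a form is a sum of products \<open>x\<^sub>j l\<^sub>j\<close> of linear forms, and
  \<open>l l' = ((l + l') / 2)\<^sup>2 - ((l - l') / 2)\<^sup>2\<close>.\<close>

lemma quad_form_difference:
  assumes q: "q \<in> quad_forms R (free_mod R m)"
  shows "\<exists>p\<in>T_forms R (free_mod R m). form_add R (free_mod R m) q p \<in> T_forms R (free_mod R m)"
proof -
  let ?V = "free_mod R m"
  note V = free_mod_module[of m]
  note qc = quad_forms_closed[OF q]
  \<comment> \<open>The factors of the expansion of \<open>q\<close> as the sum of the products x_j
    l_j: half the polar form against the j-th unit vector.\<close>
  define l where "l j = (\<lambda>v\<in>carrier ?V. half \<otimes> polar R ?V q (uvec R j) v)" for j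
  have pd: "polar R ?V q v \<in> dual R ?V" if "v \<in> carrier ?V" for v
    using q that by (simp add: quad_forms_def)
  have pc: "polar R ?V q v w \<in> carrier R" if "v \<in> carrier ?V" "w \<in> carrier ?V" for v w
    using lin_mapsD(1)[OF pd[unfolded dual_def, OF that(1)] that(2)] by simp
  have l: "l j \<in> dual R ?V" if "j < m" for j
    unfolding l_def by (rule dual_smult[OF V]) (use that pd in simp_all)
  have lc: "l j v \<in> carrier R" if "j < m" "v \<in> carrier ?V" for j v
    using lin_mapsD(1)[OF l[unfolded dual_def, OF that(1)] that(2)] by simp
  have qv: "q v = (\<Oplus>j\<in>{..<m}. v j \<otimes> l j v)" if v: "v \<in> carrier ?V" for v
  proof -
    \<comment> \<open>Since q(2v) = 4 q(v), the polar form at (v, v) is 4 q(v) - 2 q(v) = 2 q(v),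
      and halving recovers q(v).\<close>
    have "q ((\<one> \<oplus> \<one>) \<odot>\<^bsub>?V\<^esub> v) = ((\<one> \<oplus> \<one>) \<otimes> (\<one> \<oplus> \<one>)) \<otimes> q v"
      using q v by (simp add: quad_forms_def del: free_mod_simps)
    moreover have "(\<one> \<oplus> \<one>) \<odot>\<^bsub>?V\<^esub> v = v \<oplus>\<^bsub>?V\<^esub> v"
      using free_mod_closed[OF v] by (simp add: l_distr)
    ultimately have "polar R ?V q v v = (q v \<oplus> q v \<oplus> (q v \<oplus> q v)) \<ominus> q v \<ominus> q v"
      using v qc[OF v] by (simp add: polar_def l_distr r_distr del: free_mod_simps)
    also have "\<dots> = (q v \<oplus> q v) \<oplus> (q v \<ominus> q v) \<oplus> (q v \<ominus> q v)"
      using qc[OF v] by (simp add: minus_eq a_ac)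
    also have "\<dots> = q v \<oplus> q v"
      using qc[OF v] by (simp add: minus_eq r_neg)
    finally have "q v = half \<otimes> polar R ?V q v v"
      using half_double qc[OF v] by simp
    also have "polar R ?V q v v = (\<Oplus>j\<in>{..<m}. v j \<otimes> polar R ?V q v (uvec R j))"
      by (rule dual_expansion[OF pd[OF v] v])
    also have "half \<otimes> \<dots> = (\<Oplus>j\<in>{..<m}. half \<otimes> (v j \<otimes> polar R ?V q v (uvec R j)))"
      by (rule finsum_rdistr) (use v pc free_mod_closed[OF v] in auto)
    also have "\<dots> = (\<Oplus>j\<in>{..<m}. v j \<otimes> l j v)"
    proof (rule finsum_cong')
      fix j assume j: "j \<in> {..<m}"
      have "v \<oplus>\<^bsub>?V\<^esub> uvec R j = uvec R j \<oplus>\<^bsub>?V\<^esub> v"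
        using free_mod_closed[OF v] by (simp add: a_comm)
      moreover have "v \<oplus>\<^bsub>?V\<^esub> uvec R j \<in> carrier ?V"
        using v j by (simp add: free_mod_add_closed)
      ultimately have "polar R ?V q v (uvec R j) = polar R ?V q (uvec R j) v"
        using v j qc by (simp add: polar_def minus_eq a_ac del: free_mod_simps)
      then show "half \<otimes> (v j \<otimes> polar R ?V q v (uvec R j)) = v j \<otimes> l j v"
        using v j pc[of "uvec R j" v] free_mod_closed[OF v] by (simp add: l_def m_lcomm)
    qed (use v lc free_mod_closed[OF v] in auto)
    finally show ?thesis .
  qed
  \<comment> \<open>Induction over the partial sums: each product x_k l_k contributes one square to
    \<open>p\<close> and one to \<open>t\<close>.\<close>
  have "\<exists>p\<in>T_forms R ?V. \<exists>t\<in>T_forms R ?V.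
      \<forall>v\<in>carrier ?V. (\<Oplus>j\<in>{..<k}. v j \<otimes> l j v) \<oplus> p v = t v" if "k \<le> m" for k
    using that
  proof (induction k)
    case 0
    show ?case
      by (intro bexI[of _ "\<lambda>v\<in>carrier ?V. \<zero>"] T_forms_zero[OF V]) simp
  next
    case (Suc k)
    then obtain p t where p: "p \<in> T_forms R ?V" and t: "t \<in> T_forms R ?V"
      and eq: "\<And>v. v \<in> carrier ?V \<Longrightarrow> (\<Oplus>j\<in>{..<k}. v j \<otimes> l j v) \<oplus> p v = t v"
      by (meson Suc_leD)
    define x where "x = (\<lambda>v\<in>carrier ?V. (\<lambda>v\<in>carrier ?V. v) v k)"
    have x: "x \<in> dual R ?V"
      unfolding x_def by (intro coord_dual[OF V] lin_mapsI[OF V]) auto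
    define a where "a = (\<lambda>v\<in>carrier ?V. half \<otimes> (\<lambda>v\<in>carrier ?V. x v \<oplus> l k v) v)"
    define b where "b = (\<lambda>v\<in>carrier ?V. half \<otimes> (\<lambda>v\<in>carrier ?V. x v \<ominus> l k v) v)"
    have a: "a \<in> dual R ?V" and b: "b \<in> dual R ?V"
      unfolding a_def b_def using Suc.prems
      by (intro dual_smult dual_add dual_minus V x l; simp)+
    have key: "v k \<otimes> l k v \<oplus> b v \<otimes> b v = a v \<otimes> a v" if v: "v \<in> carrier ?V" for v
    proof -
      have c: "v k \<in> carrier R" "l k v \<in> carrier R"
        using v lc Suc.prems by (auto simp: free_mod_closed)
      have ab: "a v = half \<otimes> v k \<oplus> half \<otimes> l k v" "b v = half \<otimes> v k \<ominus> half \<otimes> l k v"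
        using v c by (simp_all add: a_def b_def x_def r_distr minus_eq r_minus)
      \<comment> \<open>In terms of the halves s and r of the two factors, the identity to prove is
        4 s r + (s - r)^2 = (s + r)^2, with integer coefficients.\<close>
      define s r where "s = half \<otimes> v k" and "r = half \<otimes> l k v"
      have sr: "s \<in> carrier R" "r \<in> carrier R"
        using c by (auto simp: s_def r_def)
      have vk: "v k = s \<oplus> s" "l k v = r \<oplus> r"
        using c half_double by (simp_all add: s_def r_def r_distr)
      have "(s \<oplus> s) \<otimes> (r \<oplus> r) \<oplus> (s \<ominus> r) \<otimes> (s \<ominus> r)
        = (s \<oplus> r) \<otimes> (s \<oplus> r) \<oplus> (s \<otimes> r \<ominus> s \<otimes> r) \<oplus> (s \<otimes> r \<ominus> s \<otimes> r)"
        using sr by (simp add: minus_eq l_distr r_distr l_minus r_minus a_ac m_comm)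
      also have "\<dots> = (s \<oplus> r) \<otimes> (s \<oplus> r)"
        using sr by (simp add: minus_eq r_neg)
      finally show ?thesis
        unfolding ab s_def[symmetric] r_def[symmetric] by (simp only: vk)
    qed
    let ?p = "form_add R ?V p (\<lambda>v\<in>carrier ?V. b v \<otimes> b v)"
      and ?t = "form_add R ?V t (\<lambda>v\<in>carrier ?V. a v \<otimes> a v)"
    have "?p \<in> T_forms R ?V" "?t \<in> T_forms R ?V"
      using T_forms_add[OF V] T_forms_square a b p t by auto
    moreover have "(\<Oplus>j\<in>{..<Suc k}. v j \<otimes> l j v) \<oplus> ?p v = ?t v" if v: "v \<in> carrier ?V" for v
    proof -
      have c: "v k \<otimes> l k v \<in> carrier R" "(\<Oplus>j\<in>{..<k}. v j \<otimes> l j v) \<in> carrier R" "p v \<in> carrier R"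
        "b v \<otimes> b v \<in> carrier R"
        using v lc Suc.prems T_forms_closed[OF V p v] lin_mapsD(1)[OF b[unfolded dual_def] v]
        by (auto simp: free_mod_closed intro!: finsum_closed)
      have "(\<Oplus>j\<in>{..<Suc k}. v j \<otimes> l j v) = v k \<otimes> l k v \<oplus> (\<Oplus>j\<in>{..<k}. v j \<otimes> l j v)"
        unfolding lessThan_Suc using c v lc Suc.prems
        by (subst finsum_insert) (auto simp: free_mod_closed)
      then have "(\<Oplus>j\<in>{..<Suc k}. v j \<otimes> l j v) \<oplus> ?p v
        = ((\<Oplus>j\<in>{..<k}. v j \<otimes> l j v) \<oplus> p v) \<oplus> (v k \<otimes> l k v \<oplus> b v \<otimes> b v)"
        using v c by (simp add: form_add_def a_ac)
      then show ?thesis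
        using v by (simp add: eq key form_add_def)
    qed
    ultimately show ?case by blast
  qed
  then obtain p t where p: "p \<in> T_forms R ?V" and t: "t \<in> T_forms R ?V"
    and eq: "\<And>v. v \<in> carrier ?V \<Longrightarrow> (\<Oplus>j\<in>{..<m}. v j \<otimes> l j v) \<oplus> p v = t v"
    by blast
  have "form_add R ?V q p = t"
  proof
    fix v show "form_add R ?V q p v = t v"
    proof (cases "v \<in> carrier ?V")
      case True
      then show ?thesis using eq qv by (simp add: form_add_def)
    next
      case False
      moreover have "t \<in> extensional (carrier ?V)"
        using t T_subset_quad[OF V] by (auto simp: quad_forms_def PiE_def)
      ultimately show ?thesis
        by (simp add: form_add_def extensional_def)
    qed
  qed
  then show ?thesis using p t by blast
qed

end


context half_cring
begin

section \<open>Bounded forms\<close>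

text \<open>The relation t <= C eps_m for the preorder in which T-forms are positive. A natural
  number as the bound lets bounds add and can later be raised to a power of 4. Only the values of
  \<open>t\<close> on the carrier count, so \<open>t\<close> may be an unrestricted formula.\<close>

definition bounded_form :: "nat \<Rightarrow> 'a qform \<Rightarrow> bool" where
  "bounded_form m t \<longleftrightarrow> (\<exists>p\<in>T_forms R (free_mod R m). \<exists>C::nat.
     \<forall>v\<in>carrier (free_mod R m). t v \<oplus> p v = [C] \<cdot> ip R m v v)"

lemma dual_closed: "l \<in> dual R V \<Longrightarrow> v \<in> carrier V \<Longrightarrow> l v \<in> carrier R"
  unfolding dual_def using lin_mapsD(1) by fastforce

lemma bounded_form_zero: "bounded_form m (\<lambda>v. \<zero>)"
  unfolding bounded_form_def
  by (rule bexI[OF exI[of _ 0] T_forms_zero[OF free_mod_module]]) simp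

lemma bounded_form_add:
  assumes "bounded_form m t" "bounded_form m t'"
    and c: "\<And>v. v \<in> carrier (free_mod R m) \<Longrightarrow> t v \<in> carrier R"
      "\<And>v. v \<in> carrier (free_mod R m) \<Longrightarrow> t' v \<in> carrier R"
  shows "bounded_form m (\<lambda>v. t v \<oplus> t' v)"
proof -
  let ?V = "free_mod R m"
  note V = free_mod_module[of m]
  obtain p C where p: "p \<in> T_forms R ?V"
    "\<And>v. v \<in> carrier ?V \<Longrightarrow> t v \<oplus> p v = [(C::nat)] \<cdot> ip R m v v"
    using assms(1) unfolding bounded_form_def by blast
  obtain p' C' where p': "p' \<in> T_forms R ?V"
    "\<And>v. v \<in> carrier ?V \<Longrightarrow> t' v \<oplus> p' v = [(C'::nat)] \<cdot> ip R m v v"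
    using assms(2) unfolding bounded_form_def by blast
  have "(t v \<oplus> t' v) \<oplus> form_add R ?V p p' v = [(C + C')] \<cdot> ip R m v v" if v: "v \<in> carrier ?V" for v
  proof -
    have "(t v \<oplus> t' v) \<oplus> form_add R ?V p p' v = (t v \<oplus> p v) \<oplus> (t' v \<oplus> p' v)"
      using v c T_forms_closed[OF V p(1)] T_forms_closed[OF V p'(1)] by (simp add: form_add_def a_ac)
    then show ?thesis
      using p(2)[OF v] p'(2)[OF v] v by (simp add: add.nat_pow_mult ip_closed)
  qed
  then show ?thesis
    unfolding bounded_form_def using T_forms_add[OF V p(1) p'(1)] by blast
qed

text \<open>By the identity \<open>(l + l')\<^sup>2 + (l - l')\<^sup>2 = 2 l\<^sup>2 + 2 l'\<^sup>2\<close>.\<close>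

lemma bounded_square_add:
  assumes l: "l \<in> dual R (free_mod R m)" "l' \<in> dual R (free_mod R m)"
    and b: "bounded_form m (\<lambda>v. l v \<otimes> l v)" "bounded_form m (\<lambda>v. l' v \<otimes> l' v)"
  shows "bounded_form m (\<lambda>v. (l v \<oplus> l' v) \<otimes> (l v \<oplus> l' v))"
proof -
  let ?V = "free_mod R m"
  note V = free_mod_module[of m]
  note c = dual_closed[OF l(1)] dual_closed[OF l(2)]
  \<comment> \<open>Twice the sum of the two squares, written as a sum with itself.\<close>
  have "bounded_form m (\<lambda>v. (l v \<otimes> l v \<oplus> l' v \<otimes> l' v) \<oplus> (l v \<otimes> l v \<oplus> l' v \<otimes> l' v))"
    using c by (intro bounded_form_add b) auto
  then obtain p C where p: "p \<in> T_forms R ?V"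
    "\<And>v. v \<in> carrier ?V \<Longrightarrow> ((l v \<otimes> l v \<oplus> l' v \<otimes> l' v) \<oplus> (l v \<otimes> l v \<oplus> l' v \<otimes> l' v)) \<oplus> p v
      = [(C::nat)] \<cdot> ip R m v v"
    unfolding bounded_form_def by blast
  \<comment> \<open>Its square is the term by which the parallelogram identity enlarges the
    complement.\<close>
  define d where "d = (\<lambda>v\<in>carrier ?V. l v \<ominus> l' v)"
  have d: "d \<in> dual R ?V"
    unfolding d_def by (rule dual_minus[OF V l])
  let ?p = "form_add R ?V (\<lambda>v\<in>carrier ?V. d v \<otimes> d v) p"
  have "(l v \<oplus> l' v) \<otimes> (l v \<oplus> l' v) \<oplus> ?p v = [C] \<cdot> ip R m v v" if v: "v \<in> carrier ?V" for v
  proof -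
    have "l v \<in> carrier R" "l' v \<in> carrier R" "p v \<in> carrier R"
      using v c T_forms_closed[OF V p(1)] by auto
    then have "(l v \<oplus> l' v) \<otimes> (l v \<oplus> l' v) \<oplus> ((l v \<ominus> l' v) \<otimes> (l v \<ominus> l' v) \<oplus> p v)
      = ((l v \<otimes> l v \<oplus> l' v \<otimes> l' v) \<oplus> (l v \<otimes> l v \<oplus> l' v \<otimes> l' v)) \<oplus> p v"
      by algebra
    then show ?thesis
      using v p(2) by (simp add: form_add_def d_def)
  qed
  then show ?thesis
    unfolding bounded_form_def using T_forms_add[OF V T_forms_square[OF d] p(1)] by blast
qed

lemma coordinate_dual: "(\<lambda>v\<in>carrier (free_mod R m). v j) \<in> dual R (free_mod R m)"
  unfolding dual_def by (rule lin_mapsI[OF free_mod_module]) (auto simp: free_mod_closed)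

text \<open>If 1 - a^2 is the sum of the b_i^2, then (a v_j)^2 together with the squares (b_i v_j)^2
  gives v_j^2, and the squares of the remaining coordinates complete it to eps_m. The bound is
  1.\<close>

lemma bounded_square_rq:
  assumes a: "a \<in> rq R" and j: "j < m"
  shows "bounded_form m (\<lambda>v. (a \<otimes> v j) \<otimes> (a \<otimes> v j))"
proof -
  let ?V = "free_mod R m"
  note V = free_mod_module[of m]
  define x where "x i = (\<lambda>v\<in>carrier ?V. v i)" for i
  have x: "x i \<in> dual R ?V" for i
    unfolding x_def by (rule coordinate_dual)
  have aR: "a \<in> carrier R"
    using a by (simp add: rq_def)
  obtain f k where f: "f \<in> {..<k::nat} \<rightarrow> {x \<otimes> x | x. x \<in> carrier R}"
    and fs: "\<one> \<ominus> a \<otimes> a = finsum R f {..<k}"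
    using a by (auto simp: rq_def sums_of_squares_def fin_sums_def)
  have "\<forall>i\<in>{..<k}. \<exists>y. y \<in> carrier R \<and> f i = y \<otimes> y"
    using f unfolding Pi_iff by blast
  then obtain b where "\<forall>i\<in>{..<k}. b i \<in> carrier R \<and> f i = b i \<otimes> b i"
    using bchoice[of "{..<k}" "\<lambda>i y. y \<in> carrier R \<and> f i = y \<otimes> y"] by blast
  then have b: "\<And>i. i < k \<Longrightarrow> b i \<in> carrier R" "\<And>i. i < k \<Longrightarrow> f i = b i \<otimes> b i"
    by simp_all
  let ?p1 = "\<lambda>v\<in>carrier ?V. \<Oplus>i\<in>{..<k}. (\<lambda>v\<in>carrier ?V. b i \<otimes> x j v) v \<otimes> (\<lambda>v\<in>carrier ?V. b i \<otimes> x j v) v"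
  let ?p2 = "\<lambda>v\<in>carrier ?V. \<Oplus>i\<in>{..<m} - {j}. x i v \<otimes> x i v"
  have "?p1 \<in> T_forms R ?V"
    by (rule T_forms_finsum[OF V, of "{..<k}" "\<lambda>i. \<lambda>v\<in>carrier ?V. b i \<otimes> x j v"])
      (rule finite_lessThan, rule dual_smult[OF V b(1) x], simp)
  moreover have "?p2 \<in> T_forms R ?V"
    by (rule T_forms_finsum[OF V, of "{..<m} - {j}" x]) (simp_all add: x)
  ultimately have T: "form_add R ?V ?p1 ?p2 \<in> T_forms R ?V"
    by (rule T_forms_add[OF V])
  have "(a \<otimes> v j) \<otimes> (a \<otimes> v j) \<oplus> form_add R ?V ?p1 ?p2 v = [(1::nat)] \<cdot> ip R m v v"
    if v: "v \<in> carrier ?V" for v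
  proof -
    note vc = free_mod_closed[OF v]
    have "?p1 v = (\<Oplus>i\<in>{..<k}. f i \<otimes> (v j \<otimes> v j))"
    proof -
      have "?p1 v = (\<Oplus>i\<in>{..<k}. (b i \<otimes> v j) \<otimes> (b i \<otimes> v j))"
        using v by (simp add: x_def)
      also have "\<dots> = (\<Oplus>i\<in>{..<k}. f i \<otimes> (v j \<otimes> v j))"
        by (rule finsum_cong') (use b vc in \<open>auto simp: m_ac\<close>)
      finally show ?thesis .
    qed
    also have "\<dots> = finsum R f {..<k} \<otimes> (v j \<otimes> v j)"
      by (rule finsum_ldistr[symmetric]) (use b vc in auto)
    also have "\<dots> = (\<one> \<ominus> a \<otimes> a) \<otimes> (v j \<otimes> v j)"
      by (simp add: fs)
    finally have p1: "?p1 v = (\<one> \<ominus> a \<otimes> a) \<otimes> (v j \<otimes> v j)" .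
    have p2: "?p2 v = (\<Oplus>i\<in>{..<m} - {j}. v i \<otimes> v i)"
      using v by (simp add: x_def)
    have "{..<m} = insert j ({..<m} - {j})"
      using j by auto
    then have "ip R m v v = finsum R (\<lambda>i. v i \<otimes> v i) (insert j ({..<m} - {j}))"
      unfolding ip_def by metis
    also have "\<dots> = v j \<otimes> v j \<oplus> ?p2 v"
      unfolding p2 by (rule finsum_insert) (use vc in auto)
    finally have ipv: "ip R m v v = v j \<otimes> v j \<oplus> ?p2 v" .
    have "?p2 v \<in> carrier R"
      unfolding p2 using vc by (intro finsum_closed) auto
    moreover have "(a \<otimes> y) \<otimes> (a \<otimes> y) \<oplus> ((\<one> \<ominus> a \<otimes> a) \<otimes> (y \<otimes> y) \<oplus> z) = y \<otimes> y \<oplus> z"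
      if "y \<in> carrier R" "z \<in> carrier R" for y z
      using aR that by algebra
    ultimately have "(a \<otimes> v j) \<otimes> (a \<otimes> v j) \<oplus> ((\<one> \<ominus> a \<otimes> a) \<otimes> (v j \<otimes> v j) \<oplus> ?p2 v) = v j \<otimes> v j \<oplus> ?p2 v"
      using vc[of j] by blast
    moreover have "form_add R ?V ?p1 ?p2 v = ?p1 v \<oplus> ?p2 v"
      unfolding form_add_def by (rule restrict_apply'[OF v])
    moreover have "[(1::nat)] \<cdot> ip R m v v = ip R m v v"
      using ip_closed[OF v v] by simp
    ultimately show ?thesis
      by (simp only: p1 ipv)
  qed
  then show ?thesis
    unfolding bounded_form_def using T by blast
qed

context
  assumes Rq: "Rq R = carrier R"
begin

text \<open>The point at which Rq(A) = A acts: \<open>a\<close> is a sum of elements of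
  \<open>rq R\<close>, for each of which the bound is known, and \<open>bounded_square_add\<close>
  adds them one at a time.\<close>

lemma bounded_square_monomial:
  assumes a: "a \<in> carrier R" and j: "j < m"
  shows "bounded_form m (\<lambda>v. (a \<otimes> v j) \<otimes> (a \<otimes> v j))"
proof -
  let ?V = "free_mod R m"
  note V = free_mod_module[of m]
  obtain f n where f: "f \<in> {..<n::nat} \<rightarrow> rq R" and an: "a = finsum R f {..<n}"
    using a unfolding Rq[symmetric] Rq_def fin_sums_def by blast
  have fc: "f i \<in> carrier R" if "i < n" for i
    using f that by (auto simp: rq_def)
  have "bounded_form m (\<lambda>v. (finsum R f {..<k} \<otimes> v j) \<otimes> (finsum R f {..<k} \<otimes> v j))" if "k \<le> n" for k
    using that
  proof (induction k)
    case 0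
    have "(\<zero> \<otimes> v j) \<otimes> (\<zero> \<otimes> v j) = \<zero>" if "v \<in> carrier ?V" for v
      using free_mod_closed[OF that] by simp
    then show ?case
      using bounded_form_zero[of m] by (simp add: bounded_form_def)
  next
    case (Suc k)
    define g where "g = finsum R f {..<k}"
    have g: "g \<in> carrier R" "f k \<in> carrier R"
      unfolding g_def using fc Suc.prems by (auto intro!: finsum_closed)
    let ?l = "\<lambda>b. \<lambda>v\<in>carrier ?V. b \<otimes> (\<lambda>v\<in>carrier ?V. v j) v"
    have l: "?l b \<in> dual R ?V" if "b \<in> carrier R" for b
      by (rule dual_smult[OF V that coordinate_dual])
    have eq: "bounded_form m (\<lambda>v. ?l b v \<otimes> ?l b v) \<longleftrightarrow> bounded_form m (\<lambda>v. (b \<otimes> v j) \<otimes> (b \<otimes> v j))" for b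
      by (simp add: bounded_form_def)
    have "bounded_form m (\<lambda>v. ?l g v \<otimes> ?l g v)"
      unfolding eq using Suc by (simp add: g_def)
    moreover have "bounded_form m (\<lambda>v. ?l (f k) v \<otimes> ?l (f k) v)"
      unfolding eq using f Suc.prems by (intro bounded_square_rq j) auto
    ultimately have "bounded_form m (\<lambda>v. (?l g v \<oplus> ?l (f k) v) \<otimes> (?l g v \<oplus> ?l (f k) v))"
      using bounded_square_add l g by blast
    moreover have "finsum R f {..<Suc k} = f k \<oplus> g"
      unfolding lessThan_Suc g_def using fc Suc.prems by (intro finsum_insert) auto
    ultimately show ?case
      using g by (simp add: bounded_form_def l_distr a_comm free_mod_closed)
  qed
  then show ?thesis using an by simp
qed

text \<open>By \<open>dual_expansion\<close>, \<open>l\<close> is a sum of monomials l(e_j) v_j,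
  which are again added one at a time with \<open>bounded_square_add\<close>.\<close>

lemma bounded_square_dual:
  assumes l: "l \<in> dual R (free_mod R m)"
  shows "bounded_form m (\<lambda>v. l v \<otimes> l v)"
proof -
  let ?V = "free_mod R m"
  note V = free_mod_module[of m]
  define g where "g j = (\<lambda>v\<in>carrier ?V. l (uvec R j) \<otimes> (\<lambda>v\<in>carrier ?V. v j) v)" for j
  have lu: "l (uvec R j) \<in> carrier R" if "j < m" for j
    using dual_closed[OF l] that by simp
  have g: "g j \<in> dual R ?V" if "j < m" for j
    unfolding g_def by (rule dual_smult[OF V lu[OF that] coordinate_dual])
  have "\<exists>s\<in>dual R ?V. (\<forall>v\<in>carrier ?V. s v = (\<Oplus>j\<in>{..<k}. v j \<otimes> l (uvec R j))) \<and>
      bounded_form m (\<lambda>v. s v \<otimes> s v)" if "k \<le> m" for k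
    using that
  proof (induction k)
    case 0
    have "(\<lambda>v\<in>carrier ?V. \<zero>) \<in> dual R ?V"
      unfolding dual_def by (rule lin_mapsI[OF V]) auto
    moreover have "bounded_form m (\<lambda>v. (\<lambda>v\<in>carrier ?V. \<zero>) v \<otimes> (\<lambda>v\<in>carrier ?V. \<zero>) v)"
      using bounded_form_zero[of m] by (simp add: bounded_form_def)
    ultimately show ?case
      by (intro bexI[of _ "\<lambda>v\<in>carrier ?V. \<zero>"]) simp_all
  next
    case (Suc k)
    then obtain s where s: "s \<in> dual R ?V" "\<And>v. v \<in> carrier ?V \<Longrightarrow> s v = (\<Oplus>j\<in>{..<k}. v j \<otimes> l (uvec R j))"
      "bounded_form m (\<lambda>v. s v \<otimes> s v)"
      by (meson Suc_leD)
    have gk: "g k \<in> dual R ?V"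
      using g Suc.prems by simp
    have "bounded_form m (\<lambda>v. g k v \<otimes> g k v)"
      using bounded_square_monomial[OF lu, of k k m] Suc.prems by (simp add: bounded_form_def g_def)
    then have "bounded_form m (\<lambda>v. (s v \<oplus> g k v) \<otimes> (s v \<oplus> g k v))"
      by (rule bounded_square_add[OF s(1) gk s(3)])
    then have "bounded_form m (\<lambda>v. (\<lambda>v\<in>carrier ?V. s v \<oplus> g k v) v \<otimes> (\<lambda>v\<in>carrier ?V. s v \<oplus> g k v) v)"
      by (simp add: bounded_form_def)
    moreover have "(\<lambda>v\<in>carrier ?V. s v \<oplus> g k v) v = (\<Oplus>j\<in>{..<Suc k}. v j \<otimes> l (uvec R j))"
      if v: "v \<in> carrier ?V" for v
    proof -
      have "(\<Oplus>j\<in>{..<Suc k}. v j \<otimes> l (uvec R j)) = v k \<otimes> l (uvec R k) \<oplus> (\<Oplus>j\<in>{..<k}. v j \<otimes> l (uvec R j))"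
        unfolding lessThan_Suc using lu Suc.prems free_mod_closed[OF v] by (intro finsum_insert) auto
      moreover have "(\<Oplus>j\<in>{..<k}. v j \<otimes> l (uvec R j)) \<in> carrier R"
        using lu Suc.prems free_mod_closed[OF v] by (intro finsum_closed) auto
      ultimately show ?thesis
        using v s(2) lu[of k] Suc.prems free_mod_closed[OF v, of k]
        by (simp add: g_def a_comm m_comm)
    qed
    ultimately show ?case
      using dual_add[OF V s(1) gk] by blast
  qed
  then obtain s where s: "\<And>v. v \<in> carrier ?V \<Longrightarrow> s v = (\<Oplus>j\<in>{..<m}. v j \<otimes> l (uvec R j))"
      "bounded_form m (\<lambda>v. s v \<otimes> s v)"
    by blast
  then show ?thesis
    using dual_expansion[OF l] by (simp add: bounded_form_def)
qed

lemma bounded_T_form: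
  assumes "t \<in> T_forms R (free_mod R m)"
  shows "bounded_form m t"
proof -
  let ?V = "free_mod R m"
  obtain n and l :: "nat \<Rightarrow> (nat \<Rightarrow> 'a) \<Rightarrow> 'a" where l: "l \<in> {..<n} \<rightarrow> dual R ?V"
    and t: "t = (\<lambda>v\<in>carrier ?V. finsum R (\<lambda>i. l i v \<otimes> l i v) {..<n})"
    using assms by (auto simp: T_forms_def)
  have lc: "l i v \<in> carrier R" if "i < n" "v \<in> carrier ?V" for i v
    using dual_closed l that by blast
  have "bounded_form m (\<lambda>v. finsum R (\<lambda>i. l i v \<otimes> l i v) {..<k})" if "k \<le> n" for k
    using that
  proof (induction k)
    case 0
    then show ?case using bounded_form_zero by simp
  next
    case (Suc k)
    have "bounded_form m (\<lambda>v. l k v \<otimes> l k v)"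
      using l Suc.prems by (intro bounded_square_dual) auto
    then have "bounded_form m (\<lambda>v. l k v \<otimes> l k v \<oplus> finsum R (\<lambda>i. l i v \<otimes> l i v) {..<k})"
      using lc Suc by (intro bounded_form_add) (auto intro!: finsum_closed)
    moreover have "l k v \<otimes> l k v \<oplus> finsum R (\<lambda>i. l i v \<otimes> l i v) {..<k}
      = finsum R (\<lambda>i. l i v \<otimes> l i v) {..<Suc k}" if "v \<in> carrier ?V" for v
      unfolding lessThan_Suc using lc Suc.prems that by (intro finsum_insert[symmetric]) auto
    ultimately show ?case
      by (simp add: bounded_form_def)
  qed
  then have "bounded_form m (\<lambda>v. finsum R (\<lambda>i. l i v \<otimes> l i v) {..<n})"
    by simp
  then show ?thesis
    by (simp add: bounded_form_def t)
qed

lemma two_pow_square_mult: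
  assumes "x \<in> carrier R"
  shows "[((4::nat) ^ k)] \<cdot> x = (((\<one> \<oplus> \<one>) [^] k) \<otimes> ((\<one> \<oplus> \<one>) [^] k)) \<otimes> x"
proof (induction k)
  case 0
  then show ?case using assms by simp
next
  case (Suc k)
  define u where "u = (\<one> \<oplus> \<one>) [^] k"
  have u: "u \<in> carrier R"
    by (simp add: u_def)
  have "[((4::nat) ^ Suc k)] \<cdot> x = [(4::nat)] \<cdot> ([((4::nat) ^ k)] \<cdot> x)"
    using assms by (simp add: add.nat_pow_pow mult.commute)
  also have "[((4::nat) ^ k)] \<cdot> x = (u \<otimes> u) \<otimes> x"
    using Suc by (simp add: u_def)
  also have "[(4::nat)] \<cdot> ((u \<otimes> u) \<otimes> x) = ((u \<otimes> (\<one> \<oplus> \<one>)) \<otimes> (u \<otimes> (\<one> \<oplus> \<one>))) \<otimes> x"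
  proof -
    have "[(4::nat)] \<cdot> y = y \<oplus> y \<oplus> y \<oplus> y" if "y \<in> carrier R" for y
      using that by (simp add: numeral_eq_Suc)
    then show ?thesis
      using u assms by simp algebra
  qed
  finally show ?case by (simp add: u_def)
qed

text \<open>From t + p = C eps_m, adding (4^C - C) eps_m to \<open>p\<close> replaces C by 4^C,
  which is the square of the unit u = 2^C. That the factor is such a square permits division by u,
  which turns the combined rows into an isometry.\<close>

lemma complement_exists:
  assumes t: "t \<in> T_forms R (free_mod R m)"
  shows "\<exists>u\<in>Units R. \<exists>p\<in>T_forms R (free_mod R m).
    \<forall>v\<in>carrier (free_mod R m). t v \<oplus> p v = (u \<otimes> u) \<otimes> ip R m v v"
proof -
  let ?V = "free_mod R m"
  note V = free_mod_module[of m]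
  obtain p C where p: "p \<in> T_forms R ?V" "\<And>v. v \<in> carrier ?V \<Longrightarrow> t v \<oplus> p v = [(C::nat)] \<cdot> ip R m v v"
    using bounded_T_form[OF t] unfolding bounded_form_def by blast
  define D where "D = 4 ^ C - C"
  have "C < 4 ^ C" by (induction C) auto
  then have CD: "4 ^ C = C + D" by (simp add: D_def)
  let ?p = "form_add R ?V p (form_mult R ?V D (eps R m))"
  let ?u = "(\<one> \<oplus> \<one>) [^] C"
  have "t v \<oplus> ?p v = (?u \<otimes> ?u) \<otimes> ip R m v v" if v: "v \<in> carrier ?V" for v
  proof -
    have c: "t v \<in> carrier R" "p v \<in> carrier R" "ip R m v v \<in> carrier R"
      using v T_forms_closed[OF V t] T_forms_closed[OF V p(1)] by auto
    have "t v \<oplus> ?p v = (t v \<oplus> p v) \<oplus> [D] \<cdot> ip R m v v"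
      using v c by (simp add: form_add_def form_mult_def eps_ip a_assoc)
    also have "\<dots> = [((4::nat) ^ C)] \<cdot> ip R m v v"
      using p(2)[OF v] c by (simp add: CD add.nat_pow_mult)
    also have "\<dots> = (?u \<otimes> ?u) \<otimes> ip R m v v"
      using c by (intro two_pow_square_mult) auto
    finally show ?thesis .
  qed
  moreover have "?u \<in> Units R"
    by (induction C) (simp_all add: two_unit)
  moreover have "?p \<in> T_forms R ?V"
    by (intro T_forms_add[OF V] p T_forms_mult[OF V] eps_T)
  ultimately show ?thesis by blast
qed

end

end


section \<open>Stable orthogonal invariance\<close>

context half_cring
begin

lemma ip_uvec:
  assumes v: "v \<in> carrier (free_mod R n)" and j: "j < n"
  shows "ip R n v (uvec R j) = v j"
proof -
  have "ip R n v (uvec R j) = (\<Oplus>i\<in>{..<n}. if j = i then v i else \<zero>)"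
    unfolding ip_def by (rule finsum_cong') (use free_mod_closed[OF v] in \<open>auto simp: uvec_def\<close>)
  also have "\<dots> = v j"
    by (rule finsum_singleton) (use free_mod_closed[OF v] j in auto)
  finally show ?thesis .
qed

lemma add_left_cancel:
  assumes "e \<in> carrier R" "x \<in> carrier R" "y \<in> carrier R" "e \<oplus> x = e \<oplus> y"
  shows "x = y"
proof -
  have "x = (e \<oplus> x) \<ominus> e"
    using assms(1,2) by algebra
  also have "\<dots> = y"
    unfolding assms(4) using assms(1,3) by algebra
  finally show ?thesis .
qed

definition isometry :: "nat \<Rightarrow> nat \<Rightarrow> 'a parr \<Rightarrow> bool" where
  "isometry m n X \<longleftrightarrow> X \<in> lin_maps R (free_mod R m) (free_mod R n) \<and>
     (\<forall>u\<in>carrier (free_mod R m). ip R n (X u) (X u) = ip R m u u)"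

text \<open>Polarisation: comparing the square lengths of X(u + v) and u + v gives twice the claim,
  and 2 can be cancelled.\<close>

lemma isometry_ip:
  assumes X: "isometry m n X" and u: "u \<in> carrier (free_mod R m)" and v: "v \<in> carrier (free_mod R m)"
  shows "ip R n (X u) (X v) = ip R m u v"
proof -
  have Xl: "X \<in> lin_maps R (free_mod R m) (free_mod R n)"
    and Xi: "\<And>u. u \<in> carrier (free_mod R m) \<Longrightarrow> ip R n (X u) (X u) = ip R m u u"
    using X by (auto simp: isometry_def)
  note XD = lin_mapsD[OF Xl]
  have uv: "(\<lambda>i. u i \<oplus> v i) \<in> carrier (free_mod R m)"
    using u v by (rule free_mod_add_closed)
  have Xuv: "X (\<lambda>i. u i \<oplus> v i) = (\<lambda>i. X u i \<oplus> X v i)"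
    using XD(2)[OF u v] by simp
  have sum: "ip R k (\<lambda>i. a i \<oplus> b i) (\<lambda>i. a i \<oplus> b i) = (ip R k a a \<oplus> ip R k b b) \<oplus> (ip R k a b \<oplus> ip R k a b)"
    if a: "a \<in> carrier (free_mod R k)" and b: "b \<in> carrier (free_mod R k)" for a b k
  proof -
    have "ip R k (\<lambda>i. a i \<oplus> b i) (\<lambda>i. a i \<oplus> b i)
       = (ip R k a a \<oplus> ip R k a b) \<oplus> (ip R k b a \<oplus> ip R k b b)"
      by (simp add: ip_add_left[OF a b free_mod_add_closed[OF a b]] ip_add_right[OF a b a]
          ip_add_right[OF a b b])
    moreover have "ip R k b a = ip R k a b"
      by (rule ip_comm[OF b a])
    ultimately show ?thesis
      using ip_closed[OF a a] ip_closed[OF b b] ip_closed[OF a b] by (simp add: a_ac)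
  qed
  have c: "ip R m u u \<in> carrier R" "ip R m v v \<in> carrier R" "ip R m u v \<in> carrier R"
    "ip R n (X u) (X v) \<in> carrier R"
    using u v XD(1) by (auto intro: ip_closed)
  have "(ip R m u u \<oplus> ip R m v v) \<oplus> (ip R n (X u) (X v) \<oplus> ip R n (X u) (X v))
    = (ip R m u u \<oplus> ip R m v v) \<oplus> (ip R m u v \<oplus> ip R m u v)"
    using Xi[OF uv] unfolding Xuv
    by (simp add: sum[OF XD(1)[OF u] XD(1)[OF v]] sum[OF u v] Xi u v)
  then have "ip R n (X u) (X v) \<oplus> ip R n (X u) (X v) = ip R m u v \<oplus> ip R m u v"
    by (rule add_left_cancel[OF a_closed[OF c(1,2)] a_closed[OF c(4,4)] a_closed[OF c(3,3)]])
  then show ?thesis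
    using double_cancel c by blast
qed

text \<open>X' is the transpose of X: its j-th coordinate is the product with X(e_j). As X is an
  isometry, X' X is the identity, so X X' is the orthogonal projection onto the image of X, and X'
  vanishes on the orthogonal complement.\<close>

lemma isometry_adjoint:
  assumes X: "isometry m n X"
  shows "\<exists>X'\<in>lin_maps R (free_mod R n) (free_mod R m).
    (\<forall>x\<in>carrier (free_mod R n). \<forall>y\<in>carrier (free_mod R m). ip R m (X' x) y = ip R n x (X y)) \<and>
    (\<forall>u\<in>carrier (free_mod R m). X' (X u) = u) \<and>
    (\<forall>x\<in>carrier (free_mod R n). (\<forall>u\<in>carrier (free_mod R m). ip R n (X u) x = \<zero>) \<longrightarrow>
      X' x = (\<lambda>i. \<zero>))"
proof -
  let ?V = "free_mod R m" and ?W = "free_mod R n"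
  have Xl: "X \<in> lin_maps R ?V ?W"
    using X by (simp add: isometry_def)
  note XD = lin_mapsD[OF Xl]
  let ?l = "\<lambda>j. \<lambda>x\<in>carrier ?W. ip R n (X (uvec R j)) x"
  let ?X' = "\<lambda>x\<in>carrier ?W. \<lambda>j. if j < m then ?l j x else \<zero>"
  have X': "?X' \<in> lin_maps R ?W ?V"
    using XD(1) by (intro lin_map_of_dual[OF free_mod_module] ip_dual) simp
  have adj: "ip R m (?X' x) y = ip R n x (X y)" if x: "x \<in> carrier ?W" and y: "y \<in> carrier ?V" for x y
  proof -
    let ?f = "\<lambda>y\<in>carrier ?V. (\<lambda>z\<in>carrier ?W. ip R n x z) (X y)"
    have "?f \<in> dual R ?V"
      by (rule dual_compose[OF free_mod_module Xl ip_dual[OF x]])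
    then have "?f y = (\<Oplus>j\<in>{..<m}. y j \<otimes> ?f (uvec R j))"
      using y by (rule dual_expansion)
    also have "\<dots> = ip R m (?X' x) y"
      unfolding ip_def[of _ m]
    proof (rule finsum_cong')
      fix j assume "j \<in> {..<m}"
      then show "y j \<otimes> ?f (uvec R j) = ?X' x j \<otimes> y j"
        using x XD(1)[of "uvec R j"] ip_comm[OF x XD(1), of "uvec R j"] free_mod_closed[OF y]
        by (simp add: m_comm ip_closed)
    qed (use x y XD(1) free_mod_closed[OF y] in \<open>auto intro!: ip_closed[OF XD(1) x] m_closed\<close>)
    finally show ?thesis
      using x y XD(1) by simp
  qed
  have inv: "?X' (X u) = u" if u: "u \<in> carrier ?V" for u
  proof
    fix j show "?X' (X u) j = u j"
    proof (cases "j < m")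
      case True
      then have "?X' (X u) j = ip R n (X (uvec R j)) (X u)"
        using u XD(1) by simp
      also have "\<dots> = ip R m u (uvec R j)"
        using isometry_ip[OF X _ u, of "uvec R j"] ip_comm[OF u uvec_closed, of j m] True by simp
      finally show ?thesis
        using ip_uvec[OF u True] by simp
    qed (use u XD(1) in \<open>simp add: free_mod_tail\<close>)
  qed
  have orth: "?X' x = (\<lambda>i. \<zero>)"
    if "x \<in> carrier ?W" "\<And>u. u \<in> carrier ?V \<Longrightarrow> ip R n (X u) x = \<zero>" for x
    using that by (simp add: fun_eq_iff)
  show ?thesis
    by (intro bexI[OF _ X'] conjI ballI impI adj inv orth) auto
qed

text \<open>The orthogonal involution exchanging \<open>X(A\<^sup>m) \<oplus> 0\<close> and \<open>0 \<oplus> A\<^sup>m\<close> in \<open>A\<^sup>n \<oplus> A\<^sup>m\<close>.\<close>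

lemma exchange_orth:
  assumes X: "isometry m n X"
  obtains h where "h \<in> orth R (n + m)"
    "\<And>u z. u \<in> carrier (free_mod R m) \<Longrightarrow> z \<in> carrier (free_mod R n) \<Longrightarrow>
      (\<And>y. y \<in> carrier (free_mod R m) \<Longrightarrow> ip R n (X y) z = \<zero>) \<Longrightarrow>
      h (\<lambda>i. X u i \<oplus> z i) = vcat n z u"
proof -
  let ?V = "free_mod R m" and ?W = "free_mod R n" and ?U = "free_mod R (n + m)"
  note V = free_mod_module[of m] and W = free_mod_module[of n] and U = free_mod_module[of "n + m"]
  have Xl: "X \<in> lin_maps R ?V ?W"
    using X by (simp add: isometry_def)
  note XD = lin_mapsD[OF Xl]
  obtain X' where X'l: "X' \<in> lin_maps R ?W ?V"
    and adj: "\<And>x y. x \<in> carrier ?W \<Longrightarrow> y \<in> carrier ?V \<Longrightarrow> ip R m (X' x) y = ip R n x (X y)"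
    and inv: "\<And>u. u \<in> carrier ?V \<Longrightarrow> X' (X u) = u"
    and orth: "\<And>x. x \<in> carrier ?W \<Longrightarrow> (\<And>u. u \<in> carrier ?V \<Longrightarrow> ip R n (X u) x = \<zero>) \<Longrightarrow>
      X' x = (\<lambda>i. \<zero>)"
    using isometry_adjoint[OF X] by blast
  note X'D = lin_mapsD[OF X'l]
  define H where "H w = (\<lambda>i. if i < n then w i else \<zero>)" for w :: "nat \<Rightarrow> 'a"
  define K where "K w = (\<lambda>i. w (n + i))" for w :: "nat \<Rightarrow> 'a"
  have Hc: "H w \<in> carrier ?W" and Kc: "K w \<in> carrier ?V" if "w \<in> carrier ?U" for w
    using that by (auto simp: H_def K_def free_mod_iff)
  \<comment> \<open>The component X X' a of \<open>a\<close> is replaced by X b, and its coordinates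
    X' a move to the last m entries: the first part is a - X X' a + X b.\<close>
  define e where "e a b = vcat n (\<lambda>i. a i \<ominus> X (\<lambda>i. X' a i \<ominus> b i) i) (X' a)" for a b
  define h where "h = (\<lambda>w\<in>carrier ?U. e (H w) (K w))"
  have dc: "(\<lambda>i. X' a i \<ominus> b i) \<in> carrier ?V" if "a \<in> carrier ?W" "b \<in> carrier ?V" for a b
    using that X'D(1) free_mod_minus_closed by blast
  have ac: "(\<lambda>i. a i \<ominus> X (\<lambda>i. X' a i \<ominus> b i) i) \<in> carrier ?W"
    if "a \<in> carrier ?W" "b \<in> carrier ?V" for a b
    using that XD(1) dc free_mod_minus_closed by blast
  have ec: "e a b \<in> carrier ?U" if "a \<in> carrier ?W" "b \<in> carrier ?V" for a b
    unfolding e_def using that ac X'D(1) vcat_closed by blast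
  have Hcat: "H (vcat n a b) = a" and Kcat: "K (vcat n a b) = b" if "a \<in> carrier ?W" for a b
    using that by (auto simp: H_def K_def vcat_def fun_eq_iff free_mod_tail)
  have catHK: "vcat n (H w) (K w) = w" if "w \<in> carrier ?U" for w
    by (auto simp: H_def K_def vcat_def fun_eq_iff)
  \<comment> \<open>The first part a' of e(a, b) satisfies X' a' = b, so a second application
    exchanges the two components back. Hence \<open>h\<close> is its own inverse.\<close>
  have ee: "h (e a b) = vcat n a b" if a: "a \<in> carrier ?W" and b: "b \<in> carrier ?V" for a b
  proof -
    define d where "d = (\<lambda>i. X' a i \<ominus> b i)"
    define a' where "a' = (\<lambda>i. a i \<ominus> X d i)"
    have d: "d \<in> carrier ?V" and a': "a' \<in> carrier ?W"
      using dc[OF a b] ac[OF a b] by (simp_all add: d_def a'_def)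
    have X'a': "X' a' = b"
    proof -
      have "a = a' \<oplus>\<^bsub>?W\<^esub> X d"
        using free_mod_closed[OF a] free_mod_closed[OF XD(1)[OF d]]
        by (simp add: a'_def minus_eq fun_eq_iff a_assoc l_neg)
      then have "X' a = X' a' \<oplus>\<^bsub>?V\<^esub> X' (X d)"
        using X'D(2)[OF a' XD(1)[OF d]] by simp
      then have *: "X' a i = X' a' i \<oplus> d i" for i
        by (simp add: inv[OF d])
      show ?thesis
      proof
        fix i
        have c: "X' a i \<in> carrier R" "X' a' i \<in> carrier R" "b i \<in> carrier R"
          using free_mod_closed X'D(1) a a' b by blast+
        have "X' a' i = X' a i \<ominus> d i"
          using * c free_mod_closed[OF d, of i] by (simp add: minus_eq a_assoc r_neg)
        also have "\<dots> = b i"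
          unfolding d_def using c by algebra
        finally show "X' a' i = b i" .
      qed
    qed
    have "e a b = vcat n a' (X' a)"
      by (simp add: e_def a'_def d_def)
    then have "h (e a b) = e a' (X' a)"
      using ec[OF a b] Hcat[OF a'] Kcat[OF a'] by (simp add: h_def)
    also have "\<dots> = vcat n (\<lambda>i. a' i \<ominus> X (\<lambda>i. b i \<ominus> X' a i) i) b"
      by (simp add: e_def X'a')
    also have "(\<lambda>i. a' i \<ominus> X (\<lambda>i. b i \<ominus> X' a i) i) = a"
    proof -
      have "(\<lambda>i. b i \<ominus> X' a i) = (\<ominus> \<one>) \<odot>\<^bsub>?V\<^esub> d"
      proof -
        have "b i \<ominus> X' a i = (\<ominus> \<one>) \<otimes> (X' a i \<ominus> b i)" for i
          using free_mod_closed[OF b, of i] free_mod_closed[OF X'D(1)[OF a], of i] by algebra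
        then show ?thesis by (simp add: d_def)
      qed
      then have "X (\<lambda>i. b i \<ominus> X' a i) = (\<lambda>i. (\<ominus> \<one>) \<otimes> X d i)"
        using XD(3)[of "\<ominus> \<one>" d] d by simp
      moreover have "a i \<ominus> X d i \<ominus> (\<ominus> \<one>) \<otimes> X d i = a i" for i
        using free_mod_closed[OF a, of i] free_mod_closed[OF XD(1)[OF d], of i] by algebra
      ultimately show ?thesis
        by (simp add: a'_def)
    qed
    finally show ?thesis .
  qed
  have hh: "h (h w) = w" if "w \<in> carrier ?U" for w
    using ee[OF Hc[OF that] Kc[OF that]] catHK[OF that] that by (simp add: h_def)
  have hc: "h w \<in> carrier ?U" if "w \<in> carrier ?U" for w
    using ec[OF Hc[OF that] Kc[OF that]] that by (simp add: h_def)
  have bij: "bij_betw h (carrier ?U) (carrier ?U)"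
    by (rule bij_betw_byWitness[where f' = h]) (use hh hc in auto)
  have Hl: "(\<lambda>w\<in>carrier ?U. H w) \<in> lin_maps R ?U ?W"
    by (rule lin_mapsI[OF U]) (use Hc in \<open>auto simp: H_def fun_eq_iff\<close>)
  have Kl: "(\<lambda>w\<in>carrier ?U. K w) \<in> lin_maps R ?U ?V"
    by (rule lin_mapsI[OF U]) (use Kc in \<open>auto simp: K_def fun_eq_iff\<close>)
  have minus_lin: "(\<lambda>w\<in>carrier ?U. \<lambda>i. f w i \<ominus> g w i) \<in> lin_maps R ?U (free_mod R k)"
    if f: "f \<in> lin_maps R ?U (free_mod R k)" and g: "g \<in> lin_maps R ?U (free_mod R k)" for f g k
  proof -
    have "(\<lambda>w\<in>carrier ?U. \<lambda>i. f w i \<oplus> (\<lambda>w\<in>carrier ?U. \<lambda>i. (\<ominus> \<one>) \<otimes> g w i) w i) \<in> lin_maps R ?U (free_mod R k)"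
      by (intro lin_add[OF U f] lin_smult[OF U g]) simp
    moreover have "f w i \<oplus> (\<ominus> \<one>) \<otimes> g w i = f w i \<ominus> g w i" if "w \<in> carrier ?U" for w i
      using free_mod_closed[OF lin_mapsD(1)[OF g that], of i] by (simp add: minus_eq l_minus)
    then have "(\<lambda>w\<in>carrier ?U. \<lambda>i. f w i \<oplus> (\<lambda>w\<in>carrier ?U. \<lambda>i. (\<ominus> \<one>) \<otimes> g w i) w i)
      = (\<lambda>w\<in>carrier ?U. \<lambda>i. f w i \<ominus> g w i)"
      by (intro restrict_ext) simp
    ultimately show ?thesis by simp
  qed
  have X'H: "(\<lambda>w\<in>carrier ?U. X' ((\<lambda>w\<in>carrier ?U. H w) w)) \<in> lin_maps R ?U ?V"
    by (rule lin_maps_restrict_comp[OF Hl X'l U])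
  note D = minus_lin[OF X'H Kl]
  note XD' = lin_maps_restrict_comp[OF D Xl U]
  \<comment> \<open>Linearity of \<open>h\<close> is obtained by assembling it from maps known to be
    linear; the inner restrictions disappear on the carrier.\<close>
  have "(\<lambda>w\<in>carrier ?U. vcat n
      ((\<lambda>w\<in>carrier ?U. \<lambda>i. (\<lambda>w\<in>carrier ?U. H w) w i \<ominus>
         (\<lambda>w\<in>carrier ?U. X ((\<lambda>w\<in>carrier ?U. \<lambda>i. (\<lambda>w\<in>carrier ?U. X' ((\<lambda>w\<in>carrier ?U. H w) w)) w i
             \<ominus> (\<lambda>w\<in>carrier ?U. K w) w i) w)) w i) w)
      ((\<lambda>w\<in>carrier ?U. X' ((\<lambda>w\<in>carrier ?U. H w) w)) w)) \<in> lin_maps R ?U ?U"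
    by (rule lin_vcat[OF U minus_lin[OF Hl XD'] X'H])
  also have "(\<lambda>w\<in>carrier ?U. vcat n
      ((\<lambda>w\<in>carrier ?U. \<lambda>i. (\<lambda>w\<in>carrier ?U. H w) w i \<ominus>
         (\<lambda>w\<in>carrier ?U. X ((\<lambda>w\<in>carrier ?U. \<lambda>i. (\<lambda>w\<in>carrier ?U. X' ((\<lambda>w\<in>carrier ?U. H w) w)) w i
             \<ominus> (\<lambda>w\<in>carrier ?U. K w) w i) w)) w i) w)
      ((\<lambda>w\<in>carrier ?U. X' ((\<lambda>w\<in>carrier ?U. H w) w)) w)) = h"
    unfolding h_def e_def by (rule restrict_ext) simp
  finally have hl: "h \<in> lin_maps R ?U ?U" .
  \<comment> \<open>With d = X' a - b, adjointness and isometry give |a - X d|^2 = |a|^2 - |X' a|^2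
    + |b|^2; the last m entries restore |X' a|^2.\<close>
  have iso: "ip R (n + m) (h w) (h w) = ip R (n + m) w w" if w: "w \<in> carrier ?U" for w
  proof -
    define a b where "a = H w" and "b = K w"
    have a: "a \<in> carrier ?W" and b: "b \<in> carrier ?V"
      using Hc[OF w] Kc[OF w] by (simp_all add: a_def b_def)
    define u where "u = X' a"
    have u: "u \<in> carrier ?V"
      using X'D(1)[OF a] by (simp add: u_def)
    define d where "d = (\<lambda>i. u i \<ominus> b i)"
    have d: "d \<in> carrier ?V"
      using dc[OF a b] by (simp add: d_def u_def)
    have hw: "h w = vcat n (\<lambda>i. a i \<ominus> X d i) u"
      using w by (simp add: h_def e_def a_def b_def u_def d_def)
    have a': "(\<lambda>i. a i \<ominus> X d i) \<in> carrier ?W"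
      by (rule free_mod_minus_closed[OF a XD(1)[OF d]])
    define \<alpha> p q r where "\<alpha> = ip R n a a" and "p = ip R m u u" and "q = ip R m u b" and "r = ip R m b b"
    have c: "\<alpha> \<in> carrier R" "p \<in> carrier R" "q \<in> carrier R" "r \<in> carrier R"
      using a u b by (auto simp: \<alpha>_def p_def q_def r_def intro: ip_closed)
    have aXd: "ip R n a (X d) = p \<ominus> q"
    proof -
      have "ip R n a (X d) = ip R m u d"
        using adj[OF a d] by (simp add: u_def)
      also have "\<dots> = p \<ominus> q"
        unfolding d_def p_def q_def by (rule ip_minus_right[OF u b u])
      finally show ?thesis .
    qed
    have dd: "ip R n (X d) (X d) = (p \<ominus> q) \<ominus> (q \<ominus> r)"
    proof -
      have "ip R n (X d) (X d) = ip R m d d"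
        using X d by (simp add: isometry_def)
      also have "\<dots> = ip R m u d \<ominus> ip R m b d"
        unfolding d_def[symmetric] by (subst (1) d_def) (rule ip_minus_left[OF u b d])
      also have "ip R m u d = p \<ominus> q"
        unfolding d_def p_def q_def by (rule ip_minus_right[OF u b u])
      also have "ip R m b d = q \<ominus> r"
        unfolding d_def q_def r_def ip_comm[OF u b] by (rule ip_minus_right[OF u b b])
      finally show ?thesis .
    qed
    have "ip R (n + m) (h w) (h w) = ip R n (\<lambda>i. a i \<ominus> X d i) (\<lambda>i. a i \<ominus> X d i) \<oplus> p"
      unfolding hw p_def by (rule ip_vcat[OF a' u a' u])
    also have "ip R n (\<lambda>i. a i \<ominus> X d i) (\<lambda>i. a i \<ominus> X d i)
      = (ip R n a a \<ominus> ip R n a (X d)) \<ominus> (ip R n (X d) a \<ominus> ip R n (X d) (X d))"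
      by (simp add: ip_minus_left[OF a XD(1)[OF d] a'] ip_minus_right[OF a XD(1)[OF d] a]
          ip_minus_right[OF a XD(1)[OF d] XD(1)[OF d]])
    also have "\<dots> = (\<alpha> \<ominus> (p \<ominus> q)) \<ominus> ((p \<ominus> q) \<ominus> ((p \<ominus> q) \<ominus> (q \<ominus> r)))"
      by (simp only: ip_comm[OF XD(1)[OF d] a] aXd dd \<alpha>_def)
    also have "\<dots> \<oplus> p = \<alpha> \<oplus> r"
      using c by algebra
    also have "\<dots> = ip R (n + m) (vcat n a b) (vcat n a b)"
      unfolding \<alpha>_def r_def by (rule ip_vcat[OF a b a b, symmetric])
    also have "vcat n a b = w"
      using catHK[OF w] by (simp add: a_def b_def)
    finally show ?thesis .
  qed
  have "pullback_form ?U h (eps R (n + m)) = eps R (n + m)"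
  proof
    fix w show "pullback_form ?U h (eps R (n + m)) w = eps R (n + m) w"
    proof (cases "w \<in> carrier ?U")
      case True
      then show ?thesis
        using iso hc by (simp add: pullback_form_def eps_ip)
    qed (simp add: pullback_form_def eps_def)
  qed
  then have "h \<in> orth R (n + m)"
    using hl bij by (simp add: orth_def)
  \<comment> \<open>For w = X u + z with z orthogonal to the image of X, the additional coordinates
    of w are zero and X' w = u, so h(w) consists of w - X u = z followed by u.\<close>
  moreover have "h (\<lambda>i. X u i \<oplus> z i) = vcat n z u"
    if u: "u \<in> carrier ?V" and z: "z \<in> carrier ?W"
      and uz: "\<And>y. y \<in> carrier ?V \<Longrightarrow> ip R n (X y) z = \<zero>" for u z
  proof -
    define w where "w = (\<lambda>i. X u i \<oplus> z i)"
    have wW: "w \<in> carrier ?W"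
      unfolding w_def by (rule free_mod_add_closed[OF XD(1)[OF u] z])
    have w: "w \<in> carrier ?U"
      by (rule free_mod_mono[OF _ wW]) simp
    have "w = vcat n w (\<lambda>i. \<zero>)"
      using vcat_zero[OF wW] by simp
    then have HK: "H w = w" "K w = (\<lambda>i. \<zero>)"
      using Hcat[OF wW] Kcat[OF wW] by metis+
    have "X' w = X' (X u) \<oplus>\<^bsub>?V\<^esub> X' z"
      using X'D(2)[OF XD(1)[OF u] z] by (simp add: w_def)
    then have X'w: "X' w = u"
      using inv[OF u] orth[OF z uz] free_mod_closed[OF u] by simp
    have "h w = vcat n (\<lambda>i. w i \<ominus> X (\<lambda>i. u i \<ominus> \<zero>) i) u"
      using w by (simp add: h_def e_def HK X'w)
    also have "(\<lambda>i. u i \<ominus> \<zero>) = u"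
      using free_mod_closed[OF u] by (simp add: minus_eq)
    also have "(\<lambda>i. w i \<ominus> X u i) = z"
    proof
      fix i show "w i \<ominus> X u i = z i"
        unfolding w_def using free_mod_closed[OF XD(1)[OF u], of i] free_mod_closed[OF z, of i] by algebra
    qed
    finally show ?thesis by (simp add: w_def)
  qed
  ultimately show thesis by (rule that)
qed

end

section \<open>Functors on projective modules and their orthogonally invariant cocones\<close>

locale functor_over_half_cring = half_cring R for R :: "'a ring" (structure) +
  fixes F :: "('a pobj, 'a parr, 'g) ab_functor"
  assumes F: "is_functor (proj_cat R) F"
begin

lemma F_group: "V \<in> Ob (proj_cat R) \<Longrightarrow> comm_group (fob F V)"
  by (rule functor_group[OF F])

lemma F_hom: "V \<in> Ob (proj_cat R) \<Longrightarrow> W \<in> Ob (proj_cat R) \<Longrightarrow> f \<in> lin_maps R V W \<Longrightarrow>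
    far F V W f \<in> hom (fob F V) (fob F W)"
  using functor_hom[OF F] by simp

lemma F_closed: "V \<in> Ob (proj_cat R) \<Longrightarrow> W \<in> Ob (proj_cat R) \<Longrightarrow> f \<in> lin_maps R V W \<Longrightarrow>
    x \<in> carrier (fob F V) \<Longrightarrow> far F V W f x \<in> carrier (fob F W)"
  using functor_closed[OF F] by simp

text \<open>The composite may be any linear map \<open>h\<close> with the right values on the
  carrier, so \<open>compose\<close> never appears in later terms.\<close>

lemma F_comp:
  assumes "U \<in> Ob (proj_cat R)" "V \<in> Ob (proj_cat R)" "W \<in> Ob (proj_cat R)"
    "f \<in> lin_maps R U V" "g \<in> lin_maps R V W" "x \<in> carrier (fob F U)"
    and h: "h \<in> lin_maps R U W" "\<And>u. u \<in> carrier U \<Longrightarrow> h u = g (f u)"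
  shows "far F V W g (far F U V f x) = far F U W h x"
proof -
  have "far F U W (Cmp (proj_cat R) U V W g f) x = far F V W g (far F U V f x)"
    using F assms unfolding is_functor_def Arr_proj_cat by blast
  moreover have "Cmp (proj_cat R) U V W g f = h"
    unfolding proj_cat_def
    using lin_maps_ext[OF lin_maps_compose[OF assms(4,5) Ob_proj_cat_module[OF assms(1)]] h(1)] h(2)
    by (simp add: compose_def)
  ultimately show ?thesis by simp
qed

lemma F_id:
  assumes "V \<in> Ob (proj_cat R)" "x \<in> carrier (fob F V)" "h \<in> lin_maps R V V"
    "\<And>v. v \<in> carrier V \<Longrightarrow> h v = v"
  shows "far F V V h x = x"
proof -
  have "far F V V (Idn (proj_cat R) V) x = x"
    using F assms unfolding is_functor_def by blast
  moreover have "Idn (proj_cat R) V = h"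
    unfolding proj_cat_def
    using lin_maps_ext[OF lin_mapsI[OF Ob_proj_cat_module[OF assms(1)], of "\<lambda>v. v" V] assms(3)]
    by (simp add: assms(4))
  ultimately show ?thesis by simp
qed

end

text \<open>An abstract cocone: \<open>c n\<close> stands for the canonical map from F(A^n) to the
  stable coinvariants, with invariance under orthogonal maps and compatibility with inclusions as
  its only properties. The concrete instance is \<open>stable_class_invariant\<close>.\<close>

locale stable_invariant = functor_over_half_cring R F
  for R :: "'a ring" (structure) and F :: "('a pobj, 'a parr, 'g) ab_functor" +
  fixes G :: "'h monoid" and c :: "nat \<Rightarrow> 'g \<Rightarrow> 'h"
  assumes G: "comm_group G"
    and c_hom: "\<And>n. c n \<in> hom (fob F (free_mod R n)) G"
    and c_orth: "\<And>n g x. g \<in> orth R n \<Longrightarrow> x \<in> carrier (fob F (free_mod R n)) \<Longrightarrow>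
      c n (far F (free_mod R n) (free_mod R n) g x) = c n x"
    and c_incl: "\<And>m n x. m \<le> n \<Longrightarrow> x \<in> carrier (fob F (free_mod R m)) \<Longrightarrow>
      c n (far F (free_mod R m) (free_mod R n) (std_incl R m) x) = c m x"
begin

text \<open>The same function \<open>f\<close> is read with two targets; they differ by the standard
  inclusion, which \<open>c\<close> ignores. Dimensions can thus be enlarged at will.\<close>

lemma c_mono:
  assumes "m \<le> n" and V: "V \<in> Ob (proj_cat R)" and f: "f \<in> lin_maps R V (free_mod R m)"
    and x: "x \<in> carrier (fob F V)"
  shows "c n (far F V (free_mod R n) f x) = c m (far F V (free_mod R m) f x)"
proof -
  have "far F (free_mod R m) (free_mod R n) (std_incl R m) (far F V (free_mod R m) f x)
    = far F V (free_mod R n) f x"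
    by (rule F_comp[OF V free_mod_Ob free_mod_Ob f std_incl_lin[OF assms(1)] x lin_map_std[OF f assms(1)]])
      (simp add: std_incl_def lin_mapsD(1)[OF f])
  then show ?thesis
    using c_incl[OF assms(1) F_closed[OF V free_mod_Ob f x]] by simp
qed

text \<open>Here \<open>t\<close> gives coordinates in the image of X, and \<open>z\<close> the part
  orthogonal to it. The right-hand side does not contain X, so two isometries with the same
  \<open>t\<close> and \<open>z\<close> lead to equal classes. A nonzero \<open>z\<close> leaves
  room for further rows.\<close>

lemma exchange:
  assumes V: "V \<in> Ob (proj_cat R)" and X: "isometry m n X"
    and t: "t \<in> lin_maps R V (free_mod R m)" and z: "z \<in> lin_maps R V (free_mod R n)"
    and orth: "\<And>u v. u \<in> carrier (free_mod R m) \<Longrightarrow> v \<in> carrier V \<Longrightarrow> ip R n (X u) (z v) = \<zero>"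
    and f: "f \<in> lin_maps R V (free_mod R n)" "\<And>v. v \<in> carrier V \<Longrightarrow> f v = (\<lambda>i. X (t v) i \<oplus> z v i)"
    and x: "x \<in> carrier (fob F V)"
  shows "c n (far F V (free_mod R n) f x)
    = c (n + m) (far F V (free_mod R (n + m)) (\<lambda>v\<in>carrier V. vcat n (z v) (t v)) x)"
proof -
  let ?U = "free_mod R (n + m)"
  obtain h where h: "h \<in> orth R (n + m)"
    and hv: "\<And>u z. u \<in> carrier (free_mod R m) \<Longrightarrow> z \<in> carrier (free_mod R n) \<Longrightarrow>
      (\<And>y. y \<in> carrier (free_mod R m) \<Longrightarrow> ip R n (X y) z = \<zero>) \<Longrightarrow>
      h (\<lambda>i. X u i \<oplus> z i) = vcat n z u"
    using exchange_orth[OF X] by blast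
  have hl: "h \<in> lin_maps R ?U ?U"
    using h by (simp add: orth_def)
  have f': "f \<in> lin_maps R V ?U"
    by (rule lin_map_std[OF f(1)]) simp
  have "far F ?U ?U h (far F V ?U f x) = far F V ?U (\<lambda>v\<in>carrier V. vcat n (z v) (t v)) x"
    by (rule F_comp[OF V free_mod_Ob free_mod_Ob f' hl x lin_vcat[OF Ob_proj_cat_module[OF V] z t]])
      (simp add: f(2) hv[OF lin_mapsD(1)[OF t] lin_mapsD(1)[OF z] orth])
  then have "c (n + m) (far F V ?U (\<lambda>v\<in>carrier V. vcat n (z v) (t v)) x) = c (n + m) (far F V ?U f x)"
    using c_orth[OF h F_closed[OF V free_mod_Ob f' x]] by simp
  also have "\<dots> = c n (far F V (free_mod R n) f x)"
    by (rule c_mono[OF _ V f(1) x]) simp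
  finally show ?thesis by simp
qed

end


section \<open>Alternating products over subsets\<close>

text \<open>The alternating sum over subsets from the definition of polynomial functors, in
  multiplicative notation; signs are exponents 1 and -1, exactly as in
  \<open>polynomial_of_degree_le\<close>.\<close>

definition sprod :: "('g, 'm) monoid_scheme \<Rightarrow> nat set \<Rightarrow> (nat set \<Rightarrow> 'g) \<Rightarrow> 'g" where
  "sprod G S f = finprod G (\<lambda>I. f I [^]\<^bsub>G\<^esub> ((-1) ^ card I :: int)) (Pow S)"

context comm_group
begin

lemma sprod_closed: "(\<And>I. I \<subseteq> S \<Longrightarrow> f I \<in> carrier G) \<Longrightarrow> sprod G S f \<in> carrier G"
  unfolding sprod_def by (rule finprod_closed) auto

lemma sprod_cong:
  assumes "\<And>I. I \<subseteq> S \<Longrightarrow> f I = g I" "\<And>I. I \<subseteq> S \<Longrightarrow> g I \<in> carrier G"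
  shows "sprod G S f = sprod G S g"
  unfolding sprod_def by (rule finprod_cong') (use assms in auto)

lemma finprod_hom:
  assumes H: "comm_group H" and h: "h \<in> hom G H" and f: "f \<in> A \<rightarrow> carrier G"
  shows "h (finprod G f A) = finprod H (\<lambda>a. h (f a)) A"
proof -
  interpret H: comm_group H by fact
  interpret h: group_hom G H h
    using h by unfold_locales
  show ?thesis
    using f
  proof (induction A rule: infinite_finite_induct)
    case (insert a A)
    then have "f \<in> A \<rightarrow> carrier G" "f a \<in> carrier G" "(\<lambda>a. h (f a)) \<in> A \<rightarrow> carrier H"
      using h.hom_closed by (auto simp: Pi_iff)
    with insert show ?case
      by simp
  qed simp_all
qed

lemma sprod_hom:
  assumes H: "comm_group H" and h: "h \<in> hom G H" and f: "\<And>I. I \<subseteq> S \<Longrightarrow> f I \<in> carrier G"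
  shows "h (sprod G S f) = sprod H S (\<lambda>I. h (f I))"
proof -
  interpret H: comm_group H by fact
  interpret h: group_hom G H h
    using h by unfold_locales
  have "h (sprod G S f) = finprod H (\<lambda>I. h (f I [^] ((-1) ^ card I :: int))) (Pow S)"
    unfolding sprod_def by (rule finprod_hom[OF H h]) (use f in auto)
  also have "\<dots> = sprod H S (\<lambda>I. h (f I))"
    unfolding sprod_def by (rule H.finprod_cong') (use f h.hom_int_pow in auto)
  finally show ?thesis .
qed

lemma inv_hom_self: "(\<lambda>x. inv x) \<in> hom G G"
  by (rule homI) (simp_all add: inv_mult)

lemma sprod_inv:
  assumes "\<And>I. I \<subseteq> S \<Longrightarrow> f I \<in> carrier G"
  shows "sprod G S (\<lambda>I. inv (f I)) = inv (sprod G S f)"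
  using sprod_hom[OF comm_group_axioms inv_hom_self assms] by simp

lemma sprod_mult:
  assumes f: "\<And>I. I \<subseteq> S \<Longrightarrow> f I \<in> carrier G" and g: "\<And>I. I \<subseteq> S \<Longrightarrow> g I \<in> carrier G"
  shows "sprod G S (\<lambda>I. f I \<otimes> g I) = sprod G S f \<otimes> sprod G S g"
proof -
  have "sprod G S (\<lambda>I. f I \<otimes> g I) = finprod G (\<lambda>I. f I [^] ((-1) ^ card I :: int) \<otimes> g I [^] ((-1) ^ card I :: int)) (Pow S)"
    unfolding sprod_def by (rule finprod_cong') (use f g in \<open>auto simp: int_pow_distrib\<close>)
  also have "\<dots> = sprod G S f \<otimes> sprod G S g"
    unfolding sprod_def by (rule finprod_multf) (use f g in auto)
  finally show ?thesis .
qed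

text \<open>Subsets are sorted by membership of \<open>a\<close>; inserting \<open>a\<close> flips
  the sign, whence the inverse. A new direction therefore measures how the product changes when the
  base point is moved along it.\<close>

lemma sprod_insert:
  assumes S: "finite S" "a \<notin> S" and f: "\<And>I. I \<subseteq> insert a S \<Longrightarrow> f I \<in> carrier G"
  shows "sprod G (insert a S) f = sprod G S f \<otimes> inv (sprod G S (\<lambda>I. f (insert a I)))"
proof -
  let ?g = "\<lambda>I. f I [^] ((-1) ^ card I :: int)"
  have g: "?g I \<in> carrier G" if "I \<subseteq> insert a S" for I
    using f[OF that] by simp
  have "finprod G ?g (Pow (insert a S)) = finprod G ?g (Pow S) \<otimes> finprod G ?g (insert a ` Pow S)"
    unfolding Pow_insert by (rule finprod_Un_disjoint) (use S g in \<open>auto simp: subset_insertI2\<close>)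
  moreover have "finprod G ?g (insert a ` Pow S) = finprod G (\<lambda>I. ?g (insert a I)) (Pow S)"
  proof (rule finprod_reindex)
    show "inj_on (insert a) (Pow S)"
      using S(2) by (intro inj_onI) (metis PowD insert_ident subsetD)
  qed (auto intro!: g)
  moreover have "finprod G (\<lambda>I. ?g (insert a I)) (Pow S) = sprod G S (\<lambda>I. inv (f (insert a I)))"
    unfolding sprod_def
  proof (rule finprod_cong')
    fix I assume "I \<in> Pow S"
    then have "card (insert a I) = Suc (card I)" "f (insert a I) \<in> carrier G"
      using S f by (auto simp: finite_subset subset_iff intro!: card_insert_disjoint f)
    then show "?g (insert a I) = inv (f (insert a I)) [^] ((-1) ^ card I :: int)"
      by (simp add: int_pow_neg int_pow_inv)
  qed (auto intro!: int_pow_closed inv_closed f)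
  moreover have "sprod G S (\<lambda>I. inv (f (insert a I))) = inv (sprod G S (\<lambda>I. f (insert a I)))"
    by (rule sprod_inv) (auto intro!: f)
  ultimately show ?thesis
    by (simp add: sprod_def)
qed

text \<open>Isolates the term at the base point. When the whole product is trivial, this term is
  determined by the others, in \<open>cancellation_free\<close> as well as in
  \<open>form_ext_eq\<close>.\<close>

lemma sprod_remove_empty:
  assumes S: "finite S" and f: "\<And>I. I \<subseteq> S \<Longrightarrow> f I \<in> carrier G"
  shows "sprod G S f = f {} \<otimes> finprod G (\<lambda>I. f I [^] ((-1) ^ card I :: int)) (Pow S - {{}})"
proof -
  have "Pow S = insert {} (Pow S - {{}})"
    by auto
  then have "sprod G S f = finprod G (\<lambda>I. f I [^] ((-1) ^ card I :: int)) (insert {} (Pow S - {{}}))"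
    unfolding sprod_def by metis
  also have "\<dots> = f {} [^] ((-1) ^ card ({}::nat set) :: int)
      \<otimes> finprod G (\<lambda>I. f I [^] ((-1) ^ card I :: int)) (Pow S - {{}})"
    by (rule finprod_insert) (use S f in auto)
  also have "f {} [^] ((-1) ^ card ({}::nat set) :: int) = f {}"
    using f by simp
  finally show ?thesis .
qed

lemma finprod_swap:
  assumes "finite A" "finite B" "\<And>a b. a \<in> A \<Longrightarrow> b \<in> B \<Longrightarrow> f a b \<in> carrier G"
  shows "finprod G (\<lambda>a. finprod G (f a) B) A = finprod G (\<lambda>b. finprod G (\<lambda>a. f a b) A) B"
  using assms(1,3)
proof (induction A rule: finite_induct)
  case (insert a A)
  have "finprod G (\<lambda>a. finprod G (f a) B) (insert a A)
    = finprod G (f a) B \<otimes> finprod G (\<lambda>a. finprod G (f a) B) A"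
    by (rule finprod_insert) (use insert in \<open>auto intro!: finprod_closed\<close>)
  also have "\<dots> = finprod G (f a) B \<otimes> finprod G (\<lambda>b. finprod G (\<lambda>a. f a b) A) B"
    using insert by simp
  also have "\<dots> = finprod G (\<lambda>b. f a b \<otimes> finprod G (\<lambda>a. f a b) A) B"
    by (rule finprod_multf[symmetric]) (use insert in \<open>auto intro!: finprod_closed\<close>)
  also have "\<dots> = finprod G (\<lambda>b. finprod G (\<lambda>a. f a b) (insert a A)) B"
  proof (rule finprod_cong')
    fix b assume b: "b \<in> B"
    show "f a b \<otimes> finprod G (\<lambda>a. f a b) A = finprod G (\<lambda>a. f a b) (insert a A)"
      by (rule finprod_insert[symmetric]) (use insert b in auto)
  qed (use insert in \<open>auto intro!: finprod_closed\<close>)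
  finally show ?case .
qed (simp add: finprod_one_eqI)

end


section \<open>Elements of finite degree\<close>

text \<open>Keeps the dimension \<open>m * Suc r\<close> of a sum of r + 1 blocks from being
  rewritten as a sum.\<close>

declare mult_Suc_right [simp del]

text \<open>\<open>(A\<^sup>m)\<^sup>K\<close> is \<open>A\<^bsup>mK\<^esup>\<close> cut into \<open>K\<close> blocks of length \<open>m\<close>. In \<open>block_map\<close>, a block index
  outside the source reads 0, so that blocks can be deleted as well as repeated. In
  \<open>finite_degree\<close> the last block is always filled: it is the base point of an affine cube.\<close>

definition diag_map :: "('a, 'r) ring_scheme \<Rightarrow> nat \<Rightarrow> nat \<Rightarrow> nat set \<Rightarrow> 'a parr" where
  "diag_map R m K J = (\<lambda>v\<in>carrier (free_mod R m).
     \<lambda>i. if i < m * K \<and> i div m \<in> J then v (i mod m) else \<zero>\<^bsub>R\<^esub>)"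

definition block_map :: "('a, 'r) ring_scheme \<Rightarrow> nat \<Rightarrow> nat \<Rightarrow> nat \<Rightarrow> (nat \<Rightarrow> nat) \<Rightarrow> 'a parr" where
  "block_map R m K K' \<phi> = (\<lambda>w\<in>carrier (free_mod R (m * K)).
     \<lambda>i. if i < m * K' then w (\<phi> (i div m) * m + i mod m) else \<zero>\<^bsub>R\<^esub>)"

definition block :: "('a, 'r) ring_scheme \<Rightarrow> nat \<Rightarrow> nat \<Rightarrow> nat \<Rightarrow> 'a parr" where
  "block R m K e = (\<lambda>w\<in>carrier (free_mod R (m * K)). \<lambda>i. if i < m then w (e * m + i) else \<zero>\<^bsub>R\<^esub>)"

definition finite_degree ::
  "('a, 'r) ring_scheme \<Rightarrow> ('a pobj, 'a parr, 'g) ab_functor \<Rightarrow> nat \<Rightarrow> nat \<Rightarrow> 'g \<Rightarrow> bool" where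
  "finite_degree R F m r x \<longleftrightarrow>
     sprod (fob F (free_mod R (m * Suc r))) {..<r}
       (\<lambda>I. far F (free_mod R m) (free_mod R (m * Suc r)) (diag_map R m (Suc r) (insert r I)) x)
     = \<one>\<^bsub>fob F (free_mod R (m * Suc r))\<^esub>"

context cring
begin

lemma diag_map_lin: "diag_map R m K J \<in> lin_maps R (free_mod R m) (free_mod R (m * K))"
  unfolding diag_map_def
  by (rule lin_mapsI[OF free_mod_module]) (auto simp: free_mod_iff free_mod_closed fun_eq_iff)

lemma block_map_lin: "block_map R m K K' \<phi> \<in> lin_maps R (free_mod R (m * K)) (free_mod R (m * K'))"
  unfolding block_map_def
  by (rule lin_mapsI[OF free_mod_module]) (simp add: free_mod_iff[of _ R "m * K'"] free_mod_closed, simp_all add: fun_eq_iff)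

lemma block_lin: "block R m K e \<in> lin_maps R (free_mod R (m * K)) (free_mod R m)"
  unfolding block_def
  by (rule lin_mapsI[OF free_mod_module]) (simp add: free_mod_iff[of _ R m] free_mod_closed, simp_all add: fun_eq_iff)

lemma block_diag_map:
  assumes v: "v \<in> carrier (free_mod R m)" and e: "e < K"
  shows "block R m K e (diag_map R m K J v) = (if e \<in> J then v else (\<lambda>i. \<zero>))"
proof
  fix i
  have "e * m + i < m * K" if "i < m"
  proof -
    have "e * m + i < Suc e * m"
      using that by simp
    also have "\<dots> \<le> K * m"
      using e by (intro mult_le_mono1) simp
    finally show ?thesis by (simp add: mult.commute)
  qed
  then show "block R m K e (diag_map R m K J v) i = (if e \<in> J then v else (\<lambda>i. \<zero>)) i"
    using v lin_mapsD(1)[OF diag_map_lin v, of K J]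
    by (simp add: block_def) (auto simp: diag_map_def free_mod_tail)
qed

text \<open>Target block k is copied from source block \<phi> k, so it is filled exactly if \<phi> k
  is filled. As J lies below K, a source index from K on counts as empty.\<close>

lemma block_map_diag_map:
  assumes v: "v \<in> carrier (free_mod R m)" and J: "J \<subseteq> {..<K}"
    and J': "\<And>k. k < K' \<Longrightarrow> k \<in> J' \<longleftrightarrow> \<phi> k \<in> J"
  shows "block_map R m K K' \<phi> (diag_map R m K J v) = diag_map R m K' J' v"
proof
  fix i
  let ?e = "\<phi> (i div m)"
  show "block_map R m K K' \<phi> (diag_map R m K J v) i = diag_map R m K' J' v i"
  proof (cases "i < m * K'")
    case True
    then have m: "m > 0" and k: "i div m < K'"
      by (auto simp: less_mult_imp_div_less mult.commute intro: gr0I)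
    have lt: "?e * m + i mod m < m * K" if "?e \<in> J"
    proof -
      have "?e * m + i mod m < Suc ?e * m"
        using m by simp
      also have "\<dots> \<le> K * m"
        using that J by (intro mult_le_mono1) auto
      finally show ?thesis by (simp add: mult.commute)
    qed
    have "(?e * m + i mod m) div m = ?e" "(?e * m + i mod m) mod m = i mod m"
      using m by simp_all
    then show ?thesis
      using True v lin_mapsD(1)[OF diag_map_lin v, of K J] lt J'[OF k]
      by (simp add: block_map_def) (auto simp: diag_map_def)
  next
    case False
    then show ?thesis
      using v lin_mapsD(1)[OF diag_map_lin v, of K J] by (simp add: block_map_def) (simp add: diag_map_def)
  qed
qed

end

context functor_over_half_cring
begin

lemma diag_block_map:
  assumes x: "x \<in> carrier (fob F (free_mod R m))" and J: "J \<subseteq> {..<K}"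
    and J': "\<And>k. k < K' \<Longrightarrow> k \<in> J' \<longleftrightarrow> \<phi> k \<in> J"
  shows "far F (free_mod R (m * K)) (free_mod R (m * K')) (block_map R m K K' \<phi>)
      (far F (free_mod R m) (free_mod R (m * K)) (diag_map R m K J) x)
    = far F (free_mod R m) (free_mod R (m * K')) (diag_map R m K' J') x"
  by (rule F_comp[OF free_mod_Ob free_mod_Ob free_mod_Ob diag_map_lin block_map_lin x diag_map_lin])
    (rule block_map_diag_map[OF _ J J', symmetric])

text \<open>If the alternating product over the cube with base point \<open>g\<close> does not depend on \<open>g\<close>, or is
  trivial, then so is the difference of its values at \<open>g\<close> and \<open>g + f\<close>, which is the product
  over the cube with one more direction \<open>f\<close>. The two block maps put these two base points into
  the same relation.\<close>

lemma finite_degree_step: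
  assumes x: "x \<in> carrier (fob F (free_mod R m))"
    and eq: "sprod (fob F (free_mod R (m * Suc d))) {..<d}
         (\<lambda>I. far F (free_mod R m) (free_mod R (m * Suc d)) (diag_map R m (Suc d) (insert d I)) x)
       = sprod (fob F (free_mod R (m * Suc d))) {..<d}
         (\<lambda>I. far F (free_mod R m) (free_mod R (m * Suc d)) (diag_map R m (Suc d) I) x) \<or>
       sprod (fob F (free_mod R (m * Suc d))) {..<d}
         (\<lambda>I. far F (free_mod R m) (free_mod R (m * Suc d)) (diag_map R m (Suc d) (insert d I)) x)
       = \<one>\<^bsub>fob F (free_mod R (m * Suc d))\<^esub>"
  shows "finite_degree R F m (Suc d) x"
proof -
  let ?V = "free_mod R m" and ?W = "free_mod R (m * Suc d)" and ?W' = "free_mod R (m * Suc (Suc d))"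
  let ?s = "\<lambda>J. far F ?V ?W (diag_map R m (Suc d) J) x"
  let ?s' = "\<lambda>J. far F ?V ?W' (diag_map R m (Suc (Suc d)) J) x"
  interpret W: comm_group "fob F ?W" by (rule F_group[OF free_mod_Ob])
  interpret W': comm_group "fob F ?W'" by (rule F_group[OF free_mod_Ob])
  have sc: "?s J \<in> carrier (fob F ?W)" and sc': "?s' J \<in> carrier (fob F ?W')" for J
    using F_closed[OF free_mod_Ob free_mod_Ob diag_map_lin x] by auto
  \<comment> \<open>In the source, blocks below d are directions and d is the base; in the target, d
    is a new direction and \<open>Suc d\<close> the base. Both maps copy the old base to the new
    one. \<phi> leaves the new direction empty, because source index \<open>Suc d\<close> is out of
    range and reads 0; \<psi> fills it with the base as well.\<close>
  define \<phi> where "\<phi> k = (if k < d then k else if k = d then Suc d else d)" for k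
  define \<psi> where "\<psi> k = (if k < d then k else d)" for k
  have hom: "far F ?W ?W' (block_map R m (Suc d) (Suc (Suc d)) \<chi>) \<in> hom (fob F ?W) (fob F ?W')" for \<chi>
    by (rule F_hom[OF free_mod_Ob free_mod_Ob block_map_lin])
  note push = W.sprod_hom[OF W'.comm_group_axioms hom, of "{..<d}", OF sc]
  have push_eq: "far F ?W ?W' (block_map R m (Suc d) (Suc (Suc d)) \<chi>) (sprod (fob F ?W) {..<d} (\<lambda>I. ?s (j I)))
    = sprod (fob F ?W') {..<d} (\<lambda>I. ?s' (j' I))"
    if "\<And>I. I \<subseteq> {..<d} \<Longrightarrow> j I \<subseteq> {..<Suc d}"
      "\<And>I k. I \<subseteq> {..<d} \<Longrightarrow> k < Suc (Suc d) \<Longrightarrow> k \<in> j' I \<longleftrightarrow> \<chi> k \<in> j I" for \<chi> j j'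
    unfolding push
  proof (rule W'.sprod_cong)
    fix I :: "nat set" assume I: "I \<subseteq> {..<d}"
    show "far F ?W ?W' (block_map R m (Suc d) (Suc (Suc d)) \<chi>) (?s (j I)) = ?s' (j' I)"
      by (rule diag_block_map[OF x that(1)[OF I] that(2)[OF I]])
  qed (rule sc')
  have sub: "insert d I \<subseteq> {..<Suc d}" "I \<subseteq> {..<Suc d}" if "I \<subseteq> {..<d}" for I
    using that by auto
  have phi1: "k \<in> insert (Suc d) I \<longleftrightarrow> \<phi> k \<in> insert d I" "k \<in> I \<longleftrightarrow> \<phi> k \<in> I"
    "k \<in> insert (Suc d) (insert d I) \<longleftrightarrow> \<psi> k \<in> insert d I" "k \<in> I \<longleftrightarrow> \<psi> k \<in> I"
    if "I \<subseteq> {..<d}" "k < Suc (Suc d)" for I k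
    using that by (auto simp: \<phi>_def \<psi>_def less_Suc_eq subset_iff)
  let ?one = "\<one>\<^bsub>fob F ?W\<^esub>"
  have e1: "far F ?W ?W' (block_map R m (Suc d) (Suc (Suc d)) \<phi>) (sprod (fob F ?W) {..<d} (\<lambda>I. ?s (insert d I)))
    = sprod (fob F ?W') {..<d} (\<lambda>I. ?s' (insert (Suc d) I))"
    by (rule push_eq) (simp_all only: sub phi1(1))
  have e2: "far F ?W ?W' (block_map R m (Suc d) (Suc (Suc d)) \<phi>) (sprod (fob F ?W) {..<d} (\<lambda>I. ?s (I)))
    = sprod (fob F ?W') {..<d} (\<lambda>I. ?s' (I))"
    by (rule push_eq) (simp_all only: sub phi1(2))
  have e3: "far F ?W ?W' (block_map R m (Suc d) (Suc (Suc d)) \<psi>) (sprod (fob F ?W) {..<d} (\<lambda>I. ?s (insert d I)))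
    = sprod (fob F ?W') {..<d} (\<lambda>I. ?s' (insert (Suc d) (insert d I)))"
    by (rule push_eq) (simp_all only: sub phi1(3))
  have e4: "far F ?W ?W' (block_map R m (Suc d) (Suc (Suc d)) \<psi>) (sprod (fob F ?W) {..<d} (\<lambda>I. ?s (I)))
    = sprod (fob F ?W') {..<d} (\<lambda>I. ?s' (I))"
    by (rule push_eq) (simp_all only: sub phi1(4))
  have one: "far F ?W ?W' (block_map R m (Suc d) (Suc (Suc d)) \<chi>) ?one = \<one>\<^bsub>fob F ?W'\<^esub>" for \<chi>
    by (rule hom_one[OF hom W.group_axioms W'.group_axioms])
  have "sprod (fob F ?W') {..<d} (\<lambda>I. ?s' (insert (Suc d) I))
    = sprod (fob F ?W') {..<d} (\<lambda>I. ?s' (insert (Suc d) (insert d I)))"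
    using eq
  proof
    assume 1: "sprod (fob F ?W) {..<d} (\<lambda>I. ?s (insert d I)) = sprod (fob F ?W) {..<d} ?s"
    show ?thesis
      unfolding e1[symmetric] e3[symmetric] 1 e2 e4 by (rule refl)
  next
    assume 2: "sprod (fob F ?W) {..<d} (\<lambda>I. ?s (insert d I)) = ?one"
    show ?thesis
      unfolding e1[symmetric] e3[symmetric] 2 one by (rule refl)
  qed
  moreover have "sprod (fob F ?W') {..<Suc d} (\<lambda>I. ?s' (insert (Suc d) I))
    = sprod (fob F ?W') {..<d} (\<lambda>I. ?s' (insert (Suc d) I)) \<otimes>\<^bsub>fob F ?W'\<^esub>
      inv\<^bsub>fob F ?W'\<^esub> sprod (fob F ?W') {..<d} (\<lambda>I. ?s' (insert (Suc d) (insert d I)))"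
    unfolding lessThan_Suc by (rule W'.sprod_insert) (use sc' in auto)
  ultimately show ?thesis
    unfolding finite_degree_def using W'.sprod_closed[of "{..<d}", OF sc'] by simp
qed

text \<open>Iterates \<open>finite_degree_step\<close> in its second alternative, where the smaller
  product is trivial. It brings several elements to a common degree.\<close>

lemma finite_degree_mono:
  assumes x: "x \<in> carrier (fob F (free_mod R m))" and "finite_degree R F m r x" "r \<le> r'"
  shows "finite_degree R F m r' x"
  using assms(3,2)
proof (induction rule: dec_induct)
  case (step r)
  then show ?case
    using finite_degree_step[OF x, of r] by (simp add: finite_degree_def)
qed

text \<open>Each vertex of the cube is a homomorphism in \<open>x\<close>. With
  \<open>finite_degree_mono\<close> and \<open>finite_degree_one\<close>, the elements of finite
  degree form a subgroup, which reduces the analytic case to generators of a colimit.\<close>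

lemma finite_degree_quot:
  assumes x: "x \<in> carrier (fob F (free_mod R m))" "finite_degree R F m r x"
    and y: "y \<in> carrier (fob F (free_mod R m))" "finite_degree R F m r y"
  shows "finite_degree R F m r (x \<otimes>\<^bsub>fob F (free_mod R m)\<^esub> inv\<^bsub>fob F (free_mod R m)\<^esub> y)"
proof -
  let ?V = "free_mod R m" and ?W = "free_mod R (m * Suc r)"
  let ?s = "\<lambda>x I. far F ?V ?W (diag_map R m (Suc r) (insert r I)) x"
  interpret V: comm_group "fob F ?V" by (rule F_group[OF free_mod_Ob])
  interpret W: comm_group "fob F ?W" by (rule F_group[OF free_mod_Ob])
  have s: "group_hom (fob F ?V) (fob F ?W) (\<lambda>x. ?s x I)" for I
    by (rule comm_group_hom_group_hom[OF V.comm_group_axioms W.comm_group_axioms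
          F_hom[OF free_mod_Ob free_mod_Ob diag_map_lin]])
  have sc: "?s z I \<in> carrier (fob F ?W)" if "z \<in> carrier (fob F ?V)" for z I
    by (rule group_hom.hom_closed[OF s that])
  have "?s (x \<otimes>\<^bsub>fob F ?V\<^esub> inv\<^bsub>fob F ?V\<^esub> y) I = ?s x I \<otimes>\<^bsub>fob F ?W\<^esub> inv\<^bsub>fob F ?W\<^esub> ?s y I" for I
    using x(1) y(1) by (simp add: group_hom.hom_mult[OF s] group_hom.hom_inv[OF s])
  then have "sprod (fob F ?W) {..<r} (?s (x \<otimes>\<^bsub>fob F ?V\<^esub> inv\<^bsub>fob F ?V\<^esub> y))
    = sprod (fob F ?W) {..<r} (\<lambda>I. ?s x I \<otimes>\<^bsub>fob F ?W\<^esub> inv\<^bsub>fob F ?W\<^esub> ?s y I)"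
    by simp
  also have "\<dots> = sprod (fob F ?W) {..<r} (?s x) \<otimes>\<^bsub>fob F ?W\<^esub> sprod (fob F ?W) {..<r} (\<lambda>I. inv\<^bsub>fob F ?W\<^esub> ?s y I)"
    by (rule W.sprod_mult) (use sc x y in auto)
  also have "sprod (fob F ?W) {..<r} (\<lambda>I. inv\<^bsub>fob F ?W\<^esub> ?s y I) = inv\<^bsub>fob F ?W\<^esub> sprod (fob F ?W) {..<r} (?s y)"
    by (rule W.sprod_inv) (use sc y in auto)
  finally show ?thesis
    using x(2) y(2) by (simp add: finite_degree_def)
qed

lemma finite_degree_one: "\<exists>r. finite_degree R F m r \<one>\<^bsub>fob F (free_mod R m)\<^esub>"
proof -
  let ?V = "free_mod R m"
  interpret V: comm_group "fob F ?V" by (rule F_group[OF free_mod_Ob])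
  interpret W: comm_group "fob F (free_mod R (m * Suc 0))" by (rule F_group[OF free_mod_Ob])
  have "finite_degree R F m 0 \<one>\<^bsub>fob F ?V\<^esub>"
    unfolding finite_degree_def sprod_def
    using hom_one[OF F_hom[OF free_mod_Ob free_mod_Ob diag_map_lin] V.group_axioms W.group_axioms]
    by simp
  then show ?thesis by blast
qed

text \<open>In the relation on d + 1 blocks that defines degree d, block d is singled out as the
  base. The relation then says that the cube in the other d directions has the same alternating
  product with the base filled or empty. This is the first alternative of
  \<open>finite_degree_step\<close>, which adds one direction.\<close>

lemma polynomial_finite_degree:
  assumes poly: "polynomial_of_degree_le R F d" and x: "x \<in> carrier (fob F (free_mod R m))"
  shows "finite_degree R F m (Suc d) x"
proof (rule finite_degree_step[OF x], rule disjI1)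
  let ?V = "free_mod R m" and ?W = "free_mod R (m * Suc d)"
  let ?s = "\<lambda>J. far F ?V ?W (diag_map R m (Suc d) J) x"
  interpret W: comm_group "fob F ?W" by (rule F_group[OF free_mod_Ob])
  have sc: "?s J \<in> carrier (fob F ?W)" for J
    by (rule F_closed[OF free_mod_Ob free_mod_Ob diag_map_lin x])
  \<comment> \<open>The inverse of the family of block projections places entry i mod m of the
    vector with index i div m at position i.\<close>
  have pow: "is_power R ?V {..<Suc d} ?W (block R m (Suc d))"
    unfolding is_power_def
  proof (intro conjI ballI block_lin bij_betwI[where g = "\<lambda>a i. if i < m * Suc d then a (i div m) (i mod m) else \<zero>"])
    show "(\<lambda>w. \<lambda>e\<in>{..<Suc d}. block R m (Suc d) e w) \<in> carrier ?W \<rightarrow> {..<Suc d} \<rightarrow>\<^sub>E carrier ?V"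
      using lin_mapsD(1)[OF block_lin] by auto
    show "(\<lambda>a i. if i < m * Suc d then a (i div m) (i mod m) else \<zero>) \<in> ({..<Suc d} \<rightarrow>\<^sub>E carrier ?V) \<rightarrow> carrier ?W"
    proof
      fix a assume a: "a \<in> {..<Suc d} \<rightarrow>\<^sub>E carrier ?V"
      have "a (i div m) (i mod m) \<in> carrier R" if "i < m * Suc d" for i
        using that a free_mod_closed[of "a (i div m)" m]
        by (auto simp: less_mult_imp_div_less mult.commute PiE_iff)
      then show "(\<lambda>i. if i < m * Suc d then a (i div m) (i mod m) else \<zero>) \<in> carrier ?W"
        by (simp add: free_mod_iff[of _ R "m * Suc d"])
    qed
    show "(\<lambda>i. if i < m * Suc d then (\<lambda>e\<in>{..<Suc d}. block R m (Suc d) e w) (i div m) (i mod m) else \<zero>) = w"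
      if w: "w \<in> carrier ?W" for w
    proof
      fix i
      show "(if i < m * Suc d then (\<lambda>e\<in>{..<Suc d}. block R m (Suc d) e w) (i div m) (i mod m) else \<zero>) = w i"
      proof (cases "i < m * Suc d")
        case True
        then have "i div m < Suc d" "i mod m < m"
          by (auto simp: less_mult_imp_div_less mult.commute intro!: mod_less_divisor intro: gr0I)
        then show ?thesis
          using True w by (simp add: block_def)
      qed (use free_mod_tail[OF w] in \<open>simp_all\<close>)
    qed
    show "(\<lambda>e\<in>{..<Suc d}. block R m (Suc d) e (\<lambda>i. if i < m * Suc d then a (i div m) (i mod m) else \<zero>)) = a"
      if a: "a \<in> {..<Suc d} \<rightarrow>\<^sub>E carrier ?V" for a
    proof
      let ?w = "\<lambda>i. if i < m * Suc d then a (i div m) (i mod m) else \<zero>"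
      fix e show "(\<lambda>e\<in>{..<Suc d}. block R m (Suc d) e ?w) e = a e"
      proof (cases "e < Suc d")
        case True
        then have ae: "a e \<in> carrier ?V"
          using a by auto
        have "a (i div m) (i mod m) \<in> carrier R" if "i < m * Suc d" for i
          using that a free_mod_closed[of "a (i div m)" m]
          by (auto simp: less_mult_imp_div_less mult.commute PiE_iff)
        then have w: "?w \<in> carrier ?W"
          by (simp add: free_mod_iff[of _ R "m * Suc d"])
        have lt: "e * m + i < m * Suc d" if "i < m" for i
        proof -
          have "e * m + i < Suc e * m"
            using that by simp
          also have "\<dots> \<le> Suc d * m"
            using True by (intro mult_le_mono1) simp
          finally show ?thesis by (simp add: mult.commute)
        qed
        have "block R m (Suc d) e ?w = a e"
          using w lt free_mod_tail[OF ae] by (auto simp: block_def fun_eq_iff)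
        then show ?thesis
          using True by (simp)
      next
        case False
        then show ?thesis
          using a by (auto simp: PiE_iff extensional_def)
      qed
    qed
  qed
  have "sprod (fob F ?W) {..<Suc d} ?s = \<one>\<^bsub>fob F ?W\<^esub>"
    unfolding sprod_def
  proof (rule poly[unfolded polynomial_of_degree_le_def, rule_format, OF _ x])
    show "finite {..<Suc d} \<and> card {..<Suc d} = d + 1 \<and> ?V \<in> Ob (proj_cat R) \<and> ?W \<in> Ob (proj_cat R) \<and>
        is_power R ?V {..<Suc d} ?W (block R m (Suc d)) \<and>
        (\<forall>I\<subseteq>{..<Suc d}. diag_map R m (Suc d) I \<in> lin_maps R ?V ?W \<and>
           (\<forall>e\<in>{..<Suc d}. \<forall>v\<in>carrier ?V. block R m (Suc d) e (diag_map R m (Suc d) I v)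
              = (if e \<in> I then v else \<zero>\<^bsub>?V\<^esub>)))"
      using pow by (simp add: free_mod_Ob diag_map_lin block_diag_map)
  qed
  moreover have "sprod (fob F ?W) {..<Suc d} ?s
    = sprod (fob F ?W) {..<d} ?s \<otimes>\<^bsub>fob F ?W\<^esub> inv\<^bsub>fob F ?W\<^esub> sprod (fob F ?W) {..<d} (\<lambda>I. ?s (insert d I))"
    unfolding lessThan_Suc by (rule W.sprod_insert) (use sc in auto)
  ultimately have eq: "sprod (fob F ?W) {..<d} ?s \<otimes>\<^bsub>fob F ?W\<^esub>
      inv\<^bsub>fob F ?W\<^esub> sprod (fob F ?W) {..<d} (\<lambda>I. ?s (insert d I)) = \<one>\<^bsub>fob F ?W\<^esub>"
    by simp
  have "sprod (fob F ?W) {..<d} ?s \<in> carrier (fob F ?W)"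
    "sprod (fob F ?W) {..<d} (\<lambda>I. ?s (insert d I)) \<in> carrier (fob F ?W)"
    using sc by (auto intro!: W.sprod_closed)
  then show "sprod (fob F ?W) {..<d} (\<lambda>I. ?s (insert d I)) = sprod (fob F ?W) {..<d} ?s"
    using eq by (metis W.inv_closed W.inv_equality W.inv_inv)
qed

end

lemma finite_degree_nat_trans:
  assumes D: "functor_over_half_cring R D" and F: "functor_over_half_cring R F"
    and t: "nat_trans (proj_cat R) D F \<tau>"
    and x: "x \<in> carrier (fob D (free_mod R m))" and fd: "finite_degree R D m r x"
  shows "finite_degree R F m r (\<tau> (free_mod R m) x)"
proof -
  interpret D: functor_over_half_cring R D by fact
  interpret F: functor_over_half_cring R F by fact
  let ?V = "free_mod R m" and ?W = "free_mod R (m * Suc r)"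
  let ?s = "\<lambda>x I. far D ?V ?W (diag_map R m (Suc r) (insert r I)) x"
  interpret DW: comm_group "fob D ?W" by (rule D.F_group[OF D.free_mod_Ob])
  interpret FW: comm_group "fob F ?W" by (rule F.F_group[OF D.free_mod_Ob])
  have hom: "\<tau> ?W \<in> hom (fob D ?W) (fob F ?W)"
    using t D.free_mod_Ob by (auto simp: nat_trans_def)
  have sc: "?s x I \<in> carrier (fob D ?W)" for I
    by (rule D.F_closed[OF D.free_mod_Ob D.free_mod_Ob D.diag_map_lin x])
  have "far F ?V ?W (diag_map R m (Suc r) (insert r I)) (\<tau> ?V x) = \<tau> ?W (?s x I)" for I
    using t[unfolded nat_trans_def, THEN conjunct2, rule_format, OF D.free_mod_Ob[of m]
        D.free_mod_Ob[of "m * Suc r"], of "diag_map R m (Suc r) (insert r I)" x] x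
      D.diag_map_lin[of m "Suc r" "insert r I"] by (simp)
  then have "sprod (fob F ?W) {..<r} (\<lambda>I. far F ?V ?W (diag_map R m (Suc r) (insert r I)) (\<tau> ?V x))
    = \<tau> ?W (sprod (fob D ?W) {..<r} (?s x))"
    by (simp add: DW.sprod_hom[OF FW.comm_group_axioms hom sc])
  also have "\<dots> = \<one>\<^bsub>fob F ?W\<^esub>"
    using fd hom_one[OF hom DW.group_axioms FW.group_axioms] by (simp add: finite_degree_def)
  finally show ?thesis
    by (simp add: finite_degree_def)
qed

text \<open>Colimits of functors are pointwise, so F(A^m) is generated by images of elements of the
  polynomial functors \<open>D j\<close>. Those have finite degree, naturality transports it to F,
  and finite degree passes to combinations. The degree depends on \<open>x\<close>.\<close>

lemma (in functor_over_half_cring) analytic_finite_degree: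
  assumes an: "analytic TYPE('j \<times> 'k \<times> 'h) R F" and x: "x \<in> carrier (fob F (free_mod R m))"
  shows "\<exists>r. finite_degree R F m r x"
proof -
  let ?V = "free_mod R m"
  obtain J :: "('j, 'k) small_cat" and D :: "'j \<Rightarrow> ('a pobj, 'a parr, 'h) ab_functor" and t \<iota>
    where lim: "is_functor_colimit (proj_cat R) J D t F \<iota>"
      and poly: "\<forall>j\<in>Ob J. polynomial_functor R (D j)"
    using an unfolding analytic_def by blast
  define DV where "DV = \<lparr>fob = (\<lambda>j. fob (D j) ?V), far = (\<lambda>j k a. t j k a ?V)\<rparr>"
  have DV: "is_functor J DV"
    using lim free_mod_Ob[of m] unfolding is_functor_colimit_def DV_def Let_def by blast
  obtain \<phi> where \<phi>: "\<phi> \<in> iso (colim J DV) (fob F ?V)"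
    and \<phi>c: "\<forall>j\<in>Ob J. \<forall>x\<in>carrier (fob (D j) ?V). \<phi> (colim_class J DV j x) = \<iota> j ?V x"
    using lim free_mod_Ob[of m] unfolding is_functor_colimit_def DV_def Let_def by blast
  have D: "functor_over_half_cring R (D j)" if "j \<in> Ob J" for j
    using lim that unfolding is_functor_colimit_def by unfold_locales blast
  have nt: "nat_trans (proj_cat R) (D j) F (\<iota> j)" if "j \<in> Ob J" for j
    using lim that unfolding is_functor_colimit_def by blast
  interpret V: comm_group "fob F ?V" by (rule F_group[OF free_mod_Ob])
  interpret C: comm_group "colim J DV" by (rule colim_comm_group[OF DV])
  have \<phi>h: "\<phi> \<in> hom (colim J DV) (fob F ?V)"
    using \<phi> by (simp add: iso_def)
  interpret \<phi>: group_hom "colim J DV" "fob F ?V" \<phi>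
    by (rule comm_group_hom_group_hom[OF C.comm_group_axioms V.comm_group_axioms \<phi>h])
  obtain z where z: "z \<in> carrier (colim J DV)" "x = \<phi> z"
    using \<phi> x by (auto simp: iso_def bij_betw_def)
  have "\<exists>r. finite_degree R F m r (\<phi> z)"
  proof (rule colim_induct[OF DV z(1)])
    show "\<exists>r. finite_degree R F m r (\<phi> \<one>\<^bsub>colim J DV\<^esub>)"
      using finite_degree_one by simp
  next
    fix a b
    assume ab: "a \<in> carrier (colim J DV)" "b \<in> carrier (colim J DV)"
      and "\<exists>r. finite_degree R F m r (\<phi> a)" "\<exists>r. finite_degree R F m r (\<phi> b)"
    then obtain r s where rs: "finite_degree R F m r (\<phi> a)" "finite_degree R F m s (\<phi> b)"
      by blast
    \<comment> \<open>The two elements may come from functors of different degrees.\<close>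
    have "finite_degree R F m (max r s) (\<phi> a)" "finite_degree R F m (max r s) (\<phi> b)"
      using finite_degree_mono ab rs by auto
    then have "finite_degree R F m (max r s) (\<phi> a \<otimes>\<^bsub>fob F ?V\<^esub> inv\<^bsub>fob F ?V\<^esub> \<phi> b)"
      using finite_degree_quot ab by simp
    then show "\<exists>r. finite_degree R F m r (\<phi> (a \<otimes>\<^bsub>colim J DV\<^esub> inv\<^bsub>colim J DV\<^esub> b))"
      using ab by auto
  next
    fix j y assume j: "j \<in> Ob J" and "y \<in> carrier (fob DV j)"
    then have y: "y \<in> carrier (fob (D j) ?V)"
      by (simp add: DV_def)
    obtain d where "polynomial_of_degree_le R (D j) d"
      using poly j unfolding polynomial_functor_def by blast
    then have "finite_degree R (D j) m (Suc d) y"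
      by (rule functor_over_half_cring.polynomial_finite_degree[OF D[OF j] _ y])
    then have "finite_degree R F m (Suc d) (\<iota> j ?V y)"
      by (rule finite_degree_nat_trans[OF D[OF j] functor_over_half_cring_axioms nt[OF j] y])
    then show "\<exists>r. finite_degree R F m r (\<phi> (colim_class J DV j y))"
      using \<phi>c j y by auto
  qed
  then show ?thesis using z by simp
qed


section \<open>Cancellation\<close>

context half_cring
begin

text \<open>The only nonzero entries are those of block \<open>e\<close>, which is a shifted copy of
  \<open>a\<close>.\<close>

lemma ip_diag_map_single:
  assumes a: "a \<in> carrier (free_mod R k)" and e: "e < r"
  shows "ip R (k * r) (diag_map R k r {e} a) (diag_map R k r {e} a) = ip R k a a"
proof -
  let ?d = "diag_map R k r {e} a"
  have d: "?d \<in> carrier (free_mod R (k * r))"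
    by (rule lin_mapsD(1)[OF diag_map_lin a])
  note ac = free_mod_closed[OF a] and dc = free_mod_closed[OF d]
  have lt: "e * k + i < k * r" if "i < k" for i
  proof -
    have "e * k + i < Suc e * k"
      using that by simp
    also have "\<dots> \<le> r * k"
      using e by (intro mult_le_mono1) simp
    finally show ?thesis by (simp add: mult.commute)
  qed
  have sub: "(\<lambda>i. e * k + i) ` {..<k} \<subseteq> {..<k * r}"
    using lt by auto
  have out: "?d i = \<zero>" if "i \<in> {..<k * r} - (\<lambda>i. e * k + i) ` {..<k}" for i
  proof (rule ccontr)
    assume "?d i \<noteq> \<zero>"
    then have "i div k = e" "i < k * r"
      using a by (auto simp: diag_map_def split: if_splits)
    then have "i = e * k + i mod k" "i mod k < k"
      by (metis div_mult_mod_eq, metis gr_zeroI mod_less_divisor mult_is_0 not_less0)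
    then show False
      using that by blast
  qed
  have "ip R (k * r) ?d ?d = finsum R (\<lambda>i. ?d i \<otimes> ?d i) ((\<lambda>i. e * k + i) ` {..<k})"
    unfolding ip_def
    by (rule add.finprod_mono_neutral_cong_right) (use sub out dc in auto)
  also have "\<dots> = finsum R (\<lambda>i. ?d (e * k + i) \<otimes> ?d (e * k + i)) {..<k}"
    by (rule finsum_reindex) (use dc in \<open>auto simp: inj_on_def\<close>)
  also have "\<dots> = ip R k a a"
    unfolding ip_def
  proof (rule finsum_cong')
    fix i assume "i \<in> {..<k}"
    then have "?d (e * k + i) = a i"
      using a lt by (simp add: diag_map_def)
    then show "?d (e * k + i) \<otimes> ?d (e * k + i) = a i \<otimes> a i"
      by simp
  qed (use ac in auto)
  finally show ?thesis .
qed

end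

text \<open>Analyticity is represented by the finite degree of every element, the form in which the
  arguments below consume it.\<close>

locale euclidean_invariant = stable_invariant R F G c
  for R :: "'a ring" (structure) and F :: "('a pobj, 'a parr, 'g) ab_functor"
    and G :: "'h monoid" and c :: "nat \<Rightarrow> 'g \<Rightarrow> 'h" +
  assumes Rq: "Rq R = carrier R"
    and finite_degree: "\<And>m x. x \<in> carrier (fob F (free_mod R m)) \<Longrightarrow> \<exists>r. finite_degree R F m r x"
begin

text \<open>One of the copies of \<open>P\<close> completes \<open>M\<close> to a unit multiple of an isometry, which can be
  exchanged for a scalar. The right-hand side no longer involves \<open>M\<close>.\<close>

lemma stack_exchange:
  assumes M: "M \<in> lin_maps R (free_mod R m) (free_mod R n)"
    and P: "P \<in> lin_maps R (free_mod R m) (free_mod R k)"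
    and u: "u \<in> Units R"
    and sum: "\<And>v. v \<in> carrier (free_mod R m) \<Longrightarrow>
      ip R n (M v) (M v) \<oplus> ip R k (P v) (P v) = (u \<otimes> u) \<otimes> ip R m v v"
    and I: "I \<subseteq> {..<r}" "e \<in> I" and x: "x \<in> carrier (fob F (free_mod R m))"
  shows "c (n + k * r) (far F (free_mod R m) (free_mod R (n + k * r))
      (\<lambda>v\<in>carrier (free_mod R m). vcat n (M v) (diag_map R k r I (P v))) x)
    = c (n + k * r + m) (far F (free_mod R m) (free_mod R (n + k * r + m))
      (\<lambda>v\<in>carrier (free_mod R m). vcat (n + k * r) (vcat n (\<lambda>i. \<zero>) (diag_map R k r (I - {e}) (P v)))
         (\<lambda>i. u \<otimes> v i)) x)"
proof -
  let ?V = "free_mod R m" and ?N = "n + k * r"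
  let ?W = "free_mod R ?N"
  note V = free_mod_module[of m]
  note MD = lin_mapsD[OF M] and PD = lin_mapsD[OF P]
  have uR: "u \<in> carrier R" and iu: "inv u \<in> carrier R" "inv u \<otimes> u = \<one>"
    using u by auto
  have Pd: "(\<lambda>v\<in>carrier ?V. diag_map R k r J (P v)) \<in> lin_maps R ?V (free_mod R (k * r))" for J
    by (rule lin_maps_restrict_comp[OF P diag_map_lin V])
  have stack: "(\<lambda>v\<in>carrier ?V. vcat n (f v) (diag_map R k r J (P v))) \<in> lin_maps R ?V ?W"
    if "f \<in> lin_maps R ?V (free_mod R n)" for f J
    using lin_vcat[OF V that Pd[of J]] by (simp cong: restrict_cong)
  define S where "S J = (\<lambda>v\<in>carrier ?V. vcat n (M v) (diag_map R k r J (P v)))" for J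
  have S: "S J \<in> lin_maps R ?V ?W" for J
    unfolding S_def by (rule stack[OF M])
  \<comment> \<open>The rows \<open>M\<close> and copy \<open>e\<close> of \<open>P\<close> have
    total square length u^2 |v|^2, so dividing them by u gives the isometry X. With t multiplication
    by u and z the remaining copies, the whole stack is X t + z.\<close>
  define X where "X = (\<lambda>v\<in>carrier ?V. \<lambda>i. inv u \<otimes> S {e} v i)"
  define t where "t = (\<lambda>v\<in>carrier ?V. \<lambda>i. u \<otimes> (\<lambda>v\<in>carrier ?V. v) v i)"
  define z where "z = (\<lambda>v\<in>carrier ?V. vcat n ((\<lambda>v\<in>carrier ?V. \<lambda>i. \<zero>) v) (diag_map R k r (I - {e}) (P v)))"
  have Xl: "X \<in> lin_maps R ?V ?W"
    unfolding X_def by (rule lin_smult[OF V S iu(1)])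
  have t: "t \<in> lin_maps R ?V ?V"
    unfolding t_def by (rule lin_smult[OF V _ uR], rule lin_mapsI[OF V]) auto
  have z: "z \<in> lin_maps R ?V ?W"
    unfolding z_def by (rule stack, rule lin_mapsI[OF V]) (auto simp: free_mod_zero_closed)
  have dc: "diag_map R k r J (P v) \<in> carrier (free_mod R (k * r))" if "v \<in> carrier ?V" for v J
    by (rule lin_mapsD(1)[OF diag_map_lin PD(1)[OF that]])
  have e: "e < r"
    using I by auto
  have iso: "isometry m ?N X"
    unfolding isometry_def
  proof (intro conjI ballI Xl)
    fix v assume v: "v \<in> carrier ?V"
    have Sv: "S {e} v \<in> carrier ?W"
      by (rule lin_mapsD(1)[OF S v])
    have "ip R ?N (X v) (X v) = inv u \<otimes> (inv u \<otimes> ip R ?N (S {e} v) (S {e} v))"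
      using v iu(1)
      by (simp add: X_def ip_smult_left[OF _ Sv free_mod_smult_closed[OF _ Sv]] ip_smult_right[OF _ Sv Sv])
    also have "ip R ?N (S {e} v) (S {e} v) = ip R n (M v) (M v)
        \<oplus> ip R (k * r) (diag_map R k r {e} (P v)) (diag_map R k r {e} (P v))"
      using v ip_vcat[OF MD(1)[OF v] dc[OF v] MD(1)[OF v] dc[OF v]] by (simp add: S_def)
    also have "\<dots> = (u \<otimes> u) \<otimes> ip R m v v"
      using sum[OF v] ip_diag_map_single[OF PD(1)[OF v] e] by simp
    also have "inv u \<otimes> (inv u \<otimes> ((u \<otimes> u) \<otimes> ip R m v v)) = (inv u \<otimes> u) \<otimes> (inv u \<otimes> u) \<otimes> ip R m v v"
      using uR iu(1) ip_closed[OF v v, of m] by (simp add: m_ac)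
    also have "\<dots> = ip R m v v"
      using iu(2) ip_closed[OF v v, of m] by simp
    finally show "ip R ?N (X v) (X v) = ip R m v v" .
  qed
  \<comment> \<open>The supports are disjoint: X lives on the first n rows and on block
    \<open>e\<close>, where z vanishes.\<close>
  have orth: "ip R ?N (X y) (z v) = \<zero>" if "y \<in> carrier ?V" "v \<in> carrier ?V" for y v
  proof (rule ip_zero)
    fix i
    have c: "inv u \<otimes> S {e} y i \<in> carrier R" "z v i \<in> carrier R" "diag_map R k r J (P w) j \<in> carrier R"
      if "w \<in> carrier ?V" for J w j
      using \<open>y \<in> carrier ?V\<close> \<open>v \<in> carrier ?V\<close> that free_mod_closed[OF lin_mapsD(1)[OF S]]
        free_mod_closed[OF lin_mapsD(1)[OF z]] free_mod_closed[OF dc] iu(1) by auto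
    show "X y i \<otimes> z v i = \<zero>"
    proof (cases "i < n")
      case True
      then have "z v i = \<zero>"
        using that by (simp add: z_def vcat_def)
      then show ?thesis
        using c(1)[OF that(1)] that by (simp add: X_def)
    next
      case False
      have "diag_map R k r {e} (P y) (i - n) = \<zero> \<or> diag_map R k r (I - {e}) (P v) (i - n) = \<zero>"
        using PD(1) that by (simp add: diag_map_def)
      then show ?thesis
        using False that c iu(1) by (auto simp: X_def S_def z_def vcat_def)
    qed
  qed
  have fX: "S I v = (\<lambda>i. X (t v) i \<oplus> z v i)" if v: "v \<in> carrier ?V" for v
  proof
    fix i
    have tv: "t v = u \<odot>\<^bsub>?V\<^esub> v"
      using v by (simp add: t_def)
    have "X (t v) = u \<odot>\<^bsub>?W\<^esub> X v"
      unfolding tv by (rule lin_mapsD(3)[OF Xl uR v])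
    moreover have Sc: "S {e} v i \<in> carrier R"
      by (rule free_mod_closed[OF lin_mapsD(1)[OF S v]])
    moreover have "u \<otimes> (inv u \<otimes> s) = s" if "s \<in> carrier R" for s
      using that u by (metis Units_closed Units_inv_closed Units_r_inv l_one m_assoc)
    ultimately have "X (t v) i = S {e} v i"
      using v by (simp add: X_def)
    moreover have "S I v i = S {e} v i \<oplus> z v i"
    proof (cases "i < n")
      case True
      then show ?thesis
        using v free_mod_closed[OF MD(1)[OF v]] by (simp add: S_def z_def vcat_def)
    next
      case False
      have "diag_map R k r I (P v) j = diag_map R k r {e} (P v) j \<oplus> diag_map R k r (I - {e}) (P v) j" for j
        using PD(1)[OF v] I(2) free_mod_closed[OF PD(1)[OF v]] by (auto simp: diag_map_def)
      then show ?thesis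
        using False v by (simp add: S_def z_def vcat_def)
    qed
    ultimately show "S I v i = X (t v) i \<oplus> z v i"
      by simp
  qed
  have "c ?N (far F ?V ?W (S I) x)
    = c (?N + m) (far F ?V (free_mod R (?N + m)) (\<lambda>v\<in>carrier ?V. vcat ?N (z v) (t v)) x)"
    by (rule exchange[OF free_mod_Ob iso t z orth S fX x])
  also have "(\<lambda>v\<in>carrier ?V. vcat ?N (z v) (t v))
    = (\<lambda>v\<in>carrier ?V. vcat ?N (vcat n (\<lambda>i. \<zero>) (diag_map R k r (I - {e}) (P v))) (\<lambda>i. u \<otimes> v i))"
    by (rule restrict_ext) (simp add: z_def t_def)
  finally show ?thesis
    unfolding S_def .
qed

text \<open>One linear map \<open>L\<close> out of r + 1 blocks produces all stacks: it applies
  \<open>M\<close> to the base block r and \<open>P\<close> to each block below r. Filling the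
  blocks in \<open>I\<close> yields the stack of \<open>M\<close> with the copies in
  \<open>I\<close>, so the alternating product is the image of a trivial one.\<close>

lemma stack_relation:
  assumes M: "M \<in> lin_maps R (free_mod R m) (free_mod R n)"
    and P: "P \<in> lin_maps R (free_mod R m) (free_mod R k)"
    and x: "x \<in> carrier (fob F (free_mod R m))" and fd: "finite_degree R F m r x"
  shows "sprod G {..<r} (\<lambda>I. c (n + k * r) (far F (free_mod R m) (free_mod R (n + k * r))
      (\<lambda>v\<in>carrier (free_mod R m). vcat n (M v) (diag_map R k r I (P v))) x)) = \<one>\<^bsub>G\<^esub>"
proof -
  let ?V = "free_mod R m" and ?W = "free_mod R (m * Suc r)" and ?N = "n + k * r"
  let ?U = "free_mod R ?N"
  note MD = lin_mapsD[OF M] and PD = lin_mapsD[OF P]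
  interpret G: comm_group G by (rule G)
  interpret W: comm_group "fob F ?W" by (rule F_group[OF free_mod_Ob])
  interpret U: comm_group "fob F ?U" by (rule F_group[OF free_mod_Ob])
  define Q where "Q = (\<lambda>w\<in>carrier ?W. \<lambda>j. if j < k * r then P (block R m (Suc r) (j div k) w) (j mod k) else \<zero>)"
  have Q: "Q \<in> lin_maps R ?W (free_mod R (k * r))"
    unfolding Q_def
  proof (rule lin_mapsI[OF free_mod_module])
    note BD = lin_mapsD[OF block_lin[of m "Suc r"]]
    show "(\<lambda>j. if j < k * r then P (block R m (Suc r) (j div k) v) (j mod k) else \<zero>) \<in> carrier (free_mod R (k * r))"
      if v: "v \<in> carrier ?W" for v
      using free_mod_closed[OF PD(1)[OF BD(1)[OF v]]] by (simp add: free_mod_iff[of _ R "k * r"])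
    show "(\<lambda>j. if j < k * r then P (block R m (Suc r) (j div k) (v \<oplus>\<^bsub>?W\<^esub> w)) (j mod k) else \<zero>)
      = (\<lambda>j. if j < k * r then P (block R m (Suc r) (j div k) v) (j mod k) else \<zero>) \<oplus>\<^bsub>free_mod R (k * r)\<^esub>
        (\<lambda>j. if j < k * r then P (block R m (Suc r) (j div k) w) (j mod k) else \<zero>)"
      if v: "v \<in> carrier ?W" and w: "w \<in> carrier ?W" for v w
      unfolding BD(2)[OF v w] PD(2)[OF BD(1)[OF v] BD(1)[OF w]] by (auto simp: fun_eq_iff)
    show "(\<lambda>j. if j < k * r then P (block R m (Suc r) (j div k) (a \<odot>\<^bsub>?W\<^esub> v)) (j mod k) else \<zero>)
      = a \<odot>\<^bsub>free_mod R (k * r)\<^esub> (\<lambda>j. if j < k * r then P (block R m (Suc r) (j div k) v) (j mod k) else \<zero>)"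
      if a: "a \<in> carrier R" and v: "v \<in> carrier ?W" for a v
      unfolding BD(3)[OF a v] PD(3)[OF a BD(1)[OF v]] using a by (auto simp: fun_eq_iff)
  qed
  define L where "L = (\<lambda>w\<in>carrier ?W. vcat n ((\<lambda>w\<in>carrier ?W. M (block R m (Suc r) r w)) w) (Q w))"
  have L: "L \<in> lin_maps R ?W ?U"
    unfolding L_def
    by (rule lin_vcat[OF free_mod_module lin_maps_restrict_comp[OF block_lin M free_mod_module] Q])
  define S where "S I = (\<lambda>v\<in>carrier ?V. vcat n (M v) (diag_map R k r I (P v)))" for I
  have S: "S I \<in> lin_maps R ?V ?U" for I
    unfolding S_def
    using lin_vcat[OF free_mod_module M lin_maps_restrict_comp[OF P diag_map_lin[of k r I] free_mod_module]]
    by (simp cong: restrict_cong)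
  let ?d = "\<lambda>I. diag_map R m (Suc r) (insert r I)"
  have LS: "S I v = L (?d I v)" if v: "v \<in> carrier ?V" and I: "I \<subseteq> {..<r}" for I v
  proof -
    have dv: "?d I v \<in> carrier ?W"
      by (rule lin_mapsD(1)[OF diag_map_lin v])
    \<comment> \<open>An empty block contributes P(0), which has to be a block of zeros in the
      stack.\<close>
    have P0: "P (\<lambda>i. \<zero>) = (\<lambda>i. \<zero>)"
      using PD(3)[of \<zero> "\<lambda>i. \<zero>"] PD(1)[OF free_mod_zero_closed] free_mod_zero_closed[of m]
        free_mod_closed[OF PD(1)[OF free_mod_zero_closed]] by simp
    have "Q (?d I v) = diag_map R k r I (P v)"
    proof
      fix j
      show "Q (?d I v) j = diag_map R k r I (P v) j"
      proof (cases "j < k * r")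
        case True
        then have jr: "j div k < r"
          by (simp add: less_mult_imp_div_less mult.commute)
        then have "block R m (Suc r) (j div k) (?d I v) = (if j div k \<in> I then v else (\<lambda>i. \<zero>))"
          using block_diag_map[OF v, of "j div k" "Suc r" "insert r I"] by simp
        then show ?thesis
          using True dv PD(1)[OF v] P0 by (simp add: Q_def diag_map_def)
      next
        case False
        then show ?thesis
          using dv PD(1)[OF v] by (simp add: Q_def) (simp add: diag_map_def)
      qed
    qed
    moreover have "block R m (Suc r) r (?d I v) = v"
      using block_diag_map[OF v, of r "Suc r" "insert r I"] by simp
    ultimately show ?thesis
      using v dv by (simp add: S_def L_def)
  qed
  have FL: "far F ?W ?U L \<in> hom (fob F ?W) (fob F ?U)"
    by (rule F_hom[OF free_mod_Ob free_mod_Ob L])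
  have sc: "far F ?V ?W (?d I) x \<in> carrier (fob F ?W)" for I
    by (rule F_closed[OF free_mod_Ob free_mod_Ob diag_map_lin x])
  have hom: "(\<lambda>y. c ?N (far F ?W ?U L y)) \<in> hom (fob F ?W) G"
    using hom_compose[OF FL c_hom] by (simp add: comp_def)
  have "sprod G {..<r} (\<lambda>I. c ?N (far F ?V ?U (S I) x))
    = sprod G {..<r} (\<lambda>I. c ?N (far F ?W ?U L (far F ?V ?W (?d I) x)))"
  proof (rule G.sprod_cong)
    fix I :: "nat set" assume I: "I \<subseteq> {..<r}"
    have "far F ?W ?U L (far F ?V ?W (?d I) x) = far F ?V ?U (S I) x"
      by (rule F_comp[OF free_mod_Ob free_mod_Ob free_mod_Ob diag_map_lin L x S LS[OF _ I]])
    then show "c ?N (far F ?V ?U (S I) x) = c ?N (far F ?W ?U L (far F ?V ?W (?d I) x))"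
      by simp
    show "c ?N (far F ?W ?U L (far F ?V ?W (?d I) x)) \<in> carrier G"
      using hom_in_carrier[OF hom sc] .
  qed
  also have "\<dots> = c ?N (far F ?W ?U L (sprod (fob F ?W) {..<r} (\<lambda>I. far F ?V ?W (?d I) x)))"
    by (rule W.sprod_hom[OF G hom sc, symmetric])
  also have "\<dots> = \<one>\<^bsub>G\<^esub>"
    using fd hom_one[OF hom W.group_axioms G.group_axioms] by (simp add: finite_degree_def)
  finally show ?thesis
    by (simp add: S_def)
qed

lemma cancellation_free:
  assumes M: "M \<in> lin_maps R (free_mod R m) (free_mod R n)"
    and N: "N \<in> lin_maps R (free_mod R m) (free_mod R n)"
    and eq: "\<And>v. v \<in> carrier (free_mod R m) \<Longrightarrow> ip R n (M v) (M v) = ip R n (N v) (N v)"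
    and x: "x \<in> carrier (fob F (free_mod R m))"
  shows "c n (far F (free_mod R m) (free_mod R n) M x) = c n (far F (free_mod R m) (free_mod R n) N x)"
proof -
  let ?V = "free_mod R m"
  interpret G: comm_group G by (rule G)
  \<comment> \<open>The complement is chosen from the form of \<open>M\<close>. As \<open>N\<close>
    has the same form, the same \<open>P\<close> completes \<open>N\<close> as well.\<close>
  obtain u p where u: "u \<in> Units R" and p: "p \<in> T_forms R ?V"
    and up: "\<And>v. v \<in> carrier ?V \<Longrightarrow> (\<lambda>v\<in>carrier ?V. ip R n (M v) (M v)) v \<oplus> p v = (u \<otimes> u) \<otimes> ip R m v v"
    using complement_exists[OF Rq T_forms_lin[OF free_mod_module M]] by blast
  obtain k P where P: "P \<in> lin_maps R ?V (free_mod R k)"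
    and pP: "\<And>v. v \<in> carrier ?V \<Longrightarrow> p v = ip R k (P v) (P v)"
    using T_formsE[OF free_mod_module p] by metis
  have sumM: "ip R n (M v) (M v) \<oplus> ip R k (P v) (P v) = (u \<otimes> u) \<otimes> ip R m v v"
    and sumN: "ip R n (N v) (N v) \<oplus> ip R k (P v) (P v) = (u \<otimes> u) \<otimes> ip R m v v"
    if "v \<in> carrier ?V" for v
    using up[OF that] pP[OF that] eq[OF that] that by simp_all
  obtain r where r: "finite_degree R F m r x"
    using finite_degree[OF x] by blast
  define s where "s M I = c (n + k * r) (far F ?V (free_mod R (n + k * r))
      (\<lambda>v\<in>carrier ?V. vcat n (M v) (diag_map R k r I (P v))) x)" for M I
  have lin: "(\<lambda>v\<in>carrier ?V. vcat n (M v) (diag_map R k r I (P v))) \<in> lin_maps R ?V (free_mod R (n + k * r))"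
    if "M \<in> lin_maps R ?V (free_mod R n)" for M I
    using lin_vcat[OF free_mod_module that lin_maps_restrict_comp[OF P diag_map_lin[of k r I] free_mod_module]]
    by (simp cong: restrict_cong)
  have sc: "s M I \<in> carrier G" if "M \<in> lin_maps R ?V (free_mod R n)" for M I
    unfolding s_def by (rule hom_in_carrier[OF c_hom F_closed[OF free_mod_Ob free_mod_Ob lin[OF that] x]])
  \<comment> \<open>With the same \<open>e\<close> in \<open>I\<close> for both,
    \<open>stack_exchange\<close> leads to a right-hand side free of \<open>M\<close> and
    \<open>N\<close>.\<close>
  have rest: "s M I = s N I" if "I \<in> Pow {..<r} - {{}}" for I
  proof -
    obtain e where e: "e \<in> I" "I \<subseteq> {..<r}"
      using \<open>I \<in> Pow {..<r} - {{}}\<close> by blast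
    show ?thesis
      unfolding s_def
      by (rule trans[OF stack_exchange[OF M P u sumM e(2,1) x] stack_exchange[OF N P u sumN e(2,1) x, symmetric]])
  qed
  have zz: "finprod G (\<lambda>I. s M I [^]\<^bsub>G\<^esub> ((-1) ^ card I :: int)) (Pow {..<r} - {{}})
    = finprod G (\<lambda>I. s N I [^]\<^bsub>G\<^esub> ((-1) ^ card I :: int)) (Pow {..<r} - {{}})" (is "?z = ?z'")
    by (rule G.finprod_cong') (use rest sc N in auto)
  have "s M {} \<otimes>\<^bsub>G\<^esub> finprod G (\<lambda>I. s M I [^]\<^bsub>G\<^esub> ((-1) ^ card I :: int)) (Pow {..<r} - {{}}) = \<one>\<^bsub>G\<^esub>"
    if M: "M \<in> lin_maps R ?V (free_mod R n)" for M
  proof -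
    have "sprod G {..<r} (s M) = \<one>\<^bsub>G\<^esub>"
      unfolding s_def by (rule stack_relation[OF M P x r])
    then show ?thesis
      using G.sprod_remove_empty[of "{..<r}" "s M"] sc[OF M] by simp
  qed
  from this[OF M] this[OF N] have "s M {} \<otimes>\<^bsub>G\<^esub> ?z = \<one>\<^bsub>G\<^esub>" "s N {} \<otimes>\<^bsub>G\<^esub> ?z' = \<one>\<^bsub>G\<^esub>"
    by simp_all
  moreover have "?z' \<in> carrier G"
    by (rule G.finprod_closed) (use sc N in auto)
  ultimately have "s M {} = s N {}"
    unfolding zz using sc M N by (metis G.inv_equality)
  \<comment> \<open>Without copies of \<open>P\<close> the stack is \<open>M\<close> padded with
    zeros, that is, the same function into a larger free module.\<close>
  moreover have "s M {} = c n (far F ?V (free_mod R n) M x)" if M: "M \<in> lin_maps R ?V (free_mod R n)" for M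
  proof -
    have "vcat n (M v) (diag_map R k r {} (P v)) = M v" if "v \<in> carrier ?V" for v
      using vcat_zero[OF lin_mapsD(1)[OF M that]] lin_mapsD(1)[OF P that] by (simp add: diag_map_def)
    then have "(\<lambda>v\<in>carrier ?V. vcat n (M v) (diag_map R k r {} (P v))) = M"
      using lin_maps_ext[OF lin[OF M, of "{}"] M] by simp
    then have "s M {} = c (n + k * r) (far F ?V (free_mod R (n + k * r)) M x)"
      by (simp add: s_def)
    also have "\<dots> = c n (far F ?V (free_mod R n) M x)"
      by (rule c_mono[OF _ free_mod_Ob M x]) simp
    finally show ?thesis .
  qed
  ultimately show ?thesis
    using M N by simp
qed

text \<open>With s and r exhibiting V as a retract of A^m, the maps \<open>M\<close> and
  \<open>N\<close> are replaced by their composites with r, whose forms still agree, and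
  \<open>x\<close> by its image under s. Different targets are enlarged to the larger
  dimension.\<close>

lemma cancellation:
  assumes V: "V \<in> Ob (proj_cat R)" and M: "M \<in> lin_maps R V (free_mod R n)"
    and N: "N \<in> lin_maps R V (free_mod R n')"
    and eq: "\<And>v. v \<in> carrier V \<Longrightarrow> ip R n (M v) (M v) = ip R n' (N v) (N v)"
    and x: "x \<in> carrier (fob F V)"
  shows "c n (far F V (free_mod R n) M x) = c n' (far F V (free_mod R n') N x)"
proof -
  obtain m s r where s: "s \<in> lin_maps R V (free_mod R m)" and r: "r \<in> lin_maps R (free_mod R m) V"
    and rs: "\<And>v. v \<in> carrier V \<Longrightarrow> r (s v) = v"
    using fg_projective_retract[OF V] by blast
  let ?V = "free_mod R m" and ?k = "max n n'"
  let ?y = "far F V ?V s x"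
  have y: "?y \<in> carrier (fob F ?V)"
    by (rule F_closed[OF V free_mod_Ob s x])
  have Mk: "M \<in> lin_maps R V (free_mod R ?k)" and Nk: "N \<in> lin_maps R V (free_mod R ?k)"
    using lin_map_std[OF M, of ?k] lin_map_std[OF N, of ?k] by simp_all
  have retract: "far F V (free_mod R ?k) L x
      = far F ?V (free_mod R ?k) (\<lambda>v\<in>carrier ?V. L (r v)) ?y"
    if L: "L \<in> lin_maps R V (free_mod R ?k)" for L
    by (rule F_comp[symmetric, OF V free_mod_Ob free_mod_Ob s lin_maps_restrict_comp[OF r L free_mod_module] x L])
      (use lin_mapsD(1)[OF s] rs in simp)
  have "c ?k (far F ?V (free_mod R ?k) (\<lambda>v\<in>carrier ?V. M (r v)) ?y)
    = c ?k (far F ?V (free_mod R ?k) (\<lambda>v\<in>carrier ?V. N (r v)) ?y)"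
  proof (rule cancellation_free[OF _ _ _ y])
    fix v assume v: "v \<in> carrier ?V"
    have rv: "r v \<in> carrier V"
      by (rule lin_mapsD(1)[OF r v])
    have "ip R ?k (M (r v)) (M (r v)) = ip R ?k (N (r v)) (N (r v))"
      using eq[OF rv] ip_extend[OF _ lin_mapsD(1)[OF M rv] lin_mapsD(1)[OF M rv], of ?k]
        ip_extend[OF _ lin_mapsD(1)[OF N rv] lin_mapsD(1)[OF N rv], of ?k] by simp
    then show "ip R ?k ((\<lambda>v\<in>carrier ?V. M (r v)) v) ((\<lambda>v\<in>carrier ?V. M (r v)) v)
      = ip R ?k ((\<lambda>v\<in>carrier ?V. N (r v)) v) ((\<lambda>v\<in>carrier ?V. N (r v)) v)"
      using v by simp
  qed (rule lin_maps_restrict_comp[OF r Mk free_mod_module], rule lin_maps_restrict_comp[OF r Nk free_mod_module])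
  then have "c ?k (far F V (free_mod R ?k) M x) = c ?k (far F V (free_mod R ?k) N x)"
    using retract[OF Mk] retract[OF Nk] by simp
  then show ?thesis
    using c_mono[OF _ V M x, of ?k] c_mono[OF _ V N x, of ?k] by simp
qed

end


section \<open>Polynomial dependence on the form\<close>

text \<open>The properties shared by T-forms and all quadratic forms on which the finite degree
  argument rests. It is applied to T-forms when the stable class is extended, and to all forms when
  the last map is shown to be surjective.\<close>

definition form_class :: "('a, 'r) ring_scheme \<Rightarrow> ('a pobj \<Rightarrow> 'a qform set) \<Rightarrow> bool" where
  "form_class R S \<longleftrightarrow>
     (\<forall>V. module R V \<longrightarrow> S V \<subseteq> quad_forms R V) \<and>
     (\<forall>V. module R V \<longrightarrow> (\<forall>q\<in>S V. \<forall>p\<in>S V. form_add R V q p \<in> S V)) \<and>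
     (\<forall>V W. module R V \<longrightarrow> module R W \<longrightarrow>
        (\<forall>f\<in>lin_maps R V W. \<forall>q\<in>S W. pullback_form V f q \<in> S V))"

context half_cring
begin

lemma form_class_T: "form_class R (T_forms R)"
  unfolding form_class_def using T_subset_quad T_forms_add T_forms_pullback by blast

lemma form_class_quad: "form_class R (quad_forms R)"
  unfolding form_class_def using quad_forms_add quad_forms_pullback by blast

lemma quad_forms_zero:
  assumes V: "module R V" and q: "q \<in> quad_forms R V"
  shows "q \<zero>\<^bsub>V\<^esub> = \<zero>"
proof -
  interpret module R V by fact
  have "\<forall>a\<in>carrier R. \<forall>v\<in>carrier V. q (a \<odot>\<^bsub>V\<^esub> v) = (a \<otimes> a) \<otimes> q v"
    using q by (simp add: quad_forms_def)
  then have "q (\<zero> \<odot>\<^bsub>V\<^esub> \<zero>\<^bsub>V\<^esub>) = (\<zero> \<otimes> \<zero>) \<otimes> q \<zero>\<^bsub>V\<^esub>"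
    by blast
  then show ?thesis
    using quad_forms_closed[OF q, of "\<zero>\<^bsub>V\<^esub>"] by simp
qed

lemma quad_forms_ext: "q \<in> quad_forms R V \<Longrightarrow> v \<notin> carrier V \<Longrightarrow> q v = undefined"
  by (auto simp: quad_forms_def)

lemma form_add_mult_zero:
  assumes "q \<in> quad_forms R V"
  shows "form_add R V q (form_mult R V 0 p) = q"
proof
  fix v show "form_add R V q (form_mult R V 0 p) v = q v"
    using quad_forms_closed[OF assms] quad_forms_ext[OF assms]
    by (cases "v \<in> carrier V") (simp_all add: form_add_def form_mult_def)
qed

lemma form_add_mult_commute:
  assumes "q \<in> quad_forms R V" "p \<in> quad_forms R V" "p' \<in> quad_forms R V"
  shows "form_add R V (form_add R V q (form_mult R V a p)) (form_mult R V b p')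
    = form_add R V (form_add R V q (form_mult R V b p')) (form_mult R V a p)"
  unfolding form_add_def form_mult_def
  by (rule restrict_ext) (use assms quad_forms_closed in \<open>simp add: a_ac\<close>)

lemma pullback_form_add_mult:
  assumes "f \<in> lin_maps R V W"
  shows "pullback_form V f (form_add R W q (form_mult R W k p))
    = form_add R V (pullback_form V f q) (form_mult R V k (pullback_form V f p))"
  unfolding pullback_form_def form_add_def form_mult_def
  by (rule restrict_ext) (use lin_mapsD(1)[OF assms] in simp)

lemma pullback_form_add:
  assumes "f \<in> lin_maps R V W"
  shows "pullback_form V f (form_add R W q p) = form_add R V (pullback_form V f q) (pullback_form V f p)"
  unfolding pullback_form_def form_add_def
  by (rule restrict_ext) (use lin_mapsD(1)[OF assms] in simp)

text \<open>q + k p = (q + p) + (k - 1) p. The terms of \<open>form_ext\<close> have k = card I with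
  I nonempty, so all of them are T-forms although \<open>q\<close> need not be one.\<close>

lemma T_forms_shift:
  assumes V: "module R V" and q: "q \<in> quad_forms R V" and p: "p \<in> T_forms R V"
    and qp: "form_add R V q p \<in> T_forms R V" and k: "k > 0"
  shows "form_add R V q (form_mult R V k p) \<in> T_forms R V"
proof -
  obtain j where j: "k = Suc j"
    using k by (cases k) auto
  have "form_add R V q (form_mult R V k p) = form_add R V (form_add R V q p) (form_mult R V j p)"
    unfolding form_add_def form_mult_def j
    by (rule restrict_ext)
      (use quad_forms_closed[OF q] T_forms_closed[OF V p] in \<open>simp add: a_ac\<close>)
  then show ?thesis
    using T_forms_add[OF V qp T_forms_mult[OF V p]] by simp
qed

text \<open>Q is the orthogonal sum of \<open>q\<close> on the base block and \<open>p\<close> on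
  each of the r other blocks. Restricted to a diagonal that fills the base and the blocks in
  \<open>I\<close>, it becomes q plus one p for each element of \<open>I\<close>.\<close>

lemma diag_form:
  assumes S: "form_class R S" and q: "q \<in> S (free_mod R m)" and p: "p \<in> S (free_mod R m)"
  shows "\<exists>Q\<in>S (free_mod R (m * Suc r)). \<forall>I\<subseteq>{..<r}.
    pullback_form (free_mod R m) (diag_map R m (Suc r) (insert r I)) Q
      = form_add R (free_mod R m) q (form_mult R (free_mod R m) (card I) p)"
proof -
  let ?V = "free_mod R m" and ?W = "free_mod R (m * Suc r)"
  note V = free_mod_module[of m] and W = free_mod_module[of "m * Suc r"]
  have add: "form_add R ?W q p \<in> S ?W" if "q \<in> S ?W" "p \<in> S ?W" for q p
    using S that W unfolding form_class_def by blast
  have pull: "pullback_form ?W (block R m (Suc r) e) q \<in> S ?W" if "q \<in> S ?V" for q e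
    using S that V W block_lin[of m "Suc r" e] unfolding form_class_def by blast
  have pq: "p \<in> quad_forms R ?V" and qq: "q \<in> quad_forms R ?V"
    using S p q V unfolding form_class_def by blast+
  note pc = quad_forms_closed[OF pq] and qc = quad_forms_closed[OF qq]
  have bc: "block R m (Suc r) e w \<in> carrier ?V" if "w \<in> carrier ?W" for e w
    by (rule lin_mapsD(1)[OF block_lin that])
  have "\<exists>Q\<in>S ?W. \<forall>w\<in>carrier ?W. Q w = q (block R m (Suc r) r w) \<oplus> (\<Oplus>e\<in>{..<k}. p (block R m (Suc r) e w))" for k
  proof (induction k)
    case 0
    then show ?case
      using pull[OF q, of r] qc bc by (intro bexI[OF _ pull[OF q, of r]]) (simp add: pullback_form_def)
  next
    case (Suc k)
    then obtain Q where Q: "Q \<in> S ?W"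
      "\<forall>w\<in>carrier ?W. Q w = q (block R m (Suc r) r w) \<oplus> (\<Oplus>e\<in>{..<k}. p (block R m (Suc r) e w))"
      by blast
    let ?Q = "form_add R ?W Q (pullback_form ?W (block R m (Suc r) k) p)"
    have "?Q w = q (block R m (Suc r) r w) \<oplus> (\<Oplus>e\<in>{..<Suc k}. p (block R m (Suc r) e w))"
      if w: "w \<in> carrier ?W" for w
    proof -
      have "(\<Oplus>e\<in>{..<Suc k}. p (block R m (Suc r) e w))
        = p (block R m (Suc r) k w) \<oplus> (\<Oplus>e\<in>{..<k}. p (block R m (Suc r) e w))"
        unfolding lessThan_Suc by (rule finsum_insert) (use pc bc[OF w] in auto)
      moreover have "(\<Oplus>e\<in>{..<k}. p (block R m (Suc r) e w)) \<in> carrier R"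
        by (rule finsum_closed) (use pc bc[OF w] in auto)
      ultimately show ?thesis
        using w Q(2) pc[OF bc[OF w]] qc[OF bc[OF w]] by (simp add: form_add_def pullback_form_def a_ac)
    qed
    then show ?case
      using add[OF Q(1) pull[OF p]] by blast
  qed
  then obtain Q where Q: "Q \<in> S ?W"
    "\<And>w. w \<in> carrier ?W \<Longrightarrow> Q w = q (block R m (Suc r) r w) \<oplus> (\<Oplus>e\<in>{..<r}. p (block R m (Suc r) e w))"
    by blast
  have "pullback_form ?V (diag_map R m (Suc r) (insert r I)) Q = form_add R ?V q (form_mult R ?V (card I) p)"
    if I: "I \<subseteq> {..<r}" for I
    unfolding pullback_form_def form_add_def
  proof (rule restrict_ext)
    fix v assume v: "v \<in> carrier ?V"
    let ?d = "diag_map R m (Suc r) (insert r I) v"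
    have d: "?d \<in> carrier ?W"
      by (rule lin_mapsD(1)[OF diag_map_lin v])
    have fin: "finite I"
      using I finite_subset by blast
    have b: "block R m (Suc r) e ?d = (if e \<in> insert r I then v else (\<lambda>i. \<zero>))" if "e \<le> r" for e
      using block_diag_map[OF v, of e "Suc r"] that by simp
    have "(\<Oplus>e\<in>{..<r}. p (block R m (Suc r) e ?d)) = (\<Oplus>e\<in>I. p v)"
    proof (rule add.finprod_mono_neutral_cong_right)
      fix e assume "e \<in> {..<r} - I"
      then show "p (block R m (Suc r) e ?d) = \<zero>"
        using b[of e] quad_forms_zero[OF V pq] by simp
    next
      fix e assume "e \<in> I"
      then show "p (block R m (Suc r) e ?d) = p v"
        using b[of e] I by auto
    qed (use I pc bc[OF d] in auto)
    also have "\<dots> = [(card I)] \<cdot> p v"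
      using add.finprod_const[OF pc[OF v], of I] by simp
    finally show "Q ?d = q v \<oplus> form_mult R ?V (card I) p v"
      using Q(2)[OF d] b[of r] v by (simp add: form_mult_def)
  qed
  then show ?thesis using Q(1) by blast
qed

end

text \<open>A natural family \<open>K q x\<close> is polynomial in \<open>q\<close> when \<open>x\<close> has finite degree: the alternating
  product of \<open>K (q + |I| p) x\<close> over all \<open>I\<close> is trivial. Solved for the term with \<open>I\<close> empty, this
  extends \<open>K\<close> to forms \<open>q\<close> outside its domain for which \<open>q + p\<close> lies in it.\<close>

definition form_ext ::
  "('a, 'r) ring_scheme \<Rightarrow> 'h monoid \<Rightarrow> (nat \<Rightarrow> 'a qform \<Rightarrow> 'g \<Rightarrow> 'h) \<Rightarrow> nat \<Rightarrow> nat \<Rightarrow> 'a qform \<Rightarrow> 'a qform \<Rightarrow> 'g \<Rightarrow> 'h"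
where
  "form_ext R H K m r p q x = finprod H
     (\<lambda>I. K m (form_add R (free_mod R m) q (form_mult R (free_mod R m) (card I) p)) x
        [^]\<^bsub>H\<^esub> (- ((-1) ^ card I) :: int)) (Pow {..<r} - {{}})"

lemma (in comm_group) int_pow_hom: "(\<lambda>x. x [^] (k::int)) \<in> hom G G"
  by (rule homI) (simp_all add: int_pow_distrib)

text \<open>With Q from \<open>diag_form\<close>, naturality turns K(q + card I p) x into the value
  of the single homomorphism K(Q) at the vertex \<open>I\<close> of the cube of \<open>x\<close>.
  The alternating product of the vertices is trivial, hence so is that of the values, and it is
  solved for the term with \<open>I\<close> empty.\<close>

lemma (in functor_over_half_cring) form_ext_eq:
  assumes H: "comm_group H" and S: "form_class R S"
    and hom: "\<And>n Q. Q \<in> S (free_mod R n) \<Longrightarrow> K n Q \<in> hom (fob F (free_mod R n)) H"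
    and nat: "\<And>n f Q x. f \<in> lin_maps R (free_mod R m) (free_mod R n) \<Longrightarrow> Q \<in> S (free_mod R n) \<Longrightarrow>
      x \<in> carrier (fob F (free_mod R m)) \<Longrightarrow>
      K m (pullback_form (free_mod R m) f Q) x = K n Q (far F (free_mod R m) (free_mod R n) f x)"
    and q: "q \<in> S (free_mod R m)" and p: "p \<in> S (free_mod R m)"
    and x: "x \<in> carrier (fob F (free_mod R m))" and fd: "finite_degree R F m r x"
  shows "form_ext R H K m r p q x = K m q x"
proof -
  let ?V = "free_mod R m" and ?W = "free_mod R (m * Suc r)"
  let ?d = "\<lambda>I. diag_map R m (Suc r) (insert r I)"
  interpret H: comm_group H by fact
  interpret W: comm_group "fob F ?W" by (rule F_group[OF free_mod_Ob])
  obtain Q where Q: "Q \<in> S ?W" "\<And>I. I \<subseteq> {..<r} \<Longrightarrow>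
      pullback_form ?V (?d I) Q = form_add R ?V q (form_mult R ?V (card I) p)"
    using diag_form[OF S q p] by blast
  define k where "k I = K m (form_add R ?V q (form_mult R ?V (card I) p)) x" for I :: "nat set"
  have k: "k I = K (m * Suc r) Q (far F ?V ?W (?d I) x)" if "I \<subseteq> {..<r}" for I
    unfolding k_def Q(2)[OF that, symmetric] by (rule nat[OF diag_map_lin Q(1) x])
  have sc: "far F ?V ?W (?d I) x \<in> carrier (fob F ?W)" for I
    by (rule F_closed[OF free_mod_Ob free_mod_Ob diag_map_lin x])
  have kc: "k I \<in> carrier H" if "I \<subseteq> {..<r}" for I
    unfolding k[OF that] by (rule hom_in_carrier[OF hom[OF Q(1)] sc])
  have "sprod H {..<r} k = sprod H {..<r} (\<lambda>I. K (m * Suc r) Q (far F ?V ?W (?d I) x))"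
    by (rule H.sprod_cong) (use k kc in auto)
  also have "\<dots> = K (m * Suc r) Q (sprod (fob F ?W) {..<r} (\<lambda>I. far F ?V ?W (?d I) x))"
    by (rule W.sprod_hom[OF H hom[OF Q(1)] sc, symmetric])
  also have "\<dots> = \<one>\<^bsub>H\<^esub>"
    using fd hom_one[OF hom[OF Q(1)] W.group_axioms H.group_axioms] by (simp add: finite_degree_def)
  finally have "k {} \<otimes>\<^bsub>H\<^esub> finprod H (\<lambda>I. k I [^]\<^bsub>H\<^esub> ((-1) ^ card I :: int)) (Pow {..<r} - {{}}) = \<one>\<^bsub>H\<^esub>"
    using H.sprod_remove_empty[of "{..<r}" k] kc by simp
  moreover have c: "finprod H (\<lambda>I. k I [^]\<^bsub>H\<^esub> ((-1) ^ card I :: int)) (Pow {..<r} - {{}}) \<in> carrier H"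
    by (rule H.finprod_closed) (use kc in auto)
  ultimately have "k {} = inv\<^bsub>H\<^esub> finprod H (\<lambda>I. k I [^]\<^bsub>H\<^esub> ((-1) ^ card I :: int)) (Pow {..<r} - {{}})"
    using kc[of "{}"] by (metis H.inv_equality H.inv_inv H.inv_closed empty_subsetI)
  also have "\<dots> = finprod H (\<lambda>I. inv\<^bsub>H\<^esub> (k I [^]\<^bsub>H\<^esub> ((-1) ^ card I :: int))) (Pow {..<r} - {{}})"
    by (rule H.finprod_hom[OF H H.inv_hom_self]) (use kc in auto)
  also have "\<dots> = finprod H (\<lambda>I. k I [^]\<^bsub>H\<^esub> (- ((-1) ^ card I) :: int)) (Pow {..<r} - {{}})"
    by (rule H.finprod_cong') (use kc in \<open>auto simp: H.int_pow_neg\<close>)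
  also have "\<dots> = form_ext R H K m r p q x"
    by (simp add: form_ext_def k_def)
  finally show ?thesis
    using Q(2)[of "{}"] S q form_add_mult_zero[of q ?V p] free_mod_module
    by (simp add: k_def form_class_def subset_iff)
qed


section \<open>Extension of the stable class from T-forms to all quadratic forms on free
  modules\<close>

context euclidean_invariant
begin

text \<open>A form has many representations by linear maps; \<open>cancellation\<close> makes the
  choice immaterial, as recorded in \<open>tval_eq\<close>.\<close>

definition tval :: "'a pobj \<Rightarrow> 'a qform \<Rightarrow> 'g \<Rightarrow> 'h" where
  "tval V t x = (SOME z. \<exists>n. \<exists>M\<in>lin_maps R V (free_mod R n).
     (\<forall>v\<in>carrier V. t v = ip R n (M v) (M v)) \<and> z = c n (far F V (free_mod R n) M x))"

lemma tval_eq: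
  assumes V: "V \<in> Ob (proj_cat R)" and M: "M \<in> lin_maps R V (free_mod R n)"
    and t: "\<And>v. v \<in> carrier V \<Longrightarrow> t v = ip R n (M v) (M v)" and x: "x \<in> carrier (fob F V)"
  shows "tval V t x = c n (far F V (free_mod R n) M x)"
  unfolding tval_def
proof (rule some_equality)
  show "\<exists>n'. \<exists>M'\<in>lin_maps R V (free_mod R n'). (\<forall>v\<in>carrier V. t v = ip R n' (M' v) (M' v)) \<and>
      c n (far F V (free_mod R n) M x) = c n' (far F V (free_mod R n') M' x)"
    using M t by blast
  fix z assume "\<exists>n'. \<exists>M'\<in>lin_maps R V (free_mod R n'). (\<forall>v\<in>carrier V. t v = ip R n' (M' v) (M' v)) \<and>
      z = c n' (far F V (free_mod R n') M' x)"
  then obtain n' M' where M': "M' \<in> lin_maps R V (free_mod R n')" "\<forall>v\<in>carrier V. t v = ip R n' (M' v) (M' v)"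
    "z = c n' (far F V (free_mod R n') M' x)"
    by blast
  show "z = c n (far F V (free_mod R n) M x)"
    unfolding M'(3) by (rule cancellation[OF V M'(1) M _ x]) (use M'(2) t in simp)
qed

lemma tval_hom:
  assumes V: "V \<in> Ob (proj_cat R)" and t: "t \<in> T_forms R V"
  shows "tval V t \<in> hom (fob F V) G"
proof -
  obtain n M where M: "M \<in> lin_maps R V (free_mod R n)" "\<And>v. v \<in> carrier V \<Longrightarrow> t v = ip R n (M v) (M v)"
    using T_formsE[OF Ob_proj_cat_module[OF V] t] by metis
  have h: "(\<lambda>x. c n (far F V (free_mod R n) M x)) \<in> hom (fob F V) G"
    using hom_compose[OF F_hom[OF V free_mod_Ob M(1)] c_hom] by (simp add: comp_def)
  show ?thesis
    using h tval_eq[OF V M] by (simp add: hom_def Pi_def comm_groupE(1)[OF F_group[OF V]])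
qed

lemma tval_natural:
  assumes V: "V \<in> Ob (proj_cat R)" and W: "W \<in> Ob (proj_cat R)" and f: "f \<in> lin_maps R V W"
    and t: "t \<in> T_forms R W" and x: "x \<in> carrier (fob F V)"
  shows "tval V (pullback_form V f t) x = tval W t (far F V W f x)"
proof -
  obtain n M where M: "M \<in> lin_maps R W (free_mod R n)" "\<And>v. v \<in> carrier W \<Longrightarrow> t v = ip R n (M v) (M v)"
    using T_formsE[OF Ob_proj_cat_module[OF W] t] by metis
  let ?N = "\<lambda>v\<in>carrier V. M (f v)"
  have N: "?N \<in> lin_maps R V (free_mod R n)"
    by (rule lin_maps_restrict_comp[OF f M(1) Ob_proj_cat_module[OF V]])
  have "tval V (pullback_form V f t) x = c n (far F V (free_mod R n) ?N x)"
    by (rule tval_eq[OF V N _ x]) (simp add: pullback_form_def M(2) lin_mapsD(1)[OF f])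
  also have "far F V (free_mod R n) ?N x = far F W (free_mod R n) M (far F V W f x)"
    by (rule F_comp[OF V W free_mod_Ob f M(1) x N, symmetric]) simp
  also have "c n \<dots> = tval W t (far F V W f x)"
    by (rule tval_eq[OF W M F_closed[OF V W f x], symmetric])
  finally show ?thesis .
qed

abbreviation (input) tval_ext :: "nat \<Rightarrow> nat \<Rightarrow> 'a qform \<Rightarrow> 'a qform \<Rightarrow> 'g \<Rightarrow> 'h" where
  "tval_ext \<equiv> form_ext R G (\<lambda>m. tval (free_mod R m))"

lemma tval_ext_eq:
  assumes "q \<in> T_forms R (free_mod R m)" "p \<in> T_forms R (free_mod R m)"
    "x \<in> carrier (fob F (free_mod R m))" "finite_degree R F m r x"
  shows "tval_ext m r p q x = tval (free_mod R m) q x"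
  by (rule form_ext_eq[OF G form_class_T tval_hom[OF free_mod_Ob] tval_natural[OF free_mod_Ob free_mod_Ob] assms])

lemma shifted_closed:
  assumes q: "q \<in> quad_forms R (free_mod R m)" and p: "p \<in> T_forms R (free_mod R m)"
    and qp: "form_add R (free_mod R m) q p \<in> T_forms R (free_mod R m)"
    and x: "x \<in> carrier (fob F (free_mod R m))" and I: "I \<in> Pow {..<r::nat} - {{}}"
  shows "form_add R (free_mod R m) q (form_mult R (free_mod R m) (card I) p) \<in> T_forms R (free_mod R m)"
    and "tval (free_mod R m) (form_add R (free_mod R m) q (form_mult R (free_mod R m) (card I) p)) x \<in> carrier G"
proof -
  have "card I > 0"
    using I finite_subset[of I "{..<r}"] by (auto simp: card_gt_0_iff)
  then show T: "form_add R (free_mod R m) q (form_mult R (free_mod R m) (card I) p) \<in> T_forms R (free_mod R m)"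
    by (rule T_forms_shift[OF free_mod_module q p qp])
  show "tval (free_mod R m) (form_add R (free_mod R m) q (form_mult R (free_mod R m) (card I) p)) x \<in> carrier G"
    by (rule hom_in_carrier[OF tval_hom[OF free_mod_Ob T] x])
qed

text \<open>Each shifted form q + i p is a T-form, so its value may be expanded with the shift p',
  and conversely. Both extensions become the same double product over nonempty I and J of the values
  at q + i p + j p', taken in two orders.\<close>

lemma tval_ext_unique:
  assumes q: "q \<in> quad_forms R (free_mod R m)" and x: "x \<in> carrier (fob F (free_mod R m))"
    and p: "p \<in> T_forms R (free_mod R m)" "form_add R (free_mod R m) q p \<in> T_forms R (free_mod R m)"
    and r: "finite_degree R F m r x"
    and p': "p' \<in> T_forms R (free_mod R m)" "form_add R (free_mod R m) q p' \<in> T_forms R (free_mod R m)"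
    and r': "finite_degree R F m r' x"
  shows "tval_ext m r p q x = tval_ext m r' p' q x"
proof -
  interpret G: comm_group G by (rule G)
  let ?V = "free_mod R m"
  note V = free_mod_module[of m]
  have quad: "t \<in> quad_forms R ?V" if "t \<in> T_forms R ?V" for t
    using T_subset_quad[OF V] that by blast
  define g where "g I J = tval ?V (form_add R ?V (form_add R ?V q (form_mult R ?V (card I) p))
      (form_mult R ?V (card J) p')) x" for I J :: "nat set"
  have g': "g I J = tval ?V (form_add R ?V (form_add R ?V q (form_mult R ?V (card J) p'))
      (form_mult R ?V (card I) p)) x" for I J
    unfolding g_def by (simp add: form_add_mult_commute[OF q quad[OF p(1)] quad[OF p'(1)]])
  let ?P = "Pow {..<r} - {{}}" and ?P' = "Pow {..<r'} - {{}}"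
  have gc: "g I J \<in> carrier G" if "I \<in> ?P" for I J
    unfolding g_def
    by (rule hom_in_carrier[OF tval_hom[OF free_mod_Ob] x],
        rule T_forms_add[OF V shifted_closed(1)[OF q p x that] T_forms_mult[OF V p'(1)]])
  let ?s = "\<lambda>I. - ((-1) ^ card (I :: nat set)) :: int"
  have pow_finprod: "finprod G f A [^]\<^bsub>G\<^esub> (k::int) = finprod G (\<lambda>a. f a [^]\<^bsub>G\<^esub> k) A"
    if "f \<in> A \<rightarrow> carrier G" for f :: "nat set \<Rightarrow> 'h" and A k
    by (rule G.finprod_hom[OF G G.int_pow_hom that])
  have "tval_ext m r p q x = finprod G (\<lambda>I. finprod G (\<lambda>J. (g I J [^]\<^bsub>G\<^esub> ?s J) [^]\<^bsub>G\<^esub> ?s I) ?P') ?P"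
    unfolding form_ext_def
  proof (rule G.finprod_cong')
    fix I assume I: "I \<in> ?P"
    let ?qI = "form_add R ?V q (form_mult R ?V (card I) p)"
    have "tval ?V ?qI x = tval_ext m r' p' ?qI x"
      by (rule tval_ext_eq[OF shifted_closed(1)[OF q p x I] p'(1) x r', symmetric])
    also have "\<dots> = finprod G (\<lambda>J. g I J [^]\<^bsub>G\<^esub> ?s J) ?P'"
      by (simp add: form_ext_def g_def)
    finally show "tval ?V ?qI x [^]\<^bsub>G\<^esub> ?s I = finprod G (\<lambda>J. (g I J [^]\<^bsub>G\<^esub> ?s J) [^]\<^bsub>G\<^esub> ?s I) ?P'"
      using pow_finprod[of "\<lambda>J. g I J [^]\<^bsub>G\<^esub> ?s J" ?P' "?s I"] gc[OF I] by (simp add: Pi_def)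
  qed (use gc in \<open>auto intro!: G.finprod_closed G.int_pow_closed\<close>)
  also have "\<dots> = finprod G (\<lambda>J. finprod G (\<lambda>I. (g I J [^]\<^bsub>G\<^esub> ?s J) [^]\<^bsub>G\<^esub> ?s I) ?P) ?P'"
    by (rule G.finprod_swap) (use gc in auto)
  also have "\<dots> = tval_ext m r' p' q x"
    unfolding form_ext_def
  proof (rule G.finprod_cong')
    fix J assume J: "J \<in> ?P'"
    let ?qJ = "form_add R ?V q (form_mult R ?V (card J) p')"
    have "tval ?V ?qJ x = tval_ext m r p ?qJ x"
      by (rule tval_ext_eq[OF shifted_closed(1)[OF q p' x J] p(1) x r, symmetric])
    also have "\<dots> = finprod G (\<lambda>I. g I J [^]\<^bsub>G\<^esub> ?s I) ?P"
      by (simp add: form_ext_def g')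
    finally have "tval ?V ?qJ x [^]\<^bsub>G\<^esub> ?s J = finprod G (\<lambda>I. (g I J [^]\<^bsub>G\<^esub> ?s I) [^]\<^bsub>G\<^esub> ?s J) ?P"
      using pow_finprod[of "\<lambda>I. g I J [^]\<^bsub>G\<^esub> ?s I" ?P "?s J"] gc by (simp add: Pi_def)
    also have "\<dots> = finprod G (\<lambda>I. (g I J [^]\<^bsub>G\<^esub> ?s J) [^]\<^bsub>G\<^esub> ?s I) ?P"
      by (rule G.finprod_cong') (use gc in \<open>auto simp: G.int_pow_pow mult.commute\<close>)
    finally show "finprod G (\<lambda>I. (g I J [^]\<^bsub>G\<^esub> ?s J) [^]\<^bsub>G\<^esub> ?s I) ?P = tval ?V ?qJ x [^]\<^bsub>G\<^esub> ?s J"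
      by simp
  qed (use shifted_closed(2)[OF q p' x] in auto)
  finally show ?thesis .
qed

text \<open>The admissible shift \<open>p\<close> depends on \<open>q\<close> and the degree
  \<open>r\<close> on \<open>x\<close>, so neither can be fixed in advance; by
  \<open>tval_ext_unique\<close> the value depends on neither. A shift exists by
  \<open>quad_form_difference\<close>.\<close>

definition lam :: "nat \<Rightarrow> 'a qform \<Rightarrow> 'g \<Rightarrow> 'h" where
  "lam m q x = (SOME z. \<exists>r p. finite_degree R F m r x \<and> p \<in> T_forms R (free_mod R m) \<and>
     form_add R (free_mod R m) q p \<in> T_forms R (free_mod R m) \<and> z = tval_ext m r p q x)"

lemma lam_eq:
  assumes q: "q \<in> quad_forms R (free_mod R m)" and x: "x \<in> carrier (fob F (free_mod R m))"
    and p: "p \<in> T_forms R (free_mod R m)" "form_add R (free_mod R m) q p \<in> T_forms R (free_mod R m)"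
    and r: "finite_degree R F m r x"
  shows "lam m q x = tval_ext m r p q x"
  unfolding lam_def
  by (rule some_equality) (use tval_ext_unique[OF q x _ _ _ p r] p r in blast)+

text \<open>For a T-form the shift p = q is admissible, and on T-forms the extension formula
  reproduces the given values.\<close>

lemma lam_T:
  assumes q: "q \<in> T_forms R (free_mod R m)" and x: "x \<in> carrier (fob F (free_mod R m))"
  shows "lam m q x = tval (free_mod R m) q x"
proof -
  obtain r where r: "finite_degree R F m r x"
    using finite_degree[OF x] by blast
  have "q \<in> quad_forms R (free_mod R m)"
    using q T_subset_quad[OF free_mod_module] by blast
  then show ?thesis
    using lam_eq[OF _ x q T_forms_add[OF free_mod_module q q] r] tval_ext_eq[OF q q x r] by simp
qed

lemma lam_hom:
  assumes q: "q \<in> quad_forms R (free_mod R m)"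
  shows "lam m q \<in> hom (fob F (free_mod R m)) G"
proof -
  let ?V = "free_mod R m"
  interpret G: comm_group G by (rule G)
  interpret V: comm_group "fob F ?V" by (rule F_group[OF free_mod_Ob])
  obtain p where p: "p \<in> T_forms R ?V" "form_add R ?V q p \<in> T_forms R ?V"
    using quad_form_difference[OF q] by blast
  have cl: "tval_ext m r p q x \<in> carrier G" if "x \<in> carrier (fob F ?V)" for r x
    unfolding form_ext_def
    by (rule G.finprod_closed) (use shifted_closed(2)[OF q p that] in auto)
  show ?thesis
  proof (rule homI)
    fix x assume x: "x \<in> carrier (fob F ?V)"
    obtain r where "finite_degree R F m r x"
      using finite_degree[OF x] by blast
    then show "lam m q x \<in> carrier G"
      using lam_eq[OF q x p] cl[OF x] by simp
  next
    fix x y assume x: "x \<in> carrier (fob F ?V)" and y: "y \<in> carrier (fob F ?V)"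
    have xy: "x \<otimes>\<^bsub>fob F ?V\<^esub> y \<in> carrier (fob F ?V)"
      using x y by simp
    obtain r1 r2 r3 where r: "finite_degree R F m r1 x" "finite_degree R F m r2 y"
      "finite_degree R F m r3 (x \<otimes>\<^bsub>fob F ?V\<^esub> y)"
      using finite_degree x y xy by meson
    \<comment> \<open>The three values of \<open>lam\<close> have to be computed from one formula,
      hence with one degree.\<close>
    define r where "r = max r1 (max r2 r3)"
    have fx: "finite_degree R F m r x" and fy: "finite_degree R F m r y"
      and fxy: "finite_degree R F m r (x \<otimes>\<^bsub>fob F ?V\<^esub> y)"
      using finite_degree_mono[OF x r(1)] finite_degree_mono[OF y r(2)] finite_degree_mono[OF xy r(3)]
      by (simp_all add: r_def)
    let ?P = "Pow {..<r} - {{}}"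
    let ?t = "\<lambda>I. tval ?V (form_add R ?V q (form_mult R ?V (card I) p))"
    let ?s = "\<lambda>I. - ((-1) ^ card (I :: nat set)) :: int"
    note c = shifted_closed(2)[OF q p]
    have "tval_ext m r p q (x \<otimes>\<^bsub>fob F ?V\<^esub> y)
      = finprod G (\<lambda>I. ?t I x [^]\<^bsub>G\<^esub> ?s I \<otimes>\<^bsub>G\<^esub> ?t I y [^]\<^bsub>G\<^esub> ?s I) ?P"
      unfolding form_ext_def
    proof (rule G.finprod_cong')
      fix I assume I: "I \<in> ?P"
      have "?t I (x \<otimes>\<^bsub>fob F ?V\<^esub> y) = ?t I x \<otimes>\<^bsub>G\<^esub> ?t I y"
        by (rule hom_mult[OF tval_hom[OF free_mod_Ob shifted_closed(1)[OF q p x I]] x y])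
      then show "?t I (x \<otimes>\<^bsub>fob F ?V\<^esub> y) [^]\<^bsub>G\<^esub> ?s I = ?t I x [^]\<^bsub>G\<^esub> ?s I \<otimes>\<^bsub>G\<^esub> ?t I y [^]\<^bsub>G\<^esub> ?s I"
        using c[OF x I] c[OF y I] by (simp add: G.int_pow_distrib)
    qed (rule refl, (rule Pi_I; rule G.m_closed; rule G.int_pow_closed; rule c[OF x] c[OF y]; assumption))
    also have "\<dots> = tval_ext m r p q x \<otimes>\<^bsub>G\<^esub> tval_ext m r p q y"
      unfolding form_ext_def by (rule G.finprod_multf; rule Pi_I; rule G.int_pow_closed; rule c[OF x] c[OF y]; assumption)
    finally show "lam m q (x \<otimes>\<^bsub>fob F ?V\<^esub> y) = lam m q x \<otimes>\<^bsub>G\<^esub> lam m q y"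
      using lam_eq[OF q x p fx] lam_eq[OF q y p fy] lam_eq[OF q xy p fxy] by simp
  qed
qed

lemma lam_natural:
  assumes f: "f \<in> lin_maps R (free_mod R m) (free_mod R n)" and q: "q \<in> quad_forms R (free_mod R n)"
    and x: "x \<in> carrier (fob F (free_mod R m))"
  shows "lam m (pullback_form (free_mod R m) f q) x = lam n q (far F (free_mod R m) (free_mod R n) f x)"
proof -
  let ?V = "free_mod R m" and ?W = "free_mod R n"
  note V = free_mod_module[of m] and W = free_mod_module[of n]
  interpret G: comm_group G by (rule G)
  let ?y = "far F ?V ?W f x"
  have y: "?y \<in> carrier (fob F ?W)"
    by (rule F_closed[OF free_mod_Ob free_mod_Ob f x])
  obtain r1 r2 where r: "finite_degree R F m r1 x" "finite_degree R F n r2 ?y"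
    using finite_degree x y by meson
  define r where "r = max r1 r2"
  have fx: "finite_degree R F m r x" and fy: "finite_degree R F n r ?y"
    using finite_degree_mono[OF x r(1)] finite_degree_mono[OF y r(2)] by (simp_all add: r_def)
  obtain p where p: "p \<in> T_forms R ?W" "form_add R ?W q p \<in> T_forms R ?W"
    using quad_form_difference[OF q] by blast
  \<comment> \<open>A shift admissible for \<open>q\<close> pulls back to one admissible for the
    pullback of \<open>q\<close>, so both sides are compared term by term.\<close>
  have pb: "pullback_form ?V f p \<in> T_forms R ?V"
    "form_add R ?V (pullback_form ?V f q) (pullback_form ?V f p) \<in> T_forms R ?V"
    using T_forms_pullback[OF V W f p(1)] T_forms_pullback[OF V W f p(2)]
    by (simp_all add: pullback_form_add[OF f])
  have "tval_ext m r (pullback_form ?V f p) (pullback_form ?V f q) x = tval_ext n r p q ?y"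
    unfolding form_ext_def
  proof (rule G.finprod_cong')
    fix I assume I: "I \<in> Pow {..<r} - {{}}"
    have "tval ?V (form_add R ?V (pullback_form ?V f q) (form_mult R ?V (card I) (pullback_form ?V f p))) x
      = tval ?W (form_add R ?W q (form_mult R ?W (card I) p)) ?y"
      unfolding pullback_form_add_mult[OF f, symmetric]
      by (rule tval_natural[OF free_mod_Ob free_mod_Ob f shifted_closed(1)[OF q p y I] x])
    then show "tval ?V (form_add R ?V (pullback_form ?V f q) (form_mult R ?V (card I) (pullback_form ?V f p))) x
        [^]\<^bsub>G\<^esub> (- ((-1) ^ card I) :: int)
      = tval ?W (form_add R ?W q (form_mult R ?W (card I) p)) ?y [^]\<^bsub>G\<^esub> (- ((-1) ^ card I) :: int)"
      by simp
  qed (use shifted_closed(2)[OF q p y] in auto)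
  then show ?thesis
    using lam_eq[OF quad_forms_pullback[OF V W f q] x pb fx] lam_eq[OF q y p fy] by simp
qed

end


section \<open>The coinvariant system\<close>

lemma precomp_id [simp]: "precomp id id F = F"
  by (simp add: precomp_def)

lemma pi_star_simps [simp]:
  "fob (pi_star F) X = fob F (fst X)" "far (pi_star F) X Y f = far F (fst X) (fst Y) f"
  by (simp_all add: precomp_def)

context half_cring
begin

text \<open>The extension is g on A^m and the identity on the remaining n - m coordinates. It makes
  the transition maps between coinvariants well defined.\<close>

lemma orth_extend:
  assumes mn: "m \<le> n" and g: "g \<in> orth R m"
  obtains g' where "g' \<in> orth R n" "\<And>v. v \<in> carrier (free_mod R m) \<Longrightarrow> g' v = g v"
proof -
  define k where "k = n - m"
  have n: "n = m + k"
    using mn by (simp add: k_def)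
  let ?V = "free_mod R m" and ?W = "free_mod R k" and ?U = "free_mod R (m + k)"
  have gl: "g \<in> lin_maps R ?V ?V" and gb: "bij_betw g (carrier ?V) (carrier ?V)"
    and ge: "pullback_form ?V g (eps R m) = eps R m"
    using g by (auto simp: orth_def)
  note gD = lin_mapsD[OF gl]
  define H where "H = (\<lambda>w\<in>carrier ?U. \<lambda>i. if i < m then w i else \<zero>)"
  define K where "K = (\<lambda>w\<in>carrier ?U. \<lambda>i. w (m + i))"
  have Hl: "H \<in> lin_maps R ?U ?V" and Kl: "K \<in> lin_maps R ?U ?W"
    unfolding H_def K_def
    by (rule lin_mapsI[OF free_mod_module]; auto simp: free_mod_iff fun_eq_iff)+
  have cat: "vcat m (H w) (K w) = w" if "w \<in> carrier ?U" for w
    using that by (auto simp: H_def K_def vcat_def fun_eq_iff)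
  have HK: "H (vcat m a b) = a" "K (vcat m a b) = b" if "a \<in> carrier ?V" "b \<in> carrier ?W" for a b
    using vcat_closed[OF that] that by (auto simp: H_def K_def vcat_def fun_eq_iff free_mod_tail)
  define ext where "ext f = (\<lambda>w\<in>carrier ?U. vcat m (f (H w)) (K w))" for f
  have Hc: "H w \<in> carrier ?V" and Kc: "K w \<in> carrier ?W" if "w \<in> carrier ?U" for w
    using lin_mapsD(1)[OF Hl that] lin_mapsD(1)[OF Kl that] by auto
  have extc: "ext f w \<in> carrier ?U" if "f \<in> carrier ?V \<rightarrow> carrier ?V" "w \<in> carrier ?U" for f w
    using that Hc[OF that(2)] Kc[OF that(2)] by (auto simp: ext_def intro!: vcat_closed)
  define h where "h = inv_into (carrier ?V) g"
  have h: "h v \<in> carrier ?V" "g (h v) = v" "h (g v) = v" if "v \<in> carrier ?V" for v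
    unfolding h_def using gb that
    by (auto simp: bij_betw_def inv_into_into f_inv_into_f intro: bij_betw_inv_into_left[OF gb])
  have gf: "g \<in> carrier ?V \<rightarrow> carrier ?V" and hf: "h \<in> carrier ?V \<rightarrow> carrier ?V"
    using gD(1) h(1) by auto
  have "bij_betw (ext g) (carrier ?U) (carrier ?U)"
  proof (rule bij_betw_byWitness[where f' = "ext h"])
    show "\<forall>w\<in>carrier ?U. ext h (ext g w) = w"
      using extc[OF gf] Hc Kc gD(1) h(3) cat by (simp add: ext_def HK)
    show "\<forall>w\<in>carrier ?U. ext g (ext h w) = w"
      using extc[OF hf] Hc Kc h(1,2) cat by (simp add: ext_def HK)
  qed (use extc gf hf in auto)
  moreover have "ext g \<in> lin_maps R ?U ?U"
    using lin_vcat[OF free_mod_module lin_maps_restrict_comp[OF Hl gl free_mod_module] Kl]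
    by (simp add: ext_def cong: restrict_cong)
  moreover have "pullback_form ?U (ext g) (eps R (m + k)) = eps R (m + k)"
  proof
    fix w show "pullback_form ?U (ext g) (eps R (m + k)) w = eps R (m + k) w"
    proof (cases "w \<in> carrier ?U")
      case True
      have "ip R m (g (H w)) (g (H w)) = ip R m (H w) (H w)"
        using fun_cong[OF ge, of "H w"] Hc[OF True] gD(1)[OF Hc[OF True]]
        by (simp add: pullback_form_def eps_ip)
      then have "ip R (m + k) (ext g w) (ext g w) = ip R (m + k) (vcat m (H w) (K w)) (vcat m (H w) (K w))"
        using True Hc[OF True] Kc[OF True] gD(1)[OF Hc[OF True]] by (simp add: ext_def ip_vcat)
      then show ?thesis
        using True extc[OF gf True] cat[OF True] by (simp add: pullback_form_def eps_ip)
    qed (simp add: pullback_form_def eps_def)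
  qed
  ultimately have "ext g \<in> orth R n"
    by (simp add: orth_def n)
  moreover have "ext g v = g v" if v: "v \<in> carrier ?V" for v
  proof -
    have vU: "v \<in> carrier ?U"
      by (rule free_mod_mono[OF _ v]) simp
    have "H v = v" "K v = (\<lambda>i. \<zero>)"
      using HK[OF v free_mod_zero_closed] vcat_zero[OF v] by simp_all
    then show ?thesis
      using vU vcat_zero[OF gD(1)[OF v]] by (simp add: ext_def)
  qed
  ultimately show thesis by (rule that)
qed

end

context functor_over_half_cring
begin

abbreviation coinv_gens :: "nat \<Rightarrow> 'g set" where
  "coinv_gens n \<equiv> {far F (free_mod R n) (free_mod R n) g x \<otimes>\<^bsub>fob F (free_mod R n)\<^esub> inv\<^bsub>fob F (free_mod R n)\<^esub> x | g x.
     g \<in> orth R n \<and> x \<in> carrier (fob F (free_mod R n))}"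

lemma orth_lin: "g \<in> orth R n \<Longrightarrow> g \<in> lin_maps R (free_mod R n) (free_mod R n)"
  by (simp add: orth_def)

lemma F_orth_closed: "g \<in> orth R n \<Longrightarrow> x \<in> carrier (fob F (free_mod R n)) \<Longrightarrow>
    far F (free_mod R n) (free_mod R n) g x \<in> carrier (fob F (free_mod R n))"
  by (rule F_closed[OF free_mod_Ob free_mod_Ob orth_lin])

lemma coinv_gens_closed: "coinv_gens n \<subseteq> carrier (fob F (free_mod R n))"
proof -
  interpret comm_group "fob F (free_mod R n)" by (rule F_group[OF free_mod_Ob])
  show ?thesis using F_orth_closed by auto
qed

lemma coinv_sub_eq: "coinv_sub R F n = generate (fob F (free_mod R n)) (coinv_gens n)"
  by (simp add: coinv_sub_def Let_def)

lemma coinv_group: "comm_group (fob (coinv_system R F) n)"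
  unfolding coinv_system_def coinv_sub_eq
  using quotient_comm_group[OF F_group[OF free_mod_Ob] coinv_gens_closed] by simp

lemma coinv_class_hom: "coinv_class R F n \<in> hom (fob F (free_mod R n)) (fob (coinv_system R F) n)"
  unfolding coinv_system_def coinv_class_def coinv_sub_eq
  using quotient_hom[OF F_group[OF free_mod_Ob] coinv_gens_closed] by simp

lemma coinv_carrier:
  assumes "X \<in> carrier (fob (coinv_system R F) n)"
  obtains x where "x \<in> carrier (fob F (free_mod R n))" "X = coinv_class R F n x"
  using assms by (auto simp: coinv_system_def coinv_class_def carrier_FactGroup)

lemma coinv_universal:
  assumes H: "comm_group H" and h: "h \<in> hom (fob F (free_mod R n)) H"
    and orth: "\<And>g x. g \<in> orth R n \<Longrightarrow> x \<in> carrier (fob F (free_mod R n)) \<Longrightarrow>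
      h (far F (free_mod R n) (free_mod R n) g x) = h x"
  shows "\<exists>k\<in>hom (fob (coinv_system R F) n) H. \<forall>x\<in>carrier (fob F (free_mod R n)). k (coinv_class R F n x) = h x"
proof -
  interpret H: comm_group H by fact
  interpret V: comm_group "fob F (free_mod R n)" by (rule F_group[OF free_mod_Ob])
  interpret h: group_hom "fob F (free_mod R n)" H h
    by (rule comm_group_hom_group_hom[OF V.comm_group_axioms H h])
  have "h y = \<one>\<^bsub>H\<^esub>" if "y \<in> coinv_gens n" for y
    using that F_orth_closed orth by auto
  then show ?thesis
    using quotient_universal[OF V.comm_group_axioms coinv_gens_closed H h]
    by (simp add: coinv_system_def coinv_class_def coinv_sub_eq)
qed

lemma coinv_class_orth:
  assumes "g \<in> orth R n" "x \<in> carrier (fob F (free_mod R n))"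
  shows "coinv_class R F n (far F (free_mod R n) (free_mod R n) g x) = coinv_class R F n x"
proof -
  let ?V = "free_mod R n"
  let ?y = "far F ?V ?V g x"
  interpret V: comm_group "fob F ?V" by (rule F_group[OF free_mod_Ob])
  interpret Q: comm_group "fob (coinv_system R F) n" by (rule coinv_group)
  interpret q: group_hom "fob F ?V" "fob (coinv_system R F) n" "coinv_class R F n"
    by (rule comm_group_hom_group_hom[OF V.comm_group_axioms Q.comm_group_axioms coinv_class_hom])
  have y: "?y \<in> carrier (fob F ?V)"
    by (rule F_orth_closed[OF assms])
  have "coinv_class R F n (?y \<otimes>\<^bsub>fob F ?V\<^esub> inv\<^bsub>fob F ?V\<^esub> x) = \<one>\<^bsub>fob (coinv_system R F) n\<^esub>"
    unfolding coinv_class_def coinv_sub_eq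
    using quotient_relation[OF V.comm_group_axioms coinv_gens_closed, of "?y \<otimes>\<^bsub>fob F ?V\<^esub> inv\<^bsub>fob F ?V\<^esub> x"] assms
    by (auto simp: coinv_system_def coinv_sub_eq)
  then have "coinv_class R F n ?y \<otimes>\<^bsub>fob (coinv_system R F) n\<^esub> inv\<^bsub>fob (coinv_system R F) n\<^esub> coinv_class R F n x
    = \<one>\<^bsub>fob (coinv_system R F) n\<^esub>"
    using y assms(2) by simp
  then show ?thesis
    using y assms(2) q.hom_closed Q.inv_equality by (metis Q.inv_closed Q.inv_inv)
qed

text \<open>An orthogonal map of A^m followed by the inclusion equals the inclusion followed by the
  extended orthogonal map. All elements of a coset therefore go to one coset, and the union in
  \<open>coinv_system\<close> is this coset.\<close>

lemma coinv_far:
  assumes mn: "m \<le> n" and x: "x \<in> carrier (fob F (free_mod R m))"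
  shows "far (coinv_system R F) m n u (coinv_class R F m x)
    = coinv_class R F n (far F (free_mod R m) (free_mod R n) (std_incl R m) x)"
proof -
  let ?V = "free_mod R m" and ?W = "free_mod R n"
  let ?i = "far F ?V ?W (std_incl R m)"
  interpret V: comm_group "fob F ?V" by (rule F_group[OF free_mod_Ob])
  have hom: "(\<lambda>x. coinv_class R F n (?i x)) \<in> hom (fob F ?V) (fob (coinv_system R F) n)"
    using Group.hom_compose[OF F_hom[OF free_mod_Ob free_mod_Ob std_incl_lin[OF mn]] coinv_class_hom]
    by (simp add: comp_def)
  have "coinv_class R F n (?i (far F ?V ?V g y)) = coinv_class R F n (?i y)"
    if g: "g \<in> orth R m" and y: "y \<in> carrier (fob F ?V)" for g y
  proof -
    obtain g' where g': "g' \<in> orth R n" "\<And>v. v \<in> carrier ?V \<Longrightarrow> g' v = g v"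
      using orth_extend[OF mn g] by blast
    have gi: "(\<lambda>v\<in>carrier ?V. std_incl R m (g v)) \<in> lin_maps R ?V ?W"
      by (rule lin_maps_restrict_comp[OF orth_lin[OF g] std_incl_lin[OF mn] free_mod_module])
    have "?i (far F ?V ?V g y) = far F ?V ?W (\<lambda>v\<in>carrier ?V. std_incl R m (g v)) y"
      by (rule F_comp[OF free_mod_Ob free_mod_Ob free_mod_Ob orth_lin[OF g] std_incl_lin[OF mn] y gi]) simp
    also have "\<dots> = far F ?W ?W g' (?i y)"
      by (rule F_comp[OF free_mod_Ob free_mod_Ob free_mod_Ob std_incl_lin[OF mn] orth_lin[OF g'(1)] y gi, symmetric])
        (use g'(2) lin_mapsD(1)[OF orth_lin[OF g]] in \<open>simp add: std_incl_def\<close>)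
    finally show ?thesis
      using coinv_class_orth[OF g'(1) F_closed[OF free_mod_Ob free_mod_Ob std_incl_lin[OF mn] y]] by simp
  qed
  then obtain k where k: "\<forall>y\<in>carrier (fob F ?V). k (coinv_class R F m y) = coinv_class R F n (?i y)"
    using coinv_universal[OF coinv_group hom] by blast
  have sub: "subgroup (coinv_sub R F m) (fob F ?V)"
    unfolding coinv_sub_eq by (rule V.generate_is_subgroup[OF coinv_gens_closed])
  have same: "coinv_class R F n (?i y) = coinv_class R F n (?i x)" if y: "y \<in> coinv_class R F m x" for y
  proof -
    have "y \<in> carrier (fob F ?V)"
      using y x sub V.r_coset_subset_G[OF subgroup.subset[OF sub] x] by (auto simp: coinv_class_def)
    moreover have "coinv_class R F m x = coinv_class R F m y"
      unfolding coinv_class_def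
      by (rule V.repr_independence[OF y[unfolded coinv_class_def] x sub])
    ultimately show ?thesis
      using k x by metis
  qed
  have "x \<in> coinv_class R F m x"
    unfolding coinv_class_def by (rule V.rcos_self[OF x sub])
  then have "(\<Union>y\<in>coinv_class R F m x. coinv_class R F n (?i y)) = coinv_class R F n (?i x)"
    by (rule UN_constant_eq) (use same in blast)
  then show ?thesis
    by (simp add: coinv_system_def)
qed

lemma nat_cat_simps [simp]:
  "Ob nat_cat = UNIV" "Arr nat_cat m n = (if m \<le> n then {()} else {})"
  "Idn nat_cat = (\<lambda>_. ())" "Cmp nat_cat = (\<lambda>_ _ _ _ _. ())"
  by (simp_all add: nat_cat_def)

lemma coinv_functor: "is_functor nat_cat (coinv_system R F)"
  unfolding is_functor_def
proof (intro conjI ballI)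
  fix n m k :: nat
  show "comm_group (fob (coinv_system R F) n)"
    by (rule coinv_group)
  show "far (coinv_system R F) m n f \<in> hom (fob (coinv_system R F) m) (fob (coinv_system R F) n)"
    if "f \<in> Arr nat_cat m n" for f
  proof -
    have mn: "m \<le> n"
      using that by (simp split: if_splits)
    interpret V: comm_group "fob F (free_mod R m)" by (rule F_group[OF free_mod_Ob])
    have h: "(\<lambda>x. coinv_class R F n (far F (free_mod R m) (free_mod R n) (std_incl R m) x))
      \<in> hom (fob F (free_mod R m)) (fob (coinv_system R F) n)"
      using Group.hom_compose[OF F_hom[OF free_mod_Ob free_mod_Ob std_incl_lin[OF mn]] coinv_class_hom]
      by (simp add: comp_def)
    show ?thesis
    proof (rule homI)
      fix X assume "X \<in> carrier (fob (coinv_system R F) m)"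
      then obtain x where x: "x \<in> carrier (fob F (free_mod R m))" "X = coinv_class R F m x"
        by (rule coinv_carrier)
      then show "far (coinv_system R F) m n f X \<in> carrier (fob (coinv_system R F) n)"
        using coinv_far[OF mn x(1)] hom_in_carrier[OF h x(1)] by simp
    next
      fix X Y assume "X \<in> carrier (fob (coinv_system R F) m)" "Y \<in> carrier (fob (coinv_system R F) m)"
      then obtain x y where x: "x \<in> carrier (fob F (free_mod R m))" "X = coinv_class R F m x"
        and y: "y \<in> carrier (fob F (free_mod R m))" "Y = coinv_class R F m y"
        by (meson coinv_carrier)
      have "X \<otimes>\<^bsub>fob (coinv_system R F) m\<^esub> Y = coinv_class R F m (x \<otimes>\<^bsub>fob F (free_mod R m)\<^esub> y)"
        using hom_mult[OF coinv_class_hom x(1) y(1)] x y by simp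
      then show "far (coinv_system R F) m n f (X \<otimes>\<^bsub>fob (coinv_system R F) m\<^esub> Y)
        = far (coinv_system R F) m n f X \<otimes>\<^bsub>fob (coinv_system R F) n\<^esub> far (coinv_system R F) m n f Y"
        using x y hom_mult[OF h x(1) y(1)]
        by (simp add: coinv_far[OF mn] V.m_closed)
    qed
  qed
  show "far (coinv_system R F) n n (Idn nat_cat n) X = X"
    if X: "X \<in> carrier (fob (coinv_system R F) n)" for X
  proof -
    obtain x where x: "x \<in> carrier (fob F (free_mod R n))" "X = coinv_class R F n x"
      using X by (rule coinv_carrier)
    have "far F (free_mod R n) (free_mod R n) (std_incl R n) x = x"
      by (rule F_id[OF free_mod_Ob x(1) std_incl_lin]) (simp_all add: std_incl_def)
    then show ?thesis
      using x coinv_far[OF order.refl x(1)] by simp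
  qed
  show "far (coinv_system R F) n k (Cmp nat_cat n m k g f) X
      = far (coinv_system R F) m k g (far (coinv_system R F) n m f X)"
    if fg: "f \<in> Arr nat_cat n m" "g \<in> Arr nat_cat m k" and X: "X \<in> carrier (fob (coinv_system R F) n)" for f g X
  proof -
    have le: "n \<le> m" "m \<le> k" "n \<le> k"
      using fg by (auto split: if_splits)
    obtain x where x: "x \<in> carrier (fob F (free_mod R n))" "X = coinv_class R F n x"
      using X by (rule coinv_carrier)
    have "far F (free_mod R m) (free_mod R k) (std_incl R m)
        (far F (free_mod R n) (free_mod R m) (std_incl R n) x)
      = far F (free_mod R n) (free_mod R k) (std_incl R n) x"
      by (rule F_comp[OF free_mod_Ob free_mod_Ob free_mod_Ob std_incl_lin[OF le(1)] std_incl_lin[OF le(2)] x(1)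
            std_incl_lin[OF le(3)]])
        (simp add: std_incl_def free_mod_mono[OF le(1)])
    then show ?thesis
      unfolding x(2) using coinv_far le x(1) F_closed[OF free_mod_Ob free_mod_Ob std_incl_lin[OF le(1)] x(1)]
      by simp
  qed
qed

abbreviation coinv_colim :: "((nat \<times> 'g set) \<Rightarrow>\<^sub>0 int) set monoid" where
  "coinv_colim \<equiv> colim nat_cat (coinv_system R F)"

abbreviation stable_class :: "nat \<Rightarrow> 'g \<Rightarrow> ((nat \<times> 'g set) \<Rightarrow>\<^sub>0 int) set" where
  "stable_class n x \<equiv> colim_class nat_cat (coinv_system R F) n (coinv_class R F n x)"

text \<open>The instance of the abstract cocone to which the left inverse of the final proof
  refers.\<close>

lemma stable_class_invariant: "stable_invariant R F coinv_colim stable_class"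
proof (intro stable_invariant.intro stable_invariant_axioms.intro functor_over_half_cring_axioms)
  show "comm_group coinv_colim"
    by (rule colim_comm_group[OF coinv_functor])
  show "stable_class n \<in> hom (fob F (free_mod R n)) coinv_colim" for n
    using Group.hom_compose[OF coinv_class_hom colim_class_hom[OF coinv_functor], of n]
    by (simp add: comp_def)
  show "stable_class n (far F (free_mod R n) (free_mod R n) g x) = stable_class n x"
    if "g \<in> orth R n" "x \<in> carrier (fob F (free_mod R n))" for n g x
    using coinv_class_orth[OF that] by simp
  show "stable_class n (far F (free_mod R m) (free_mod R n) (std_incl R m) x) = stable_class m x"
    if "m \<le> n" "x \<in> carrier (fob F (free_mod R m))" for m n x
    using colim_class_far[OF coinv_functor, of m n "()" "coinv_class R F m x"] that
      coinv_far[OF that] hom_in_carrier[OF coinv_class_hom that(2)] by simp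
qed


section \<open>The canonical morphisms\<close>

lemma Ob_AT: "(V, q) \<in> Ob (AT R) \<longleftrightarrow> V \<in> Ob (proj_cat R) \<and> q \<in> T_forms R V"
  by (simp add: AT_def)

lemma Arr_AT: "f \<in> Arr (AT R) (V, q) (W, q') \<longleftrightarrow> f \<in> lin_maps R V W \<and> pullback_form V f q' = q"
  by (simp add: AT_def)

lemma Ob_HT: "(V, q) \<in> Ob (HT R) \<longleftrightarrow> (V, q) \<in> Ob (AT R) \<and> nondegenerate R V q"
  by (simp add: HT_def full_subcategory_def)

lemma Arr_HT: "Arr (HT R) = Arr (AT R)"
  by (simp add: HT_def full_subcategory_def)

lemma pi_star_functor: "is_functor (AT R) (pi_star F)"
  unfolding is_functor_def pi_star_simps
proof (intro conjI ballI)
  have Ob: "fst X \<in> Ob (proj_cat R)" if "X \<in> Ob (AT R)" for X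
    using that by (cases X) (simp add: Ob_AT)
  have Arr: "f \<in> Arr (proj_cat R) (fst X) (fst Y)" if "f \<in> Arr (AT R) X Y" for X Y f
    using that by (cases X, cases Y) (simp add: Arr_AT)
  have Idn: "Idn (AT R) X = Idn (proj_cat R) (fst X)" for X
    by (cases X) (simp add: AT_def)
  have Cmp: "Cmp (AT R) X Y Z = Cmp (proj_cat R) (fst X) (fst Y) (fst Z)" for X Y Z
    by (cases X, cases Y, cases Z) (simp add: AT_def)
  fix X assume X: "X \<in> Ob (AT R)"
  show "comm_group (fob F (fst X))"
    by (rule F_group[OF Ob[OF X]])
  show "far F (fst X) (fst X) (Idn (AT R) X) x = x" if "x \<in> carrier (fob F (fst X))" for x
    unfolding Idn using F Ob[OF X] that unfolding is_functor_def by blast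
  fix Y assume Y: "Y \<in> Ob (AT R)"
  show "far F (fst X) (fst Y) f \<in> hom (fob F (fst X)) (fob F (fst Y))" if "f \<in> Arr (AT R) X Y" for f
    by (rule functor_hom[OF F Ob[OF X] Ob[OF Y] Arr[OF that]])
  fix Z f g x assume "Z \<in> Ob (AT R)" "f \<in> Arr (AT R) X Y" "g \<in> Arr (AT R) Y Z" "x \<in> carrier (fob F (fst X))"
  then show "far F (fst X) (fst Z) (Cmp (AT R) X Y Z g f) x
    = far F (fst Y) (fst Z) g (far F (fst X) (fst Y) f x)"
    unfolding Cmp using F Ob[OF X] Ob[OF Y] Ob[of Z] Arr[of f X Y] Arr[of g Y Z] unfolding is_functor_def by blast
qed

lemma pi_star_functor_HT: "is_functor (HT R) (pi_star F)"
  using pi_star_functor unfolding is_functor_def HT_def full_subcategory_def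
  by simp

lemma eps_Ob_HT: "(free_mod R n, eps R n) \<in> Ob (HT R)"
  by (simp add: Ob_HT Ob_AT free_mod_Ob eps_T eps_nondegenerate)

lemma eps_Ob_AT: "(free_mod R n, eps R n) \<in> Ob (AT R)"
  using eps_Ob_HT by (simp add: Ob_HT)

lemma std_incl_AT:
  assumes "m \<le> n"
  shows "std_incl R m \<in> Arr (AT R) (free_mod R m, eps R m) (free_mod R n, eps R n)"
proof -
  have "pullback_form (free_mod R m) (std_incl R m) (eps R n) v = eps R m v" for v
  proof (cases "v \<in> carrier (free_mod R m)")
    case True
    then show ?thesis
      using ip_extend[OF assms True True] free_mod_mono[OF assms True]
      by (simp add: pullback_form_def std_incl_def eps_ip)
  qed (simp add: pullback_form_def eps_def)
  then show ?thesis
    by (auto simp: Arr_AT std_incl_lin[OF assms])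
qed

lemma orth_AT: "g \<in> orth R n \<Longrightarrow> g \<in> Arr (AT R) (free_mod R n, eps R n) (free_mod R n, eps R n)"
  by (simp add: Arr_AT orth_def)

text \<open>Every object of \<open>AT R\<close> maps to a standard one, so the standard objects carry the colimit.\<close>

lemma T_form_embedding:
  assumes "(V, q) \<in> Ob (AT R)"
  obtains n M where "M \<in> Arr (AT R) (V, q) (free_mod R n, eps R n)"
proof -
  have "V \<in> Ob (proj_cat R)" and "q \<in> T_forms R V"
    using assms by (auto simp: Ob_AT)
  then obtain n M where "M \<in> lin_maps R V (free_mod R n)" "q = pullback_form V M (eps R n)"
    using T_formsE[OF Ob_proj_cat_module] by metis
  then show thesis
    using that by (simp add: Arr_AT)
qed

text \<open>Orthogonal maps and standard inclusions preserve the standard forms, so they are arrows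
  of \<open>HT R\<close>; this gives invariance and compatibility. For surjectivity,
  \<open>HT R\<close> is full, so an arrow from (V, q) to a standard object is an arrow of
  \<open>HT R\<close> and moves \<open>x\<close> into some F(A^n).\<close>

lemma stabilisation_exists:
  "\<exists>\<alpha>. is_stabilisation_map R F \<alpha> \<and> \<alpha> ` carrier coinv_colim = carrier (H0 (HT R) (i_star (pi_star F)))"
proof -
  let ?H = "colim (HT R) (pi_star F)"
  let ?cl = "\<lambda>n. colim_class (HT R) (pi_star F) (free_mod R n, eps R n)"
  interpret H: comm_group ?H by (rule colim_comm_group[OF pi_star_functor_HT])
  interpret C: comm_group coinv_colim by (rule colim_comm_group[OF coinv_functor])
  have cl_hom: "?cl n \<in> hom (fob F (free_mod R n)) ?H" for n
    using colim_class_hom[OF pi_star_functor_HT eps_Ob_HT, of n] by simp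
  have inv: "?cl n (far F (free_mod R n) (free_mod R n) g x) = ?cl n x"
    if "g \<in> orth R n" "x \<in> carrier (fob F (free_mod R n))" for n g x
    using colim_class_far[OF pi_star_functor_HT eps_Ob_HT eps_Ob_HT, of g n n x] orth_AT[OF that(1)] that(2)
    by (simp add: Arr_HT)
  have "\<exists>k\<in>hom (fob (coinv_system R F) n) ?H.
      \<forall>x\<in>carrier (fob F (free_mod R n)). k (coinv_class R F n x) = ?cl n x" for n
    by (rule coinv_universal[OF H.comm_group_axioms cl_hom inv])
  then obtain k where "\<forall>n. k n \<in> hom (fob (coinv_system R F) n) ?H \<and>
      (\<forall>x\<in>carrier (fob F (free_mod R n)). k n (coinv_class R F n x) = ?cl n x)"
    unfolding Bex_def by metis
  then have k: "\<And>n. k n \<in> hom (fob (coinv_system R F) n) ?H"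
    "\<And>n x. x \<in> carrier (fob F (free_mod R n)) \<Longrightarrow> k n (coinv_class R F n x) = ?cl n x"
    by blast+
  have "\<exists>\<alpha>\<in>hom coinv_colim ?H. \<forall>n\<in>Ob nat_cat. \<forall>X\<in>carrier (fob (coinv_system R F) n).
      \<alpha> (colim_class nat_cat (coinv_system R F) n X) = k n X"
  proof (rule colim_universal[OF coinv_functor H.comm_group_axioms k(1)])
    fix m n f X
    assume f: "f \<in> Arr nat_cat m n" and "X \<in> carrier (fob (coinv_system R F) m)"
    then have mn: "m \<le> n"
      by (simp split: if_splits)
    obtain x where x: "x \<in> carrier (fob F (free_mod R m))" "X = coinv_class R F m x"
      using \<open>X \<in> carrier (fob (coinv_system R F) m)\<close> by (rule coinv_carrier)
    have "?cl n (far F (free_mod R m) (free_mod R n) (std_incl R m) x) = ?cl m x"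
      using colim_class_far[OF pi_star_functor_HT eps_Ob_HT eps_Ob_HT, of "std_incl R m" m n x]
        std_incl_AT[OF mn] x(1) by (simp add: Arr_HT)
    then show "k n (far (coinv_system R F) m n f X) = k m X"
      using x coinv_far[OF mn x(1)] k(2) F_closed[OF free_mod_Ob free_mod_Ob std_incl_lin[OF mn] x(1)] by simp
  qed
  then obtain \<alpha> where \<alpha>: "\<alpha> \<in> hom coinv_colim ?H"
    "\<And>n X. X \<in> carrier (fob (coinv_system R F) n) \<Longrightarrow> \<alpha> (colim_class nat_cat (coinv_system R F) n X) = k n X"
    by auto
  have \<alpha>c: "\<alpha> (stable_class n x) = ?cl n x" if "x \<in> carrier (fob F (free_mod R n))" for n x
    using \<alpha>(2)[OF hom_in_carrier[OF coinv_class_hom that]] k(2)[OF that] by simp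
  have "\<alpha> ` carrier coinv_colim = carrier ?H"
  proof (rule colim_surj[OF pi_star_functor_HT C.comm_group_axioms \<alpha>(1)])
    fix X x assume gen: "X \<in> Ob (HT R)" "x \<in> carrier (fob (pi_star F) X)"
    obtain V q where X: "X = (V, q)" by (cases X)
    have Vq: "(V, q) \<in> Ob (AT R)" and x: "x \<in> carrier (fob F V)"
      using gen X by (auto simp: Ob_HT)
    obtain n M where M: "M \<in> Arr (AT R) (V, q) (free_mod R n, eps R n)"
      by (rule T_form_embedding[OF Vq])
    have Mx: "far F V (free_mod R n) M x \<in> carrier (fob F (free_mod R n))"
      using M Vq x by (intro F_closed[OF _ free_mod_Ob]) (auto simp: Arr_AT Ob_AT)
    have "colim_class (HT R) (pi_star F) X x = ?cl n (far F V (free_mod R n) M x)"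
      using colim_class_far[OF pi_star_functor_HT gen(1) eps_Ob_HT, of M n x] M gen(2) X by (simp add: Arr_HT)
    also have "\<dots> = \<alpha> (stable_class n (far F V (free_mod R n) M x))"
      using \<alpha>c[OF Mx] by simp
    finally show "colim_class (HT R) (pi_star F) X x \<in> \<alpha> ` carrier coinv_colim"
      using hom_in_carrier[OF stable_invariant.c_hom[OF stable_class_invariant] Mx] by blast
  qed
  then show ?thesis
    using \<alpha>(1) \<alpha>c by (intro exI[of _ \<alpha>]) (simp add: is_stabilisation_map_def)
qed

text \<open>Surjective because every object of \<open>AT R\<close> maps to a standard one, and the
  standard forms are non-degenerate, so their classes come from \<open>HT R\<close>.\<close>

lemma inclusion_exists:
  "\<exists>\<beta>. is_inclusion_map R F \<beta> \<and>
     \<beta> ` carrier (H0 (HT R) (i_star (pi_star F))) = carrier (H0 (AT R) (pi_star F))"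
proof -
  let ?H = "colim (HT R) (pi_star F)" and ?A = "colim (AT R) (pi_star F)"
  interpret H: comm_group ?H by (rule colim_comm_group[OF pi_star_functor_HT])
  interpret A: comm_group ?A by (rule colim_comm_group[OF pi_star_functor])
  have Ob: "X \<in> Ob (AT R)" if "X \<in> Ob (HT R)" for X
    using that by (cases X) (simp add: Ob_HT)
  have "\<exists>\<beta>\<in>hom ?H ?A. \<forall>X\<in>Ob (HT R). \<forall>x\<in>carrier (fob (pi_star F) X).
      \<beta> (colim_class (HT R) (pi_star F) X x) = colim_class (AT R) (pi_star F) X x"
    by (rule colim_universal[OF pi_star_functor_HT A.comm_group_axioms])
      (use Ob colim_class_hom[OF pi_star_functor] colim_class_far[OF pi_star_functor] in \<open>auto simp: Arr_HT\<close>)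
  then obtain \<beta> where \<beta>: "\<beta> \<in> hom ?H ?A" "\<And>X x. X \<in> Ob (HT R) \<Longrightarrow> x \<in> carrier (fob F (fst X)) \<Longrightarrow>
      \<beta> (colim_class (HT R) (pi_star F) X x) = colim_class (AT R) (pi_star F) X x"
    by auto
  have "\<beta> ` carrier ?H = carrier ?A"
  proof (rule colim_surj[OF pi_star_functor H.comm_group_axioms \<beta>(1)])
    fix X x assume gen: "X \<in> Ob (AT R)" "x \<in> carrier (fob (pi_star F) X)"
    obtain V q where X: "X = (V, q)" by (cases X)
    have x: "x \<in> carrier (fob F V)"
      using gen X by simp
    obtain n M where M: "M \<in> Arr (AT R) (V, q) (free_mod R n, eps R n)"
      using T_form_embedding gen(1) X by blast
    have Mx: "far F V (free_mod R n) M x \<in> carrier (fob F (free_mod R n))"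
      using M gen(1) X x by (intro F_closed[OF _ free_mod_Ob]) (auto simp: Arr_AT Ob_AT)
    have "colim_class (AT R) (pi_star F) X x
      = colim_class (AT R) (pi_star F) (free_mod R n, eps R n) (far F V (free_mod R n) M x)"
      using colim_class_far[OF pi_star_functor gen(1) eps_Ob_AT, of M n x] M gen(2) X by simp
    also have "\<dots> = \<beta> (colim_class (HT R) (pi_star F) (free_mod R n, eps R n) (far F V (free_mod R n) M x))"
      using \<beta>(2)[OF eps_Ob_HT] Mx by simp
    finally show "colim_class (AT R) (pi_star F) X x \<in> \<beta> ` carrier ?H"
      using colim_class_closed[OF pi_star_functor_HT eps_Ob_HT] Mx by simp
  qed
  then show ?thesis
    using \<beta> by (intro exI[of _ \<beta>]) (auto simp: is_inclusion_map_def)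
qed

section \<open>Tensor products with the free abelian groups on sets of forms\<close>

lemma Z_forms_simps [simp]:
  "fob (Z_forms S) V = free_Abelian_group (S V)"
  "far (Z_forms S) V W f = frag_extend (\<lambda>q. frag_of (pullback_form V f q))"
  by (simp_all add: Z_forms_def)

lemma Z_forms_far_closed:
  assumes "form_class R S" "V \<in> Ob (proj_cat R)" "W \<in> Ob (proj_cat R)" "f \<in> Arr (proj_cat R) V W"
    "g \<in> carrier (fob (Z_forms S) W)"
  shows "far (Z_forms S) V W f g \<in> carrier (fob (Z_forms S) V)"
proof -
  have "pullback_form V f q \<in> S V" if "q \<in> S W" for q
    using assms(1)[unfolded form_class_def, THEN conjunct2, THEN conjunct2, rule_format,
        OF Ob_proj_cat_module[OF assms(2)] Ob_proj_cat_module[OF assms(3)], of f q] assms(4) that by simp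
  then have "(\<Union>q\<in>Poly_Mapping.keys g. Poly_Mapping.keys (frag_of (pullback_form V f q))) \<subseteq> S V"
    using assms(5) by auto
  then show ?thesis
    by (simp add: order.trans[OF keys_frag_extend])
qed

lemma Z_forms_group: "comm_group (fob (Z_forms S) V)"
  by (simp add: abelian_free_Abelian_group)

lemma Z_forms_presheaf: "form_class R S \<Longrightarrow> group_presheaf (proj_cat R) (Z_forms S)"
  unfolding group_presheaf_def using Z_forms_group Z_forms_far_closed by blast

lemmas Z_tensor_group = tensor_comm_group[OF F Z_forms_presheaf]
  and Z_tensor_closed = tensor_class_closed[OF F Z_forms_presheaf]
  and Z_tensor_hom_left = tensor_class_hom_left[OF F Z_forms_presheaf]
  and Z_tensor_hom_right = tensor_class_hom_right[OF F Z_forms_presheaf]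
  and Z_tensor_coend = tensor_class_coend[OF F Z_forms_presheaf]
  and Z_tensor_surj_gens = tensor_surj[OF F Z_forms_presheaf]
  and Z_tensor_universal = tensor_universal[OF F Z_forms_presheaf]

end


context functor_over_half_cring
begin

abbreviation Z_tensor :: "('a pobj \<Rightarrow> 'a qform set) \<Rightarrow> _" where
  "Z_tensor S \<equiv> tensor (proj_cat R) (Z_forms S) F"

abbreviation Z_class :: "('a pobj \<Rightarrow> 'a qform set) \<Rightarrow> _" where
  "Z_class S \<equiv> tensor_class (proj_cat R) (Z_forms S) F"

lemma Z_tensor_surj:
  assumes S: "form_class R S" and A: "comm_group A" and h: "h \<in> hom A (Z_tensor S)"
    and gen: "\<And>V q x. V \<in> Ob (proj_cat R) \<Longrightarrow> q \<in> S V \<Longrightarrow> x \<in> carrier (fob F V) \<Longrightarrow>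
      Z_class S V (frag_of q) x \<in> h ` carrier A"
  shows "h ` carrier A = carrier (Z_tensor S)"
proof (rule Z_tensor_surj_gens[OF S A h])
  note B = Z_tensor_group[OF S]
  fix V g x
  assume V: "V \<in> Ob (proj_cat R)" and g: "g \<in> carrier (fob (Z_forms S) V)" and x: "x \<in> carrier (fob F V)"
  have l: "(\<lambda>g. Z_class S V g x) \<in> hom (free_Abelian_group (S V)) (Z_tensor S)"
    using Z_tensor_hom_left[OF S V x] by simp
  have "Poly_Mapping.keys g \<subseteq> S V"
    using g by simp
  then show "Z_class S V g x \<in> h ` carrier A"
  proof (rule free_Abelian_group_induct[where P = "\<lambda>g. Z_class S V g x \<in> h ` carrier A"])
    show "Z_class S V 0 x \<in> h ` carrier A"
      using hom_free_zero[OF B l] image_one[OF A B h] by simp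
    show "Z_class S V (a - b) x \<in> h ` carrier A"
      if "Poly_Mapping.keys a \<subseteq> S V" "Poly_Mapping.keys b \<subseteq> S V"
        "Z_class S V a x \<in> h ` carrier A" "Z_class S V b x \<in> h ` carrier A" for a b
      using hom_free_diff[OF B l that(1,2)] image_quot[OF A B h that(3,4)] by simp
  qed (rule gen[OF V _ x])
qed

text \<open>Z[S V] is free on the forms, so a homomorphism out of the tensor product amounts to a
  family of homomorphisms indexed by forms; the coend relation becomes naturality of this family
  under pullback.\<close>

lemma Z_tensor_universal_forms:
  assumes S: "form_class R S" and H: "comm_group H"
    and k: "\<And>V q. V \<in> Ob (proj_cat R) \<Longrightarrow> q \<in> S V \<Longrightarrow> k V q \<in> hom (fob F V) H"
    and nat: "\<And>V W f q x. V \<in> Ob (proj_cat R) \<Longrightarrow> W \<in> Ob (proj_cat R) \<Longrightarrow> f \<in> lin_maps R V W \<Longrightarrow>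
      q \<in> S W \<Longrightarrow> x \<in> carrier (fob F V) \<Longrightarrow> k V (pullback_form V f q) x = k W q (far F V W f x)"
  shows "\<exists>h\<in>hom (Z_tensor S) H. \<forall>V\<in>Ob (proj_cat R). \<forall>q\<in>S V. \<forall>x\<in>carrier (fob F V).
    h (Z_class S V (frag_of q) x) = k V q x"
proof -
  interpret H: comm_group H by fact
  \<comment> \<open>The linear extension of \<open>k V q x\<close> in the variable q. Additivity in
    x and the coend relation are then checked on single forms by
    \<open>hom_free_eqI\<close>.\<close>
  define e where "e V x = (SOME h. h \<in> hom (free_Abelian_group (S V)) H \<and> (\<forall>q\<in>S V. h (frag_of q) = k V q x))" for V x
  have ex: "e V x \<in> hom (free_Abelian_group (S V)) H \<and> (\<forall>q\<in>S V. e V x (frag_of q) = k V q x)"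
    if V: "V \<in> Ob (proj_cat R)" and x: "x \<in> carrier (fob F V)" for V x
  proof -
    have k_closed: "(\<lambda>q. k V q x) ` S V \<subseteq> carrier H"
      using hom_in_carrier[OF k[OF V] x] by blast
    have "\<exists>h. h \<in> hom (free_Abelian_group (S V)) H \<and> (\<forall>q\<in>S V. h (frag_of q) = k V q x)"
      by (rule H.free_Abelian_group_universal[OF k_closed]) blast
    from someI_ex[OF this] show ?thesis
      unfolding e_def .
  qed
  have e: "e V x \<in> hom (free_Abelian_group (S V)) H"
    and eq: "\<And>q. q \<in> S V \<Longrightarrow> e V x (frag_of q) = k V q x"
    if "V \<in> Ob (proj_cat R)" "x \<in> carrier (fob F V)" for V x
    using ex[OF that] by blast+
  have pull: "pullback_form V f q \<in> S V"
    if "V \<in> Ob (proj_cat R)" "W \<in> Ob (proj_cat R)" "f \<in> lin_maps R V W" "q \<in> S W" for V W f q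
    using S[unfolded form_class_def, THEN conjunct2, THEN conjunct2, rule_format,
        OF Ob_proj_cat_module[OF that(1)] Ob_proj_cat_module[OF that(2)] that(3,4)] .
  have "\<exists>h\<in>hom (Z_tensor S) H. \<forall>V\<in>Ob (proj_cat R). \<forall>g\<in>carrier (fob (Z_forms S) V). \<forall>x\<in>carrier (fob F V).
      h (Z_class S V g x) = e V x g"
  proof (rule Z_tensor_universal[OF S H])
    show "(\<lambda>g. e V x g) \<in> hom (fob (Z_forms S) V) H"
      if "V \<in> Ob (proj_cat R)" "x \<in> carrier (fob F V)" for V x
      using e[OF that] by simp
  next
    fix V g assume V: "V \<in> Ob (proj_cat R)" and "g \<in> carrier (fob (Z_forms S) V)"
    then have g: "Poly_Mapping.keys g \<subseteq> S V"
      by simp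
    interpret V: comm_group "fob F V" by (rule F_group[OF V])
    show "(\<lambda>x. e V x g) \<in> hom (fob F V) H"
    proof (rule homI)
      show "e V x g \<in> carrier H" if "x \<in> carrier (fob F V)" for x
        using hom_in_carrier[OF e[OF V that]] g by simp
      fix x y assume x: "x \<in> carrier (fob F V)" and y: "y \<in> carrier (fob F V)"
      have xy: "x \<otimes>\<^bsub>fob F V\<^esub> y \<in> carrier (fob F V)"
        using x y by simp
      show "e V (x \<otimes>\<^bsub>fob F V\<^esub> y) g = e V x g \<otimes>\<^bsub>H\<^esub> e V y g"
      proof (rule hom_free_eqI[OF H e[OF V xy] _ _ g])
        show "(\<lambda>g. e V x g \<otimes>\<^bsub>H\<^esub> e V y g) \<in> hom (free_Abelian_group (S V)) H"
          by (rule H.hom_group_mult[OF e[OF V x] e[OF V y]])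
        show "e V (x \<otimes>\<^bsub>fob F V\<^esub> y) (frag_of q) = e V x (frag_of q) \<otimes>\<^bsub>H\<^esub> e V y (frag_of q)" if "q \<in> S V" for q
          using hom_mult[OF k[OF V that] x y] by (simp add: eq V x y xy that)
      qed
    qed
  next
    fix V W f g x
    assume V: "V \<in> Ob (proj_cat R)" and W: "W \<in> Ob (proj_cat R)" and f: "f \<in> Arr (proj_cat R) V W"
      and g: "g \<in> carrier (fob (Z_forms S) W)" and x: "x \<in> carrier (fob F V)"
    have fl: "f \<in> lin_maps R V W"
      using f by simp
    have gW: "Poly_Mapping.keys g \<subseteq> S W"
      using g by simp
    have y: "far F V W f x \<in> carrier (fob F W)"
      by (rule F_closed[OF V W fl x])
    have pb: "far (Z_forms S) V W f \<in> hom (free_Abelian_group (S W)) (free_Abelian_group (S V))"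
      using Z_forms_far_closed[OF S V W f] by (intro homI) (simp_all add: frag_extend_add)
    show "e V x (far (Z_forms S) V W f g) = e W (far F V W f x) g"
    proof (rule hom_free_eqI[OF H _ e[OF W y] _ gW])
      show "(\<lambda>g. e V x (far (Z_forms S) V W f g)) \<in> hom (free_Abelian_group (S W)) H"
        using Group.hom_compose[OF pb e[OF V x]] by (simp add: comp_def)
      show "e V x (far (Z_forms S) V W f (frag_of q)) = e W (far F V W f x) (frag_of q)" if "q \<in> S W" for q
        using nat[OF V W fl that x] eq[OF V x pull[OF V W fl that]] eq[OF W y that] by simp
    qed
  qed
  then obtain h where h: "h \<in> hom (Z_tensor S) H"
    "\<And>V g x. V \<in> Ob (proj_cat R) \<Longrightarrow> g \<in> carrier (fob (Z_forms S) V) \<Longrightarrow> x \<in> carrier (fob F V) \<Longrightarrow>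
      h (Z_class S V g x) = e V x g"
    by blast
  have "h (Z_class S V (frag_of q) x) = k V q x"
    if "V \<in> Ob (proj_cat R)" "q \<in> S V" "x \<in> carrier (fob F V)" for V q x
    using h(2)[OF that(1) _ that(3), of "frag_of q"] eq[OF that(1,3,2)] that by simp
  then show ?thesis
    using h(1) by blast
qed

lemma Z_class_hom:
  assumes "form_class R S" "V \<in> Ob (proj_cat R)" "q \<in> S V"
  shows "Z_class S V (frag_of q) \<in> hom (fob F V) (Z_tensor S)"
  using Z_tensor_hom_right[OF assms(1,2), of "frag_of q"] assms(3) by simp

lemma Z_class_natural:
  assumes "form_class R S" "V \<in> Ob (proj_cat R)" "W \<in> Ob (proj_cat R)" "f \<in> lin_maps R V W"
    "q \<in> S W" "x \<in> carrier (fob F V)"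
  shows "Z_class S V (frag_of (pullback_form V f q)) x = Z_class S W (frag_of q) (far F V W f x)"
  using Z_tensor_coend[OF assms(1,2,3), of f "frag_of q" x] assms(4-) by simp

text \<open>An arrow (V, q) to (W, q') of \<open>AT R\<close> has q as the pullback of q', so
  compatibility is the coend relation on a basis element. Surjectivity holds because every basis
  element [q] arises from the object (V, q).\<close>

lemma fibration_exists:
  "\<exists>\<gamma>. is_fibration_map R F \<gamma> \<and> \<gamma> ` carrier (H0 (AT R) (pi_star F)) = carrier (Z_tensor (T_forms R))"
proof -
  let ?A = "colim (AT R) (pi_star F)"
  note T = form_class_T
  have "\<exists>\<gamma>\<in>hom ?A (Z_tensor (T_forms R)). \<forall>X\<in>Ob (AT R). \<forall>x\<in>carrier (fob (pi_star F) X).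
      \<gamma> (colim_class (AT R) (pi_star F) X x) = Z_class (T_forms R) (fst X) (frag_of (snd X)) x"
  proof (rule colim_universal[OF pi_star_functor Z_tensor_group[OF T]])
    show "Z_class (T_forms R) (fst X) (frag_of (snd X)) \<in> hom (fob (pi_star F) X) (Z_tensor (T_forms R))"
      if "X \<in> Ob (AT R)" for X
      using that by (cases X) (simp add: Ob_AT Z_class_hom[OF T])
    show "Z_class (T_forms R) (fst Y) (frag_of (snd Y)) (far (pi_star F) X Y f x)
      = Z_class (T_forms R) (fst X) (frag_of (snd X)) x"
      if "X \<in> Ob (AT R)" "Y \<in> Ob (AT R)" "f \<in> Arr (AT R) X Y" "x \<in> carrier (fob (pi_star F) X)" for X Y f x
      using that Z_class_natural[OF T, of "fst X" "fst Y" f "snd Y" x]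
      by (cases X, cases Y) (simp add: Ob_AT Arr_AT)
  qed
  then obtain \<gamma> where \<gamma>h: "\<gamma> \<in> hom ?A (Z_tensor (T_forms R))"
    and \<gamma>X: "\<forall>X\<in>Ob (AT R). \<forall>x\<in>carrier (fob (pi_star F) X).
      \<gamma> (colim_class (AT R) (pi_star F) X x) = Z_class (T_forms R) (fst X) (frag_of (snd X)) x"
    by blast
  have "\<gamma> (colim_class (AT R) (pi_star F) (V, q) x) = Z_class (T_forms R) V (frag_of q) x"
    if "(V, q) \<in> Ob (AT R)" "x \<in> carrier (fob F V)" for V q x
    using bspec[OF bspec[OF \<gamma>X that(1)], of x] that(2) by simp
  note \<gamma> = \<gamma>h this
  have "\<gamma> ` carrier ?A = carrier (Z_tensor (T_forms R))"
  proof (rule Z_tensor_surj[OF T colim_comm_group[OF pi_star_functor] \<gamma>(1)])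
    fix V q x assume "V \<in> Ob (proj_cat R)" "q \<in> T_forms R V" and x: "x \<in> carrier (fob F V)"
    then have Vq: "(V, q) \<in> Ob (AT R)"
      by (simp add: Ob_AT)
    have "colim_class (AT R) (pi_star F) (V, q) x \<in> carrier ?A"
      by (rule colim_class_closed[OF pi_star_functor Vq]) (simp add: x)
    then show "Z_class (T_forms R) V (frag_of q) x \<in> \<gamma> ` carrier ?A"
      unfolding \<gamma>(2)[OF Vq x, symmetric] by (rule imageI)
  qed
  then show ?thesis
    using \<gamma> by (intro exI[of _ \<gamma>]) (auto simp: is_fibration_map_def)
qed

lemma retract_form:
  assumes V: "module R V" and q: "q \<in> quad_forms R V"
    and s: "\<And>v. v \<in> carrier V \<Longrightarrow> s v \<in> carrier W" and rs: "\<And>v. v \<in> carrier V \<Longrightarrow> r (s v) = v"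
  shows "pullback_form V s (pullback_form W r q) = q"
proof
  fix v show "pullback_form V s (pullback_form W r q) v = q v"
    using s rs quad_forms_ext[OF q] by (cases "v \<in> carrier V") (simp_all add: pullback_form_def)
qed

lemma forms_map_exists:
  "\<exists>\<delta>. is_forms_map R F \<delta>"
proof -
  let ?T = "T_forms R" and ?Q = "quad_forms R"
  note Q = form_class_quad
  have sub: "?T V \<subseteq> ?Q V" if "V \<in> Ob (proj_cat R)" for V
    by (rule T_subset_quad[OF Ob_proj_cat_module[OF that]])
  have g: "g \<in> carrier (fob (Z_forms ?Q) V)" if "V \<in> Ob (proj_cat R)" "g \<in> carrier (fob (Z_forms ?T) V)" for V g
    using that sub[OF that(1)] by auto
  have "\<exists>\<delta>\<in>hom (Z_tensor ?T) (Z_tensor ?Q). \<forall>V\<in>Ob (proj_cat R). \<forall>g\<in>carrier (fob (Z_forms ?T) V).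
      \<forall>x\<in>carrier (fob F V). \<delta> (Z_class ?T V g x) = Z_class ?Q V g x"
  proof (rule Z_tensor_universal[OF form_class_T Z_tensor_group[OF Q]])
    show "(\<lambda>g. Z_class ?Q V g x) \<in> hom (fob (Z_forms ?T) V) (Z_tensor ?Q)"
      if V: "V \<in> Ob (proj_cat R)" and x: "x \<in> carrier (fob F V)" for V x
    proof (rule homI)
      fix a b assume a: "a \<in> carrier (fob (Z_forms ?T) V)" and b: "b \<in> carrier (fob (Z_forms ?T) V)"
      show "Z_class ?Q V a x \<in> carrier (Z_tensor ?Q)"
        by (rule hom_in_carrier[OF Z_tensor_hom_left[OF Q V x] g[OF V a]])
      show "Z_class ?Q V (a \<otimes>\<^bsub>fob (Z_forms ?T) V\<^esub> b) x
        = Z_class ?Q V a x \<otimes>\<^bsub>Z_tensor ?Q\<^esub> Z_class ?Q V b x"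
        using hom_mult[OF Z_tensor_hom_left[OF Q V x] g[OF V a] g[OF V b]] by simp
    qed
    show "Z_class ?Q V h \<in> hom (fob F V) (Z_tensor ?Q)"
      if "V \<in> Ob (proj_cat R)" "h \<in> carrier (fob (Z_forms ?T) V)" for V h
      by (rule Z_tensor_hom_right[OF Q that(1) g[OF that]])
    show "Z_class ?Q V (far (Z_forms ?T) V W f h) x = Z_class ?Q W h (far F V W f x)"
      if "V \<in> Ob (proj_cat R)" "W \<in> Ob (proj_cat R)" "f \<in> Arr (proj_cat R) V W"
        "h \<in> carrier (fob (Z_forms ?T) W)" "x \<in> carrier (fob F V)" for V W f h x
      using Z_tensor_coend[OF Q that(1,2,3) g[OF that(2,4)] that(5)] by simp
  qed
  then show ?thesis
    unfolding is_forms_map_def by auto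
qed

text \<open>Retractions reduce to a form on A^m. With a shift p such that p and q + p are T-forms,
  finite degree of the element expresses [q] tensor y through the classes of q + i p with i
  positive, and these forms lie in T.\<close>

lemma forms_map_surj:
  assumes \<delta>: "is_forms_map R F \<delta>"
    and finite_degree: "\<And>m x. x \<in> carrier (fob F (free_mod R m)) \<Longrightarrow> \<exists>r. finite_degree R F m r x"
  shows "\<delta> ` carrier (Z_tensor (T_forms R)) = carrier (Z_tensor (quad_forms R))"
proof (rule Z_tensor_surj[OF form_class_quad Z_tensor_group[OF form_class_T]])
  let ?T = "T_forms R" and ?Q = "quad_forms R"
  note T = form_class_T and Q = form_class_quad
  show \<delta>h: "\<delta> \<in> hom (Z_tensor ?T) (Z_tensor ?Q)"
    using \<delta> by (simp add: is_forms_map_def)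
  have \<delta>c: "\<delta> (Z_class ?T V (frag_of q) x) = Z_class ?Q V (frag_of q) x"
    if "V \<in> Ob (proj_cat R)" "q \<in> ?T V" "x \<in> carrier (fob F V)" for V q x
    using \<delta> that by (simp add: is_forms_map_def)
  interpret T: comm_group "Z_tensor ?T" by (rule Z_tensor_group[OF T])
  interpret Q: comm_group "Z_tensor ?Q" by (rule Z_tensor_group[OF Q])
  interpret \<delta>: group_hom "Z_tensor ?T" "Z_tensor ?Q" \<delta>
    by (rule comm_group_hom_group_hom[OF T.comm_group_axioms Q.comm_group_axioms \<delta>h])
  fix V q x assume V: "V \<in> Ob (proj_cat R)" and q: "q \<in> ?Q V" and x: "x \<in> carrier (fob F V)"
  obtain m s r where s: "s \<in> lin_maps R V (free_mod R m)" and r: "r \<in> lin_maps R (free_mod R m) V"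
    and rs: "\<And>v. v \<in> carrier V \<Longrightarrow> r (s v) = v"
    using fg_projective_retract[OF V] by blast
  let ?V = "free_mod R m"
  let ?q = "pullback_form ?V r q" and ?y = "far F V ?V s x"
  have q': "?q \<in> ?Q ?V"
    by (rule quad_forms_pullback[OF free_mod_module Ob_proj_cat_module[OF V] r q])
  have y: "?y \<in> carrier (fob F ?V)"
    by (rule F_closed[OF V free_mod_Ob s x])
  have "Z_class ?Q V (frag_of q) x = Z_class ?Q ?V (frag_of ?q) ?y"
    using Z_class_natural[OF Q V free_mod_Ob s q' x]
      retract_form[OF Ob_proj_cat_module[OF V] q lin_mapsD(1)[OF s] rs] by simp
  also have "\<dots> \<in> \<delta> ` carrier (Z_tensor ?T)"
  proof -
    obtain d where d: "finite_degree R F m d ?y"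
      using finite_degree[OF y] by blast
    obtain p where p: "p \<in> ?T ?V" "form_add R ?V ?q p \<in> ?T ?V"
      using quad_form_difference[OF q'] by blast
    have pQ: "p \<in> ?Q ?V"
      using p(1) T_subset_quad[OF free_mod_module] by blast
    let ?t = "\<lambda>I. form_add R ?V ?q (form_mult R ?V (card I) p)"
    let ?s = "\<lambda>I. - ((-1) ^ card (I :: nat set)) :: int"
    have tT: "?t I \<in> ?T ?V" if "I \<in> Pow {..<d} - {{}}" for I
      by (rule T_forms_shift[OF free_mod_module q' p])
        (use that finite_subset[of I "{..<d}"] in \<open>auto simp: card_gt_0_iff\<close>)
    have tc: "Z_class ?T ?V (frag_of (?t I)) ?y \<in> carrier (Z_tensor ?T)" if "I \<in> Pow {..<d} - {{}}" for I
      by (rule hom_in_carrier[OF Z_class_hom[OF T free_mod_Ob tT[OF that]] y])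
    \<comment> \<open>Here \<open>form_ext_eq\<close> is used for the class of all quadratic forms:
      q and p are both forms of the class, and the family of classes [q] tensor y is natural by the
      coend relation.\<close>
    have "Z_class ?Q ?V (frag_of ?q) ?y
      = form_ext R (Z_tensor ?Q) (\<lambda>m q. Z_class ?Q (free_mod R m) (frag_of q)) m d p ?q ?y"
      by (rule form_ext_eq[OF Q.comm_group_axioms Q Z_class_hom[OF Q free_mod_Ob]
            Z_class_natural[OF Q free_mod_Ob free_mod_Ob] q' pQ y d, symmetric])
    also have "\<dots> = finprod (Z_tensor ?Q) (\<lambda>I. \<delta> (Z_class ?T ?V (frag_of (?t I)) ?y [^]\<^bsub>Z_tensor ?T\<^esub> ?s I))
        (Pow {..<d} - {{}})"
      unfolding form_ext_def
    proof (rule Q.finprod_cong')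
      fix I assume I: "I \<in> Pow {..<d} - {{}}"
      show "Z_class ?Q ?V (frag_of (?t I)) ?y [^]\<^bsub>Z_tensor ?Q\<^esub> ?s I
        = \<delta> (Z_class ?T ?V (frag_of (?t I)) ?y [^]\<^bsub>Z_tensor ?T\<^esub> ?s I)"
        using \<delta>c[OF free_mod_Ob tT[OF I] y] \<delta>.hom_int_pow[OF tc[OF I]] by simp
    qed (rule refl, (rule Pi_I; rule \<delta>.hom_closed; rule T.int_pow_closed; rule tc; assumption))
    also have "\<dots> = \<delta> (finprod (Z_tensor ?T) (\<lambda>I. Z_class ?T ?V (frag_of (?t I)) ?y [^]\<^bsub>Z_tensor ?T\<^esub> ?s I)
        (Pow {..<d} - {{}}))"
      by (rule T.finprod_hom[OF Q.comm_group_axioms \<delta>h, symmetric]; rule Pi_I; rule T.int_pow_closed; rule tc; assumption)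
    also have "\<dots> \<in> \<delta> ` carrier (Z_tensor ?T)"
      by (rule imageI; rule T.finprod_closed; rule Pi_I; rule T.int_pow_closed; rule tc; assumption)
    finally show ?thesis .
  qed
  finally show "Z_class ?Q V (frag_of q) x \<in> \<delta> ` carrier (Z_tensor ?T)" .
qed

end

section \<open>The left inverse of the composite\<close>

context euclidean_invariant
begin

text \<open>\<open>lam\<close> is defined on free modules and is carried over to V by a chosen
  retraction: the form is pulled back along r and the element is pushed forward along s. Naturality
  of \<open>lam\<close> makes the result natural in V.\<close>

lemma lam_tensor:
  "\<exists>L\<in>hom (Z_tensor (quad_forms R)) G. \<forall>n. \<forall>x\<in>carrier (fob F (free_mod R n)).
     L (Z_class (quad_forms R) (free_mod R n) (frag_of (eps R n)) x) = c n x"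
proof -
  let ?Q = "quad_forms R"
  note Q = form_class_quad
  \<comment> \<open>Dimension, section and retraction are packed into a triple so that one
    application of choice serves all objects.\<close>
  have "\<forall>V\<in>Ob (proj_cat R). \<exists>z. fst (snd z) \<in> lin_maps R V (free_mod R (fst z)) \<and>
      snd (snd z) \<in> lin_maps R (free_mod R (fst z)) V \<and> (\<forall>v\<in>carrier V. snd (snd z) (fst (snd z) v) = v)"
    using fg_projective_retract by fastforce
  then obtain z where z: "\<forall>V\<in>Ob (proj_cat R). fst (snd (z V)) \<in> lin_maps R V (free_mod R (fst (z V))) \<and>
      snd (snd (z V)) \<in> lin_maps R (free_mod R (fst (z V))) V \<and>
      (\<forall>v\<in>carrier V. snd (snd (z V)) (fst (snd (z V)) v) = v)"
    using bchoice[of "Ob (proj_cat R)" "\<lambda>V z. fst (snd z) \<in> lin_maps R V (free_mod R (fst z)) \<and>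
      snd (snd z) \<in> lin_maps R (free_mod R (fst z)) V \<and> (\<forall>v\<in>carrier V. snd (snd z) (fst (snd z) v) = v)"] by blast
  define m s r where "m V = fst (z V)" and "s V = fst (snd (z V))" and "r V = snd (snd (z V))" for V
  have s: "s V \<in> lin_maps R V (free_mod R (m V))" and r: "r V \<in> lin_maps R (free_mod R (m V)) V"
    and rs: "\<And>v. v \<in> carrier V \<Longrightarrow> r V (s V v) = v" if "V \<in> Ob (proj_cat R)" for V
    using z that by (auto simp: m_def s_def r_def)
  define k where "k V q x = lam (m V) (pullback_form (free_mod R (m V)) (r V) q) (far F V (free_mod R (m V)) (s V) x)"
    for V q x
  have pq: "pullback_form (free_mod R (m V)) (r V) q \<in> ?Q (free_mod R (m V))"
    if "V \<in> Ob (proj_cat R)" "q \<in> ?Q V" for V q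
    by (rule quad_forms_pullback[OF free_mod_module Ob_proj_cat_module[OF that(1)] r[OF that(1)] that(2)])
  have "\<exists>L\<in>hom (Z_tensor ?Q) G. \<forall>V\<in>Ob (proj_cat R). \<forall>q\<in>?Q V. \<forall>x\<in>carrier (fob F V).
      L (Z_class ?Q V (frag_of q) x) = k V q x"
  proof (rule Z_tensor_universal_forms[OF Q G])
    fix V q assume V: "V \<in> Ob (proj_cat R)" and q: "q \<in> ?Q V"
    have "k V q = lam (m V) (pullback_form (free_mod R (m V)) (r V) q) \<circ> far F V (free_mod R (m V)) (s V)"
      by (simp add: fun_eq_iff k_def)
    then show "k V q \<in> hom (fob F V) G"
      using Group.hom_compose[OF F_hom[OF V free_mod_Ob s[OF V]] lam_hom[OF pq[OF V q]]] by simp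
  next
    fix V W f q x
    assume V: "V \<in> Ob (proj_cat R)" and W: "W \<in> Ob (proj_cat R)" and f: "f \<in> lin_maps R V W"
      and q: "q \<in> ?Q W" and x: "x \<in> carrier (fob F V)"
    let ?V = "free_mod R (m V)" and ?W = "free_mod R (m W)"
    note sV = s[OF V] and rV = r[OF V] and sW = s[OF W] and rW = r[OF W]
    \<comment> \<open>The map s f r between the free modules. Pulling back along it agrees with
      pulling back along f on forms coming from W, and it sends the image of \<open>x\<close> to the
      image of f(x), so \<open>lam_natural\<close> applies.\<close>
    define g where "g = (\<lambda>v\<in>carrier ?V. s W ((\<lambda>v\<in>carrier ?V. f (r V v)) v))"
    have fr: "(\<lambda>v\<in>carrier ?V. f (r V v)) \<in> lin_maps R ?V W"
      by (rule lin_maps_restrict_comp[OF rV f free_mod_module])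
    have g: "g \<in> lin_maps R ?V ?W"
      unfolding g_def by (rule lin_maps_restrict_comp[OF fr sW free_mod_module])
    have gv: "g v = s W (f (r V v))" if "v \<in> carrier ?V" for v
      using that by (simp add: g_def)
    have y: "far F V ?V (s V) x \<in> carrier (fob F ?V)"
      by (rule F_closed[OF V free_mod_Ob sV x])
    have "pullback_form ?V (r V) (pullback_form V f q) = pullback_form ?V g (pullback_form ?W (r W) q)"
      unfolding pullback_form_def
    proof (rule restrict_ext)
      fix v assume v: "v \<in> carrier ?V"
      have rv: "r V v \<in> carrier V"
        by (rule lin_mapsD(1)[OF rV v])
      have fv: "f (r V v) \<in> carrier W"
        by (rule lin_mapsD(1)[OF f rv])
      show "(\<lambda>v\<in>carrier V. q (f v)) (r V v) = (\<lambda>v\<in>carrier ?W. q (r W v)) (g v)"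
        using rv fv lin_mapsD(1)[OF sW fv] by (simp add: gv[OF v] rs[OF W fv])
    qed
    moreover have "far F ?V ?W g (far F V ?V (s V) x) = far F W ?W (s W) (far F V W f x)"
    proof -
      have sf: "(\<lambda>v\<in>carrier V. s W (f v)) \<in> lin_maps R V ?W"
        by (rule lin_maps_restrict_comp[OF f sW Ob_proj_cat_module[OF V]])
      have "far F ?V ?W g (far F V ?V (s V) x) = far F V ?W (\<lambda>v\<in>carrier V. s W (f v)) x"
        by (rule F_comp[OF V free_mod_Ob free_mod_Ob sV g x sf])
          (simp add: gv[OF lin_mapsD(1)[OF sV]] rs[OF V])
      also have "\<dots> = far F W ?W (s W) (far F V W f x)"
        by (rule F_comp[OF V W free_mod_Ob f sW x sf, symmetric]) simp
      finally show ?thesis .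
    qed
    ultimately show "k V (pullback_form V f q) x = k W q (far F V W f x)"
      unfolding k_def using lam_natural[OF g pq[OF W q] y] by simp
  qed
  then obtain L where L: "L \<in> hom (Z_tensor ?Q) G"
    "\<And>V q x. V \<in> Ob (proj_cat R) \<Longrightarrow> q \<in> ?Q V \<Longrightarrow> x \<in> carrier (fob F V) \<Longrightarrow>
      L (Z_class ?Q V (frag_of q) x) = k V q x"
    by blast
  have "L (Z_class ?Q (free_mod R n) (frag_of (eps R n)) x) = c n x"
    if x: "x \<in> carrier (fob F (free_mod R n))" for n x
  proof -
    let ?V = "free_mod R n"
    note V = free_mod_Ob[of n]
    let ?I = "\<lambda>v\<in>carrier ?V. v"
    have I: "?I \<in> lin_maps R ?V ?V"
      by (rule lin_mapsI[OF free_mod_module]) auto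
    have "L (Z_class ?Q ?V (frag_of (eps R n)) x) = k ?V (eps R n) x"
      by (rule L(2)[OF V eps_quad x])
    \<comment> \<open>The retraction chosen for A^n need not be the identity; naturality along its
      section brings the value back to A^n itself.\<close>
    also have "\<dots> = lam n (pullback_form ?V (s ?V) (pullback_form (free_mod R (m ?V)) (r ?V) (eps R n))) x"
      unfolding k_def by (rule lam_natural[OF s[OF V] pq[OF V eps_quad] x, symmetric])
    also have "\<dots> = lam n (eps R n) x"
      using retract_form[OF free_mod_module eps_quad lin_mapsD(1)[OF s[OF V]] rs[OF V]] by simp
    also have "\<dots> = tval ?V (eps R n) x"
      by (rule lam_T[OF eps_T x])
    also have "\<dots> = c n (far F ?V ?V ?I x)"
      by (rule tval_eq[OF V I _ x]) (simp add: eps_ip)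
    also have "far F ?V ?V ?I x = x"
      by (rule F_id[OF V x I]) simp
    finally show ?thesis .
  qed
  then show ?thesis
    using L(1) by blast
qed

end

text \<open>Injectivity of the composite passes to \<open>h\<close>; as \<open>h\<close> is onto, it
  also passes to \<open>k\<close>.\<close>

lemma surj_chain_iso:
  assumes h: "h \<in> hom A B" "h ` carrier A = carrier B" and k: "k \<in> hom B C" "k ` carrier B = carrier C"
    and inj: "inj_on (k \<circ> h) (carrier A)"
  shows "h \<in> iso A B" "inj_on k (carrier B)"
proof -
  have "inj_on h (carrier A)"
    using inj by (rule inj_on_imageI2)
  then show "h \<in> iso A B"
    using h by (simp add: iso_def bij_betw_def)
  show "inj_on k (carrier B)"
    using inj by (metis h(2) inj_on_imageI)
qed

theorem mainTheorem7:
  fixes R :: "'a ring"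
    and F :: "('a pobj, 'a parr, 'g) ab_functor"
  assumes "cring R"
    and "\<one>\<^bsub>R\<^esub> \<oplus>\<^bsub>R\<^esub> \<one>\<^bsub>R\<^esub> \<in> Units R"
    and "Rq R = carrier R"
    and "is_functor (proj_cat R) F"
    and "analytic TYPE('j \<times> 'k \<times> 'h) R F"
  shows "\<exists>\<alpha> \<beta> \<gamma> \<delta>.
      is_stabilisation_map R F \<alpha> \<and>
      \<alpha> \<in> iso (colim nat_cat (coinv_system R F)) (H0 (HT R) (i_star (pi_star F))) \<and>
      is_inclusion_map R F \<beta> \<and>
      \<beta> \<in> iso (H0 (HT R) (i_star (pi_star F))) (H0 (AT R) (pi_star F)) \<and>
      is_fibration_map R F \<gamma> \<and>
      \<gamma> \<in> iso (H0 (AT R) (pi_star F)) (tensor (proj_cat R) (Z_forms (T_forms R)) F) \<and>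
      is_forms_map R F \<delta> \<and>
      \<delta> \<in> iso (tensor (proj_cat R) (Z_forms (T_forms R)) F)
              (tensor (proj_cat R) (Z_forms (quad_forms R)) F) \<and>
      \<delta> \<circ> \<gamma> \<circ> \<beta> \<circ> \<alpha> \<in> iso (colim nat_cat (coinv_system R F))
                          (tensor (proj_cat R) (Z_forms (quad_forms R)) F)"
proof -
  interpret functor_over_half_cring R F
    by (intro functor_over_half_cring.intro half_cring.intro half_cring_axioms.intro
        functor_over_half_cring_axioms.intro assms(1,2,4))
  have fd: "\<exists>r. finite_degree R F m r x" if "x \<in> carrier (fob F (free_mod R m))" for m x
    by (rule analytic_finite_degree[OF assms(5) that])
  interpret E: euclidean_invariant R F coinv_colim stable_class
    by (intro euclidean_invariant.intro euclidean_invariant_axioms.intro stable_class_invariant assms(3) fd)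
  let ?C = coinv_colim and ?H = "H0 (HT R) (i_star (pi_star F))" and ?A = "H0 (AT R) (pi_star F)"
    and ?T = "Z_tensor (T_forms R)" and ?Q = "Z_tensor (quad_forms R)"
  obtain \<alpha> where \<alpha>: "is_stabilisation_map R F \<alpha>" "\<alpha> ` carrier ?C = carrier ?H"
    using stabilisation_exists by blast
  obtain \<beta> where \<beta>: "is_inclusion_map R F \<beta>" "\<beta> ` carrier ?H = carrier ?A"
    using inclusion_exists by blast
  obtain \<gamma> where \<gamma>: "is_fibration_map R F \<gamma>" "\<gamma> ` carrier ?A = carrier ?T"
    using fibration_exists by blast
  obtain \<delta> where \<delta>: "is_forms_map R F \<delta>"
    using forms_map_exists by blast
  have \<delta>s: "\<delta> ` carrier ?T = carrier ?Q"
    by (rule forms_map_surj[OF \<delta> fd])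
  have \<alpha>h: "\<alpha> \<in> hom ?C ?H" and \<beta>h: "\<beta> \<in> hom ?H ?A" and \<gamma>h: "\<gamma> \<in> hom ?A ?T" and \<delta>h: "\<delta> \<in> hom ?T ?Q"
    using \<alpha>(1) \<beta>(1) \<gamma>(1) \<delta>
    by (simp_all only: is_stabilisation_map_def is_inclusion_map_def is_fibration_map_def is_forms_map_def)
  \<comment> \<open>The composite sends the stable class of x to [eps_n] tensor x, and
    \<open>L\<close> sends this back.\<close>
  obtain L where L: "L \<in> hom ?Q ?C" "\<And>n x. x \<in> carrier (fob F (free_mod R n)) \<Longrightarrow>
      L (Z_class (quad_forms R) (free_mod R n) (frag_of (eps R n)) x) = stable_class n x"
    using E.lam_tensor by blast
  let ?f = "\<delta> \<circ> \<gamma> \<circ> \<beta> \<circ> \<alpha>"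
  have fh: "?f \<in> hom ?C ?Q"
    using Group.hom_compose[OF \<alpha>h Group.hom_compose[OF \<beta>h Group.hom_compose[OF \<gamma>h \<delta>h]]]
    by (simp add: comp_assoc)
  have f: "?f (stable_class n x) = Z_class (quad_forms R) (free_mod R n) (frag_of (eps R n)) x"
    if x: "x \<in> carrier (fob F (free_mod R n))" for n x
  proof -
    let ?V = "free_mod R n" and ?e = "eps R n"
    have "\<alpha> (stable_class n x) = colim_class (HT R) (i_star (pi_star F)) (?V, ?e) x"
      using \<alpha>(1) x unfolding is_stabilisation_map_def by blast
    moreover have "\<beta> (colim_class (HT R) (i_star (pi_star F)) (?V, ?e) x) = colim_class (AT R) (pi_star F) (?V, ?e) x"
      using \<beta>(1) eps_Ob_HT x unfolding is_inclusion_map_def by blast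
    moreover have "\<gamma> (colim_class (AT R) (pi_star F) (?V, ?e) x) = Z_class (T_forms R) ?V (frag_of ?e) x"
      using \<gamma>(1) eps_Ob_AT x unfolding is_fibration_map_def by blast
    moreover have "\<delta> (Z_class (T_forms R) ?V (frag_of ?e) x) = Z_class (quad_forms R) ?V (frag_of ?e) x"
      using \<delta> free_mod_Ob x frag_of_in_free_Abelian_group[THEN iffD2, OF eps_T]
      unfolding is_forms_map_def by blast
    ultimately show ?thesis
      by simp
  qed
  interpret C: comm_group ?C by (rule E.G)
  have gC: "group_hom ?C ?C (L \<circ> ?f)"
    by (rule comm_group_hom_group_hom[OF E.G E.G Group.hom_compose[OF fh L(1)]])
  \<comment> \<open>Both sides are homomorphisms, so it is enough to compare them on stable classes,
    which generate the colimit.\<close>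
  have Lf: "(L \<circ> ?f) z = z" if z: "z \<in> carrier ?C" for z
  proof (rule colim_induct[OF coinv_functor z])
    show "(L \<circ> ?f) \<one>\<^bsub>?C\<^esub> = \<one>\<^bsub>?C\<^esub>"
      by (rule group_hom.hom_one[OF gC])
    show "(L \<circ> ?f) (x \<otimes>\<^bsub>?C\<^esub> inv\<^bsub>?C\<^esub> y) = x \<otimes>\<^bsub>?C\<^esub> inv\<^bsub>?C\<^esub> y"
      if "x \<in> carrier ?C" "y \<in> carrier ?C" "(L \<circ> ?f) x = x" "(L \<circ> ?f) y = y" for x y
      using that group_hom.hom_mult[OF gC, of x "inv\<^bsub>?C\<^esub> y"] group_hom.hom_inv[OF gC, of y]
      by (simp del: comp_apply)
    fix n X assume "X \<in> carrier (fob (coinv_system R F) n)"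
    then obtain x where "x \<in> carrier (fob F (free_mod R n))" "X = coinv_class R F n x"
      by (rule coinv_carrier)
    then show "(L \<circ> ?f) (colim_class nat_cat (coinv_system R F) n X) = colim_class nat_cat (coinv_system R F) n X"
      using f L(2) by simp
  qed
  have inj: "inj_on ?f (carrier ?C)"
    by (rule inj_on_inverseI[where g = L]) (use Lf in simp)
  have i\<gamma>: "\<delta> \<circ> \<gamma> \<in> hom ?A ?Q" "(\<delta> \<circ> \<gamma>) ` carrier ?A = carrier ?Q"
    and i\<beta>: "\<delta> \<circ> \<gamma> \<circ> \<beta> \<in> hom ?H ?Q" "(\<delta> \<circ> \<gamma> \<circ> \<beta>) ` carrier ?H = carrier ?Q"
    and f_surj: "?f ` carrier ?C = carrier ?Q"
    using Group.hom_compose[OF \<gamma>h \<delta>h] Group.hom_compose[OF \<beta>h Group.hom_compose[OF \<gamma>h \<delta>h]]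
    by (simp_all only: image_comp[symmetric] \<alpha>(2) \<beta>(2) \<gamma>(2) \<delta>s)
  \<comment> \<open>The surjections \<alpha>, \<beta>, \<gamma> are split off in turn; each time the
    rest of the composite remains injective, until \<delta> is left.\<close>
  note 1 = surj_chain_iso[OF \<alpha>h \<alpha>(2) i\<beta> inj]
  note 2 = surj_chain_iso[OF \<beta>h \<beta>(2) i\<gamma> 1(2)]
  note 3 = surj_chain_iso[OF \<gamma>h \<gamma>(2) \<delta>h \<delta>s 2(2)]
  have "\<delta> \<in> iso ?T ?Q"
    using \<delta>h \<delta>s 3(2) by (simp add: iso_def bij_betw_def)
  moreover have "?f \<in> iso ?C ?Q"
    using fh inj f_surj by (simp only: iso_def bij_betw_def mem_Collect_eq simp_thms)
  ultimately show ?thesis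
    using \<alpha>(1) \<beta>(1) \<gamma>(1) \<delta> 1(1) 2(1) 3(1) by blast
qed

end
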